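(* Let $\mathcal{D}$ be a distribution on $\mathbb{R}^n$ with mean $\mu$ and covariance $\Sigma$ satisfying the following concentration inequality: there exists a constant $\gamma>0$ such that for every unit vector $v$ and every $t\ge 0$, $$\Pr_{x\sim\mathcal{D}}\left(\left|(x-\mu)^Tv\right|>t\sqrt{v^T\Sigma v}\right)\le e^{-t^\gamma}.$$ Assume $\eta$ is less than a universal constant. Then there is an algorithm that runs in $\mathrm{poly}(n,\log\frac1\eta)$ time, takes as input $\eta$ and $m=O\left(\frac{n^3(\log (n/\eta))^2\log n}{\eta^2}\right)$ independent samples $x_1,\dots,x_m\sim\mathcal{D}_\eta$, and computes $\widehat\lambda_{\max}$ such that, with probability $1-1/\mathrm{poly}(n)$, $$(1-O(\eta))\,\|\Sigma\|_2\le\widehat\lambda_{\max}\le\left(1+O\left(\eta\log^{2/\gamma}(n/\eta)\right)\right)\|\Sigma\|_2 .$$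
   Context: Noise model: for a distribution $\mathcal{D}$ on $\mathbb{R}^n$ and $\eta\in(0,1)$, the notation $x_1,\dots,x_m\sim\mathcal{D}_\eta$ means that each $x_i$ is, with probability $1-\eta$, sampled independently from $\mathcal{D}$, and with probability $\eta$ is chosen by an adversary (it is completely arbitrary; no assumption is made on it). $\|\Sigma\|_2$ is the operator norm. $\gamma$ is treated as a constant.
   Formalization: The running time poly(n, log 1/η) is impossible as stated, since about 1/η² samples (up to logs) must be read; the bound proved is (m+1)·poly(n, log 1/η) exact real-arithmetic steps, that is, poly(n, log 1/η) per input sample. *)

theory Defs
  imports "HOL-Probability.Probability"
begin

section \<open>A real RAM\<close>

text \<open>
  The input consists of real vectors, so running time is measured on a real RAM, given here as a
  WHILE language over two memories: one with natural numbers (also used for indexing) and one with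
  reals. Arithmetic and comparisons are exact and have unit cost; as in the Blum-Shub-Smale model,
  a program may contain finitely many real constants. There are no roots, no logarithms and no
  rounding of reals to naturals.

  A program is one fixed syntactic object, so in particular the same program serves all dimensions
  and all sample sizes.
\<close>

datatype nexp =
    NConst nat
  | NCell nexp
  | NAdd nexp nexp
  | NSub nexp nexp
  | NMul nexp nexp

datatype rexp =
    RConst real
  | RCell nexp
  | ROfNat nexp
  | RAdd rexp rexp
  | RSub rexp rexp
  | RMul rexp rexp
  | RDiv rexp rexp

datatype test =
    NLess nexp nexp
  | RLess rexp rexp
  | Neg test
  | Conj test test

datatype prog =
    Skip
  | NStore nexp nexp
  | RStore nexp rexp
  | Seq prog prog
  | Cond test prog prog
  | Loop test prog

type_synonym state = "(nat \<Rightarrow> nat) \<times> (nat \<Rightarrow> real)"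

fun nval :: "nexp \<Rightarrow> state \<Rightarrow> nat" where
  "nval (NConst k) s = k"
| "nval (NCell a) s = fst s (nval a s)"
| "nval (NAdd a b) s = nval a s + nval b s"
| "nval (NSub a b) s = nval a s - nval b s"
| "nval (NMul a b) s = nval a s * nval b s"

fun rval :: "rexp \<Rightarrow> state \<Rightarrow> real" where
  "rval (RConst c) s = c"
| "rval (RCell a) s = snd s (nval a s)"
| "rval (ROfNat a) s = real (nval a s)"
| "rval (RAdd a b) s = rval a s + rval b s"
| "rval (RSub a b) s = rval a s - rval b s"
| "rval (RMul a b) s = rval a s * rval b s"
| "rval (RDiv a b) s = rval a s / rval b s"

fun tval :: "test \<Rightarrow> state \<Rightarrow> bool" where
  "tval (NLess a b) s \<longleftrightarrow> nval a s < nval b s"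
| "tval (RLess a b) s \<longleftrightarrow> rval a s < rval b s"
| "tval (Neg b) s \<longleftrightarrow> \<not> tval b s"
| "tval (Conj a b) s \<longleftrightarrow> tval a s \<and> tval b s"

text \<open>
  \<open>exec p s t s'\<close>: started in \<open>s\<close>, the program \<open>p\<close> halts in \<open>s'\<close> after \<open>t\<close> steps. Every store and
  every test counts as one step; since the expressions occurring in a fixed program have bounded
  size, this agrees with the number of arithmetic operations up to a constant factor.
\<close>

inductive exec :: "prog \<Rightarrow> state \<Rightarrow> nat \<Rightarrow> state \<Rightarrow> bool" where
  Skip: "exec Skip s 1 s"
| NStore: "exec (NStore a e) s 1 ((fst s)(nval a s := nval e s), snd s)"
| RStore: "exec (RStore a e) s 1 (fst s, (snd s)(nval a s := rval e s))"
| Seq: "exec p s t s' \<Longrightarrow> exec q s' u s'' \<Longrightarrow> exec (Seq p q) s (t + u) s''"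
| CondTrue: "tval b s \<Longrightarrow> exec p s t s' \<Longrightarrow> exec (Cond b p q) s (Suc t) s'"
| CondFalse: "\<not> tval b s \<Longrightarrow> exec q s t s' \<Longrightarrow> exec (Cond b p q) s (Suc t) s'"
| LoopFalse: "\<not> tval b s \<Longrightarrow> exec (Loop b p) s 1 s"
| LoopTrue: "tval b s \<Longrightarrow> exec p s t s' \<Longrightarrow> exec (Loop b p) s' u s'' \<Longrightarrow>
    exec (Loop b p) s (Suc (t + u)) s''"

inductive_cases exec_SkipE: "exec Skip s t s'"
inductive_cases exec_NStoreE: "exec (NStore a e) s t s'"
inductive_cases exec_RStoreE: "exec (RStore a e) s t s'"
inductive_cases exec_SeqE: "exec (Seq p q) s t s'"
inductive_cases exec_CondE: "exec (Cond b p q) s t s'"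
inductive_cases exec_LoopE: "exec (Loop b p) s t s'"

lemma exec_deterministic:
  "exec p s t s' \<Longrightarrow> exec p s u s'' \<Longrightarrow> t = u \<and> s' = s''"
proof (induction arbitrary: u s'' rule: exec.induct)
  case (Skip s)
  then show ?case by (auto elim: exec_SkipE)
next
  case (NStore a e s)
  then show ?case by (auto elim: exec_NStoreE)
next
  case (RStore a e s)
  then show ?case by (auto elim: exec_RStoreE)
next
  case (Seq p s t s' q u s'')
  from Seq.prems show ?case by (rule exec_SeqE) (use Seq.IH in blast)
next
  case (CondTrue b s p t s' q)
  from CondTrue.prems show ?case by (rule exec_CondE) (use CondTrue in blast)+
next
  case (CondFalse b s q t s' p)
  from CondFalse.prems show ?case by (rule exec_CondE) (use CondFalse in blast)+
next
  case (LoopFalse b s p)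
  from LoopFalse.prems show ?case by (rule exec_LoopE) (use LoopFalse in auto)
next
  case (LoopTrue b s p t s' u s'')
  from LoopTrue.prems show ?case by (rule exec_LoopE) (use LoopTrue in blast)+
qed

text \<open>
  Input: \<open>n\<close> and \<open>m\<close> in the first two natural-number cells, \<open>\<eta>\<close> in the first real cell, followed by
  the \<open>m\<close> sample points, each occupying \<open>n\<close> consecutive cells. The output is the first real cell.
\<close>

definition input_state :: "nat \<Rightarrow> nat \<Rightarrow> real \<Rightarrow> (nat \<Rightarrow> nat \<Rightarrow> real) \<Rightarrow> state" where
  "input_state n m \<eta> x =
    ((\<lambda>k. if k = 0 then n else if k = 1 then m else 0),
     (\<lambda>k. if k = 0 then \<eta> else if k \<le> m * n then x ((k - 1) div n) ((k - 1) mod n) else 0))"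

definition computes ::
  "prog \<Rightarrow> nat \<Rightarrow> nat \<Rightarrow> real \<Rightarrow> (nat \<Rightarrow> nat \<Rightarrow> real) \<Rightarrow> nat \<Rightarrow> real \<Rightarrow> bool" where
  "computes p n m \<eta> x t y \<longleftrightarrow> (\<exists>s. exec p (input_state n m \<eta> x) t s \<and> snd s 0 = y)"


section \<open>Distributions on n-dimensional space\<close>

text \<open>
  One program has to work for all dimensions, so the dimension cannot be a type: a vector is a
  function of which only the values at \<open>i < n\<close> matter.
\<close>

definition distribution_on :: "nat \<Rightarrow> (nat \<Rightarrow> real) measure \<Rightarrow> bool" where
  "distribution_on n D \<longleftrightarrow> prob_space D \<and> sets D = sets (PiM {..<n} (\<lambda>_. borel :: real measure))"

definition has_mean_and_covariance ::
  "nat \<Rightarrow> (nat \<Rightarrow> real) measure \<Rightarrow> (nat \<Rightarrow> real) \<Rightarrow> (nat \<Rightarrow> nat \<Rightarrow> real) \<Rightarrow> bool" where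
  "has_mean_and_covariance n D \<mu> S \<longleftrightarrow>
    (\<forall>i<n. has_bochner_integral D (\<lambda>x. x i) (\<mu> i)) \<and>
    (\<forall>i<n. \<forall>j<n. has_bochner_integral D (\<lambda>x. (x i - \<mu> i) * (x j - \<mu> j)) (S i j))"

definition concentrated ::
  "nat \<Rightarrow> (nat \<Rightarrow> real) measure \<Rightarrow> (nat \<Rightarrow> real) \<Rightarrow> (nat \<Rightarrow> nat \<Rightarrow> real) \<Rightarrow> real \<Rightarrow> bool" where
  "concentrated n D \<mu> S \<gamma> \<longleftrightarrow>
    (\<forall>v. L2_set v {..<n} = 1 \<longrightarrow> (\<forall>t\<ge>0.
      measure D {x \<in> space D.
        \<bar>\<Sum>i<n. (x i - \<mu> i) * v i\<bar> > t * sqrt (\<Sum>i<n. \<Sum>j<n. v i * S i j * v j)}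
      \<le> exp (- (t powr \<gamma>))))"

definition operator_norm :: "nat \<Rightarrow> (nat \<Rightarrow> nat \<Rightarrow> real) \<Rightarrow> real" where
  "operator_norm n S =
    (SUP v\<in>{v. L2_set v {..<n} = 1}. L2_set (\<lambda>i. \<Sum>j<n. S i j * v j) {..<n})"


section \<open>The noise model\<close>

text \<open>
  An outcome assigns to each index \<open>i < m\<close> an independent pair of a coin, which is \<open>True\<close> with
  probability \<open>\<eta>\<close>, and an independent draw from \<open>D\<close>. If the coin is \<open>True\<close>, the draw is replaced by
  a point chosen by the adversary. The adversary is an arbitrary, not necessarily measurable,
  function of the entire outcome: it knows all coins and all draws.
\<close>

definition noise_space ::
  "nat \<Rightarrow> real \<Rightarrow> (nat \<Rightarrow> real) measure \<Rightarrow> (nat \<Rightarrow> bool \<times> (nat \<Rightarrow> real)) measure" where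
  "noise_space m \<eta> D = PiM {..<m} (\<lambda>_. measure_pmf (bernoulli_pmf \<eta>) \<Otimes>\<^sub>M D)"

definition noisy_samples ::
  "((nat \<Rightarrow> bool \<times> (nat \<Rightarrow> real)) \<Rightarrow> nat \<Rightarrow> nat \<Rightarrow> real) \<Rightarrow>
   (nat \<Rightarrow> bool \<times> (nat \<Rightarrow> real)) \<Rightarrow> nat \<Rightarrow> nat \<Rightarrow> real" where
  "noisy_samples adv \<omega> i = (if fst (\<omega> i) then adv \<omega> i else snd (\<omega> i))"

text \<open>
  Because of the arbitrary adversary the event in question need not be measurable; its probability
  is bounded from below by that of a measurable subevent.
\<close>

definition with_prob_at_least :: "'a measure \<Rightarrow> real \<Rightarrow> ('a \<Rightarrow> bool) \<Rightarrow> bool" where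
  "with_prob_at_least M p P \<longleftrightarrow> (\<exists>E\<in>sets M. p \<le> measure M E \<and> (\<forall>\<omega>\<in>E. P \<omega>))"

end

theory Submission
  imports Defs "HOL-Real_Asymp.Real_Asymp"
begin

text \<open>
  Differences of two samples have mean zero, covariance \<open>2 \<Sigma>\<close> and, up to a factor, the same tails.
  For a direction \<open>v\<close>, a fixed upper quantile of \<open>(v \<bullet> y)\<^sup>2\<close> over a small batch of differences \<open>y\<close>
  estimates \<open>v\<^sup>T \<Sigma> v\<close> up to a constant. The algorithm deletes from the main batch all \<open>y\<close> for which
  \<open>(v \<bullet> y)\<^sup>2\<close> exceeds a threshold of order \<open>log\<^bsup>2/\<gamma>\<^esup>(n/\<eta>)\<close> times this estimate, first for the unit
  vectors and then, \<open>n\<close> times, for the columns of a high power of the current second moment matrix \<open>M\<close>;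
  its output is the Rayleigh quotient of \<open>M\<close> averaged over the columns of the last power.

  Upper bound: after the first round, the trace of the outliers' second moment matrix is at most \<open>n\<close>
  times the target error, and as long as \<open>M\<close> has too large an eigenvalue, one of the columns is a
  direction in which the outliers dominate, so that each round lowers this trace by more than the
  target error. Hence \<open>n\<close> rounds suffice.

  Lower bound: directions are rounded to a grid, so a union bound over the grid shows that each
  direction deletes at most \<open>n\<close> inliers, and \<open>O(n\<^sup>3)\<close> inliers are deleted in total. By Cauchy-Schwarz and
  a bound on the empirical fourth moment this costs a fraction \<open>O(\<eta>)\<close> of the variance in any fixed
  direction, since the sample size is at least \<open>n\<^sup>3/\<eta>\<^sup>2\<close>.
\<close>

section \<open>Quadratic forms and power iteration\<close>


text \<open>Taking differences removes the unknown mean. The directions depend on the adversary's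
  points, so a bound for a fixed direction does not apply to them; this is why they are rounded to a
  grid with at most \<open>2 ^ (b * n)\<close> vectors, where \<open>2 ^ b\<close> is about
  \<open>n / \<eta>\<close>. The cut-off corresponds to a tail of \<open>exp (- 6 * b)\<close> per
  difference, so that \<open>n\<close> inliers beyond it are unlikely enough for a union bound over
  the grid. The running time must be polynomial in \<open>n\<close> and
  \<open>ln (1 / \<eta>)\<close> per sample, while ranks are found by comparing all pairs; hence
  quantiles come from a separate batch of only about \<open>n * b\<close> differences. The machine
  has no roots: directions are scaled by their largest entry, and the bounds in a direction
  \<open>v\<close> are stated homogeneously, with the factor \<open>dot n v v\<close>. The order
  \<open>n ^ 3 / \<eta> ^ 2\<close> of the sample size is also what Chebyshev's inequality takes to
  control all \<open>n ^ 2\<close> entries of the inliers' second moment matrix, up to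
  \<open>\<eta>\<close> in Frobenius norm and with failure probability of order
  \<open>1 / n\<close>.\<close>

definition dot :: "nat \<Rightarrow> (nat \<Rightarrow> real) \<Rightarrow> (nat \<Rightarrow> real) \<Rightarrow> real" where
  "dot n u v = (\<Sum>k<n. u k * v k)"

definition mv :: "nat \<Rightarrow> (nat \<Rightarrow> nat \<Rightarrow> real) \<Rightarrow> (nat \<Rightarrow> real) \<Rightarrow> nat \<Rightarrow> real" where
  "mv n M v = (\<lambda>i. \<Sum>j<n. M i j * v j)"

definition mm :: "nat \<Rightarrow> (nat \<Rightarrow> nat \<Rightarrow> real) \<Rightarrow> (nat \<Rightarrow> nat \<Rightarrow> real) \<Rightarrow> nat \<Rightarrow> nat \<Rightarrow> real" where
  "mm n A B = (\<lambda>i j. \<Sum>k<n. A i k * B k j)"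

text \<open>Repeated squaring: the power of \<open>M\<close> with exponent \<open>2 ^ b\<close>. In
  the application \<open>2 ^ b\<close> is at least \<open>n / \<eta>\<close>, which is enough for
  the columns to stand in for a top eigenvector.\<close>

primrec pw :: "nat \<Rightarrow> (nat \<Rightarrow> nat \<Rightarrow> real) \<Rightarrow> nat \<Rightarrow> nat \<Rightarrow> nat \<Rightarrow> real" where
  "pw n M 0 = M"
| "pw n M (Suc b) = mm n (pw n M b) (pw n M b)"

definition qf :: "nat \<Rightarrow> (nat \<Rightarrow> nat \<Rightarrow> real) \<Rightarrow> (nat \<Rightarrow> real) \<Rightarrow> real" where
  "qf n M v = dot n v (mv n M v)"

definition unit_vec :: "nat \<Rightarrow> nat \<Rightarrow> real" where
  "unit_vec j = (\<lambda>k. if k = j then 1 else 0)"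

lemma dot_commute: "dot n u v = dot n v u"
  by (simp add: dot_def mult.commute)

lemma dot_self_nonneg: "0 \<le> dot n v v"
  by (auto simp: dot_def intro: sum_nonneg)

lemma dot_add_left: "dot n (\<lambda>k. u k + z * w k) v = dot n u v + z * dot n w v"
  by (simp add: dot_def algebra_simps sum.distrib sum_distrib_left)

lemma dot_add_right: "dot n v (\<lambda>k. u k + z * w k) = dot n v u + z * dot n v w"
  by (simp add: dot_def algebra_simps sum.distrib sum_distrib_left)

lemma mv_add: "mv n M (\<lambda>k. u k + z * w k) = (\<lambda>k. mv n M u k + z * mv n M w k)"
  by (simp add: mv_def algebra_simps sum.distrib sum_distrib_left)

lemma mv_mm: "mv n (mm n A B) v = mv n A (mv n B v)"
proof
  fix i
  have "mv n (mm n A B) v i = (\<Sum>j<n. \<Sum>k<n. A i k * B k j * v j)"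
    by (simp add: mv_def mm_def sum_distrib_right)
  also have "\<dots> = (\<Sum>k<n. \<Sum>j<n. A i k * B k j * v j)"
    by (rule sum.swap)
  finally show "mv n (mm n A B) v i = mv n A (mv n B v) i"
    by (simp add: mv_def sum_distrib_left mult.assoc)
qed

lemma mv_pw: "mv n (pw n M b) = (mv n M ^^ (2 ^ b))"
proof (induction b)
  case (Suc b)
  have "mv n (pw n M (Suc b)) = mv n (pw n M b) \<circ> mv n (pw n M b)"
    by (auto simp: mv_mm)
  also have "\<dots> = mv n M ^^ (2 ^ b + 2 ^ b)"
    by (simp add: Suc funpow_add)
  finally show ?case by (simp add: mult_2)
qed simp

lemma dot_unit_vec: "j < n \<Longrightarrow> dot n (unit_vec j) v = v j"
  by (simp add: dot_def unit_vec_def if_distrib[of "\<lambda>x. x * _"] sum.delta cong: if_cong)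

lemma mv_unit_vec: "j < n \<Longrightarrow> mv n M (unit_vec j) = (\<lambda>i. M i j)"
  by (rule ext) (simp add: mv_def unit_vec_def if_distrib[of "\<lambda>x. _ * x"] sum.delta cong: if_cong)

lemma qf_le_if_unit:
  assumes "\<And>x. dot n x x = 1 \<Longrightarrow> qf n M x \<le> B"
  shows "qf n M v \<le> B * dot n v v"
proof (cases "dot n v v = 0")
  case True
  then have "(\<Sum>k<n. (v k)\<^sup>2) = 0" by (simp add: dot_def power2_eq_square)
  then have "\<forall>k<n. v k = 0" by (subst (asm) sum_nonneg_eq_0_iff) auto
  then have "qf n M v = 0" by (simp add: qf_def dot_def)
  then show ?thesis using True by simp
next
  case False
  then have pos: "dot n v v > 0" using dot_self_nonneg[of n v] by linarith
  define d where "d = sqrt (dot n v v)"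
  have d: "d > 0" "d\<^sup>2 = dot n v v" using pos by (auto simp: d_def)
  have sc: "dot n (\<lambda>k. v k / d) (\<lambda>k. v k / d) = dot n v v / d\<^sup>2"
    "qf n M (\<lambda>k. v k / d) = qf n M v / d\<^sup>2"
    by (simp_all add: qf_def dot_def mv_def power2_eq_square sum_divide_distrib[symmetric])
  have "qf n M (\<lambda>k. v k / d) \<le> B" by (rule assms) (use d pos sc in auto)
  then have "qf n M v / d\<^sup>2 * d\<^sup>2 \<le> B * d\<^sup>2" unfolding sc by (rule mult_right_mono) simp
  then show ?thesis using d False by simp
qed

text \<open>Source of both the log-convexity of moments and Cauchy-Schwarz for semidefinite forms.
  No sign is assumed for \<open>a\<close> and \<open>c\<close>; nonnegativity at every
  \<open>z\<close> forces both to be nonnegative.\<close>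

lemma quadratic_nonneg_discr:
  fixes a b c :: real
  assumes "\<And>z. a + 2 * z * b + z\<^sup>2 * c \<ge> 0"
  shows "b\<^sup>2 \<le> a * c"
proof (cases "c = 0")
  case True
  have "b = 0"
  proof (rule ccontr)
    assume "b \<noteq> 0"
    with assms[of "- (a + 1) / (2 * b)"] True show False by (simp add: field_simps)
  qed
  then show ?thesis using True by simp
next
  case False
  have "a \<ge> 0" using assms[of 0] by simp
  have "c > 0"
  proof (rule ccontr)
    assume "\<not> c > 0"
    then have c: "c < 0" using False by simp
    \<comment> \<open>Far enough out for a negative \<open>c\<close> to win: \<open>z * c\<close> is
      at most \<open>- (2 * \<bar>b\<bar> + a + 1)\<close>, which makes the whole value at most
      \<open>- z\<close>.\<close>
    define z where "z = (2 * \<bar>b\<bar> + a + 1) / (- c) + 1"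
    have z1: "z \<ge> 1" using c \<open>a \<ge> 0\<close> by (simp add: z_def divide_nonneg_neg)
    have "z * (- c) = (2 * \<bar>b\<bar> + a + 1) + (- c)" using c by (simp add: z_def field_simps)
    then have "z * c \<le> - (2 * \<bar>b\<bar> + a + 1)" using c by linarith
    then have "z * (z * c) \<le> z * (- (2 * \<bar>b\<bar> + a + 1))" using z1 by (intro mult_left_mono) auto
    moreover have "2 * z * b \<le> z * (2 * \<bar>b\<bar>)" using z1 by simp
    moreover have "a \<le> z * a" using z1 \<open>a \<ge> 0\<close> mult_right_mono[of 1 z a] by simp
    ultimately have "a + 2 * z * b + z\<^sup>2 * c \<le> - z"
      by (simp add: power2_eq_square algebra_simps)
    then show False using assms[of z] z1 by linarith
  qed
  have "0 \<le> c * (a + 2 * (- b / c) * b + (- b / c)\<^sup>2 * c)"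
    using assms[of "- b / c"] \<open>c > 0\<close> by simp
  also have "\<dots> = a * c - b\<^sup>2"
    using False by (simp add: field_simps power2_eq_square)
  finally show ?thesis by simp
qed

text \<open>Eigenvalue-free form of a sum of terms w * lam ^ p with nonnegative w and lam. While the
  terms are positive, the ratios of consecutive terms do not decrease.\<close>

definition log_convex :: "(nat \<Rightarrow> real) \<Rightarrow> bool" where
  "log_convex a \<longleftrightarrow> (\<forall>p. 0 \<le> a p \<and> (a (Suc p))\<^sup>2 \<le> a p * a (Suc (Suc p)))"

text \<open>Every ratio of consecutive terms is at least the first one, which is \<open>a 1\<close>
  because \<open>a 0 = 1\<close>.\<close>

lemma log_convex_power_le:
  assumes "log_convex a" "a 0 = 1"
  shows "a 1 ^ p \<le> a p"
proof (cases "a 1 = 0")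
  case True
  then show ?thesis using assms by (cases p) (auto simp: log_convex_def)
next
  case False
  then have a1: "a 1 > 0" using assms(1) by (auto simp: log_convex_def less_le)
  have "0 < a p \<and> a 1 * a p \<le> a (Suc p)" for p
  proof (induction p)
    case 0
    then show ?case using a1 assms(2) by simp
  next
    case (Suc p)
    then have pos: "a (Suc p) > 0"
      using a1 mult_pos_pos[of "a 1" "a p"] by linarith
    have "a p * (a 1 * a (Suc p)) \<le> a (Suc p) * a (Suc p)"
      using Suc pos mult_right_mono[of "a 1 * a p" "a (Suc p)" "a (Suc p)"]
      by (simp add: algebra_simps)
    also have "\<dots> \<le> a p * a (Suc (Suc p))"
      using assms(1) by (simp add: log_convex_def power2_eq_square)
    finally show ?case using Suc pos by simp
  qed note step = this
  show ?thesis
  proof (induction p)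
    case (Suc p)
    have "a 1 ^ Suc p \<le> a 1 * a p" using Suc a1 by simp
    then show ?case using step[of p] by linarith
  qed (simp add: assms)
qed

text \<open>The geometric mean of the first \<open>p\<close> ratios, whose product is
  \<open>a p / a 0\<close>, does not exceed the next ratio \<open>a (Suc p) / a p\<close>. The
  inequality is multiplied out so that zero terms are allowed.\<close>

lemma log_convex_last_ratio:
  assumes "log_convex a"
  shows "a p ^ Suc p \<le> a (Suc p) ^ p * a 0"
proof (induction p)
  case (Suc p)
  have nn: "\<And>q. 0 \<le> a q" and lc: "(a (Suc p))\<^sup>2 \<le> a p * a (Suc (Suc p))"
    using assms by (auto simp: log_convex_def)
  show ?case
  proof (cases "a p = 0")
    case True
    then have "a (Suc p) = 0" using lc by simp
    then show ?thesis using nn by simp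
  next
    case False
    then have pos: "a p > 0" using nn[of p] by linarith
    have "a p ^ Suc p * a (Suc p) ^ Suc (Suc p) \<le> (a (Suc p) ^ p * a 0) * a (Suc p) ^ Suc (Suc p)"
      using Suc nn by (intro mult_right_mono) auto
    also have "\<dots> = ((a (Suc p))\<^sup>2) ^ Suc p * a 0"
      by (simp add: power_mult[symmetric] power_add[symmetric] mult_2 power2_eq_square power_mult_distrib algebra_simps)
    also have "\<dots> \<le> (a p * a (Suc (Suc p))) ^ Suc p * a 0"
      using lc nn by (intro mult_right_mono power_mono) auto
    also have "\<dots> = a p ^ Suc p * (a (Suc (Suc p)) ^ Suc p * a 0)"
      by (simp only: power_mult_distrib mult.assoc)
    finally show ?thesis using pos by (simp del: power_Suc)
  qed
qed simp

section \<open>Spectral moments of a positive semidefinite matrix\<close>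

locale psd_form =
  fixes n :: nat and M :: "nat \<Rightarrow> nat \<Rightarrow> real"
  assumes sym: "\<And>i j. i < n \<Longrightarrow> j < n \<Longrightarrow> M i j = M j i"
    and psd: "\<And>v. 0 \<le> qf n M v"
begin

lemma self_adjoint: "dot n (mv n M u) v = dot n u (mv n M v)"
proof -
  have "dot n (mv n M u) v = (\<Sum>i<n. \<Sum>j<n. M i j * u j * v i)"
    by (simp add: dot_def mv_def sum_distrib_right)
  also have "\<dots> = (\<Sum>j<n. \<Sum>i<n. M i j * u j * v i)"
    by (rule sum.swap)
  also have "\<dots> = (\<Sum>j<n. \<Sum>i<n. u j * (M j i * v i))"
    using sym by (intro sum.cong refl) auto
  finally show ?thesis by (simp add: dot_def mv_def sum_distrib_left)
qed

lemma self_adjoint_funpow: "dot n ((mv n M ^^ p) u) v = dot n u ((mv n M ^^ p) v)"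
  by (induction p arbitrary: u v) (simp_all add: self_adjoint funpow_swap1)

text \<open>The \<open>p\<close>-th moment of the spectral measure of \<open>x\<close>: in an
  eigenbasis, the sum of the \<open>p\<close>-th powers of the eigenvalues weighted by the squared
  coefficients of \<open>x\<close>.\<close>

definition mom :: "(nat \<Rightarrow> real) \<Rightarrow> nat \<Rightarrow> real" where
  "mom x p = dot n x ((mv n M ^^ p) x)"

lemma mom_even: "mom x (2 * p) = dot n ((mv n M ^^ p) x) ((mv n M ^^ p) x)"
  by (simp add: mom_def self_adjoint_funpow mult_2 funpow_add)

lemma mom_odd: "mom x (Suc (2 * p)) = qf n M ((mv n M ^^ p) x)"
  by (simp add: mom_def qf_def self_adjoint_funpow mult_2 funpow_add funpow_swap1)

lemma mom_nonneg: "0 \<le> mom x p"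
  by (metis (no_types) mom_even mom_odd dot_self_nonneg psd oddE evenE Suc_eq_plus1)

text \<open>Moving \<open>x\<close> along its image makes three consecutive moments the coefficients
  of a nonnegative quadratic polynomial in \<open>z\<close>; its discriminant condition is
  log-convexity.\<close>

lemma mom_shift: "mom (\<lambda>k. x k + z * mv n M x k) p = mom x p + 2 * z * mom x (Suc p) + z\<^sup>2 * mom x (Suc (Suc p))"
proof -
  have f: "(mv n M ^^ p) (\<lambda>k. x k + z * mv n M x k) =
      (\<lambda>k. (mv n M ^^ p) x k + z * (mv n M ^^ Suc p) x k)" for p
    by (induction p) (simp_all add: mv_add)
  show ?thesis
    unfolding mom_def f dot_add_left dot_add_right
    by (simp add: self_adjoint algebra_simps power2_eq_square funpow_swap1)
qed

lemma log_convex_sum_mom: "log_convex (\<lambda>p. \<Sum>x\<in>X. mom x p)"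
  unfolding log_convex_def
proof (intro allI conjI)
  fix p
  show "0 \<le> (\<Sum>x\<in>X. mom x p)" by (intro sum_nonneg mom_nonneg)
  show "(\<Sum>x\<in>X. mom x (Suc p))\<^sup>2 \<le> (\<Sum>x\<in>X. mom x p) * (\<Sum>x\<in>X. mom x (Suc (Suc p)))"
  proof (rule quadratic_nonneg_discr)
    fix z
    have "0 \<le> (\<Sum>x\<in>X. mom (\<lambda>k. x k + z * mv n M x k) p)" by (intro sum_nonneg mom_nonneg)
    then show "0 \<le> (\<Sum>x\<in>X. mom x p) + 2 * z * (\<Sum>x\<in>X. mom x (Suc p)) + z\<^sup>2 * (\<Sum>x\<in>X. mom x (Suc (Suc p)))"
      by (simp add: mom_shift sum.distrib sum_distrib_left)
  qed
qed

lemma log_convex_mom: "log_convex (mom x)"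
  using log_convex_sum_mom[of "{x}"] by simp

lemma qf_add: "qf n M (\<lambda>k. u k + z * w k) = qf n M u + 2 * z * dot n u (mv n M w) + z\<^sup>2 * qf n M w"
proof -
  have "dot n w (mv n M u) = dot n u (mv n M w)"
    by (subst self_adjoint[symmetric]) (rule dot_commute)
  then show ?thesis
    unfolding qf_def mv_add dot_add_left dot_add_right
    by (simp add: algebra_simps power2_eq_square)
qed

lemma cauchy_schwarz: "(dot n u (mv n M w))\<^sup>2 \<le> qf n M u * qf n M w"
  by (rule quadratic_nonneg_discr) (metis qf_add psd)

text \<open>The largest eigenvalue is at most the trace. Cauchy-Schwarz for unit vectors bounds
  \<open>\<bar>M i j\<bar>\<close> by \<open>sqrt (M i i) * sqrt (M j j)\<close>, after which the
  double sum is a square.\<close>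

lemma qf_le_trace: "qf n M u \<le> dot n u u * (\<Sum>j<n. M j j)"
proof -
  have diag: "qf n M (unit_vec j) = M j j" if "j < n" for j
    using that by (simp add: qf_def mv_unit_vec dot_unit_vec)
  have d0: "0 \<le> M j j" if "j < n" for j
    using psd[of "unit_vec j"] diag[OF that] by simp
  have entry: "\<bar>M i j\<bar> \<le> sqrt (M i i) * sqrt (M j j)" if "i < n" "j < n" for i j
    using cauchy_schwarz[of "unit_vec i" "unit_vec j"] that
    by (simp add: diag mv_unit_vec dot_unit_vec real_sqrt_mult[symmetric] real_le_rsqrt)
  have "qf n M u = (\<Sum>i<n. \<Sum>j<n. u i * M i j * u j)"
    by (simp add: qf_def dot_def mv_def sum_distrib_left mult.assoc)
  also have "\<dots> \<le> (\<Sum>i<n. \<Sum>j<n. (\<bar>u i\<bar> * sqrt (M i i)) * (\<bar>u j\<bar> * sqrt (M j j)))"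
  proof (intro sum_mono)
    fix i j assume ij: "i \<in> {..<n}" "j \<in> {..<n}"
    have "u i * M i j * u j \<le> \<bar>u i\<bar> * \<bar>M i j\<bar> * \<bar>u j\<bar>"
      by (metis abs_ge_self abs_mult)
    also have "\<dots> \<le> \<bar>u i\<bar> * (sqrt (M i i) * sqrt (M j j)) * \<bar>u j\<bar>"
      using entry ij by (intro mult_right_mono mult_left_mono) auto
    finally show "u i * M i j * u j \<le> (\<bar>u i\<bar> * sqrt (M i i)) * (\<bar>u j\<bar> * sqrt (M j j))"
      by (simp add: mult_ac)
  qed
  also have "\<dots> = (\<Sum>i<n. \<bar>u i\<bar> * sqrt (M i i))\<^sup>2"
    by (simp add: power2_eq_square sum_product)
  also have "\<dots> \<le> (\<Sum>i<n. \<bar>u i\<bar>\<^sup>2) * (\<Sum>i<n. (sqrt (M i i))\<^sup>2)"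
    by (rule Cauchy_Schwarz_ineq_sum)
  also have "\<dots> = dot n u u * (\<Sum>j<n. M j j)"
    using d0 by (simp add: dot_def power2_eq_square)
  finally show ?thesis .
qed

text \<open>The argument avoids eigenvalues: the traces of the powers of \<open>M\<close> form a log-convex sequence.\<close>

lemma power_method:
  assumes u: "dot n u u = 1" and lam: "0 < lam" "lam \<le> qf n M u"
    and \<delta>: "0 < \<delta>" "\<delta> < 1" "ln n \<le> \<delta> * (2 * 2 ^ b)"
  shows "(1 - \<delta>) * lam * (\<Sum>j<n. dot n (\<lambda>k. pw n M b k j) (\<lambda>k. pw n M b k j))
    \<le> (\<Sum>j<n. qf n M (\<lambda>k. pw n M b k j))" (is ?ratio)
    and "0 < (\<Sum>j<n. qf n M (\<lambda>k. pw n M b k j))" (is ?pos)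
proof -
  define P :: nat where "P = 2 ^ b"
  \<comment> \<open>The trace of the \<open>p\<close>-th power of \<open>M\<close>. The squared
    columns of the computed power sum to \<open>a (2 * P)\<close>, their quadratic forms to
    \<open>a (Suc (2 * P))\<close>.\<close>
  define a where "a = (\<lambda>p. \<Sum>j<n. mom (unit_vec j) p)"
  have inj: "inj_on unit_vec {..<n}" by (auto simp: inj_on_def unit_vec_def fun_eq_iff split: if_splits)
  have a: "log_convex a"
    using log_convex_sum_mom[of "unit_vec ` {..<n}"] by (simp add: a_def sum.reindex[OF inj])
  have n0: "n > 0" using u by (cases n) (auto simp: dot_def)
  have a0: "a 0 = n"
    by (simp add: a_def mom_def dot_unit_vec) (simp add: unit_vec_def)
  have col: "(\<lambda>k. pw n M b k j) = (mv n M ^^ P) (unit_vec j)" if "j < n" for j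
    using mv_unit_vec[OF that, of "pw n M b"] by (simp add: mv_pw P_def)
  have L: "(\<Sum>j<n. dot n (\<lambda>k. pw n M b k j) (\<lambda>k. pw n M b k j)) = a (2 * P)"
    by (simp add: a_def mom_even col)
  have R: "(\<Sum>j<n. qf n M (\<lambda>k. pw n M b k j)) = a (Suc (2 * P))"
    by (simp add: a_def mom_odd col)
  \<comment> \<open>The power with exponent \<open>Suc (2 * P)\<close> as a matrix, in a form whose
    symmetry is immediate; the trace bound for it gives
    \<open>lam ^ Suc (2 * P) \<le> a (Suc (2 * P))\<close>.\<close>
  define N where "N = (\<lambda>i j. dot n ((mv n M ^^ P) (unit_vec i)) (mv n M ((mv n M ^^ P) (unit_vec j))))"
  have Nij: "N i j = (mv n M ^^ Suc (2 * P)) (unit_vec j) i" if "i < n" for i j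
    using that by (simp add: N_def self_adjoint_funpow dot_unit_vec funpow_swap1[symmetric] mult_2 funpow_add)
  have mvN: "mv n N x i = (mv n M ^^ Suc (2 * P)) x i" if "i < n" for x i
  proof -
    have "mv n N x i = (\<Sum>j<n. dot n (unit_vec i) ((mv n M ^^ Suc (2 * P)) (unit_vec j)) * x j)"
      using that by (simp add: mv_def Nij dot_unit_vec del: funpow.simps)
    also have "\<dots> = (\<Sum>j<n. (mv n M ^^ Suc (2 * P)) (unit_vec i) j * x j)"
      by (intro sum.cong refl) (simp only: self_adjoint_funpow[symmetric],
          simp add: dot_commute[of n _ "unit_vec _"] dot_unit_vec del: funpow.simps)
    also have "\<dots> = dot n ((mv n M ^^ Suc (2 * P)) (unit_vec i)) x" by (simp add: dot_def)
    also have "\<dots> = (mv n M ^^ Suc (2 * P)) x i"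
      using that by (simp add: self_adjoint_funpow dot_unit_vec del: funpow.simps)
    finally show ?thesis .
  qed
  have qfN: "qf n N x = mom x (Suc (2 * P))" for x
    unfolding qf_def mom_def dot_def using mvN by (intro sum.cong) auto
  interpret N: psd_form n N
  proof
    show "N i j = N j i" for i j
      unfolding N_def by (subst self_adjoint[symmetric]) (rule dot_commute)
    show "0 \<le> qf n N v" for v by (simp add: qfN mom_nonneg)
  qed
  have "lam ^ Suc (2 * P) \<le> mom u 1 ^ Suc (2 * P)"
    using lam by (intro power_mono) (auto simp: mom_def qf_def)
  also have "\<dots> \<le> mom u (Suc (2 * P))"
    by (rule log_convex_power_le[OF log_convex_mom]) (simp add: mom_def u)
  also have "\<dots> = qf n N u" by (simp add: qfN)
  also have "\<dots> \<le> (\<Sum>j<n. N j j)" using N.qf_le_trace[of u] u by simp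
  also have "\<dots> = a (Suc (2 * P))"
    unfolding a_def mom_def by (intro sum.cong refl) (simp add: Nij dot_unit_vec del: funpow.simps)
  finally have big: "lam ^ Suc (2 * P) \<le> a (Suc (2 * P))" .
  have "(1 - \<delta>) * lam * a (2 * P) \<le> a (Suc (2 * P))"
  proof (rule ccontr)
    \<comment> \<open>A last ratio below \<open>(1 - \<delta>) * lam\<close> bounds the whole trace
      sequence, which starts at \<open>a 0 = n\<close>. This is compatible with the lower bound
      \<open>big\<close> only if \<open>n * (1 - \<delta>) ^ Suc (2 * P)\<close> exceeds 1, and the
      hypothesis on \<open>ln n\<close> excludes that.\<close>
    assume "\<not> ?thesis"
    then have lt: "a (Suc (2 * P)) < (1 - \<delta>) * lam * a (2 * P)" by simp
    have nn: "0 \<le> a p" for p using a by (simp add: log_convex_def)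
    have apos: "a (2 * P) > 0"
      using lt nn[of "2 * P"] nn[of "Suc (2 * P)"] by (cases "a (2 * P) = 0") auto
    have "lam ^ Suc (2 * P) * a (2 * P) ^ Suc (2 * P) \<le> a (Suc (2 * P)) * (a (Suc (2 * P)) ^ (2 * P) * n)"
      using big log_convex_last_ratio[OF a, of "2 * P"] a0 nn by (intro mult_mono) auto
    also have "\<dots> = n * a (Suc (2 * P)) ^ Suc (2 * P)" by simp
    also have "\<dots> < n * ((1 - \<delta>) * lam * a (2 * P)) ^ Suc (2 * P)"
      using lt nn n0 by (intro mult_strict_left_mono power_strict_mono) auto
    also have "\<dots> = (lam ^ Suc (2 * P) * a (2 * P) ^ Suc (2 * P)) * (n * (1 - \<delta>) ^ Suc (2 * P))"
      by (simp only: power_mult_distrib mult_ac)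
    finally have "1 < n * (1 - \<delta>) ^ Suc (2 * P)"
      using apos lam by (simp del: power_Suc)
    moreover have "n * (1 - \<delta>) ^ Suc (2 * P) \<le> 1"
    proof -
      have "(1 - \<delta>) ^ Suc (2 * P) \<le> exp (- \<delta>) ^ Suc (2 * P)"
        using \<delta> exp_ge_add_one_self[of "- \<delta>"] by (intro power_mono) auto
      also have "\<dots> = exp (- (\<delta> * Suc (2 * P)))"
        by (simp only: exp_of_nat_mult[symmetric]) (simp add: mult_ac)
      also have "\<dots> \<le> exp (- ln n)"
        using \<delta> by (auto simp: P_def algebra_simps)
      also have "\<dots> = 1 / n" using n0 by (simp add: exp_minus divide_inverse)
      finally have "n * (1 - \<delta>) ^ Suc (2 * P) \<le> n * (1 / n)"
        by (rule mult_left_mono) simp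
      then show ?thesis using n0 by simp
    qed
    ultimately show False by linarith
  qed
  then show ?ratio by (simp add: L R)
  show ?pos
    using big zero_less_power[OF lam(1), of "Suc (2 * P)"] unfolding R by linarith
qed

end


section \<open>The filtering algorithm\<close>


text \<open>Greedy binary expansion from -1 with increments 1, 1/2, 1/4 and so on. It needs only
  additions and comparisons, which matters because the machine cannot round reals.\<close>

primrec dyadic :: "nat \<Rightarrow> real \<Rightarrow> real" where
  "dyadic 0 u = - 1"
| "dyadic (Suc b) u = (if dyadic b u + (1/2) ^ b \<le> u then dyadic b u + (1/2) ^ b else dyadic b u)"

primrec grid :: "nat \<Rightarrow> real set" where
  "grid 0 = {- 1}"
| "grid (Suc b) = grid b \<union> (\<lambda>d. d + (1/2) ^ b) ` grid b"

lemma dyadic_bounds: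
  assumes "\<bar>u\<bar> \<le> 1"
  shows "dyadic b u \<le> u \<and> u \<le> dyadic b u + 2 * (1/2) ^ b"
  using assms by (induction b) auto

lemma dyadic_in_grid: "dyadic b u \<in> grid b"
  by (induction b) auto

lemma finite_grid: "finite (grid b)"
  by (induction b) auto

lemma card_grid: "card (grid b) \<le> 2 ^ b"
proof (induction b)
  case (Suc b)
  have "card (grid (Suc b)) \<le> card (grid b) + card ((\<lambda>d. d + (1/2) ^ b) ` grid b)"
    by (simp add: card_Un_le)
  also have "\<dots> \<le> card (grid b) + card (grid b)"
    using finite_grid by (intro add_left_mono card_image_le)
  finally show ?case using Suc by simp
qed simp

lemma dyadic_one: "dyadic b 1 = 1 - 2 * (1/2) ^ b"
  by (induction b) auto

text \<open>Zero is kept exactly, while 1 is rounded down by \<open>2 * (1/2) ^ b\<close>. So for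
  \<open>b \<ge> 2\<close> a unit vector is rounded to a positive multiple of itself.\<close>

lemma dyadic_zero:
  assumes "b \<ge> 1"
  shows "dyadic b 0 = 0"
  using assms
proof (induction b rule: dec_induct)
  case (step b)
  have "\<not> (1/2::real) ^ b \<le> 0" by (simp add: not_le)
  then show ?case using step by simp
qed simp

primrec colmax :: "(nat \<Rightarrow> nat \<Rightarrow> real) \<Rightarrow> nat \<Rightarrow> nat \<Rightarrow> real" where
  "colmax Q j 0 = 0"
| "colmax Q j (Suc k) = max (colmax Q j k) \<bar>Q k j\<bar>"

lemma colmax_ge: "k < n \<Longrightarrow> \<bar>Q k j\<bar> \<le> colmax Q j n"
  by (induction n) (auto simp: less_Suc_eq le_max_iff_disj)

lemma colmax_nonneg: "0 \<le> colmax Q j n"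
  by (induction n) (auto simp: le_max_iff_disj)

lemma colmax_attained: "0 < colmax Q j n \<Longrightarrow> \<exists>k<n. \<bar>Q k j\<bar> = colmax Q j n"
proof (induction n)
  case (Suc n)
  then show ?case
    by (cases "colmax Q j n \<le> \<bar>Q n j\<bar>") (auto simp: max_def less_Suc_eq)
qed simp

text \<open>Scaling by the largest absolute entry brings the column into [-1, 1] without a square
  root. A zero column leads to 0 / 0, which is 0.\<close>

definition dir :: "nat \<Rightarrow> nat \<Rightarrow> (nat \<Rightarrow> nat \<Rightarrow> real) \<Rightarrow> nat \<Rightarrow> nat \<Rightarrow> real" where
  "dir n b Q j = (\<lambda>k. dyadic b (Q k j / colmax Q j n))"

text \<open>The vectors \<open>Y i\<close> are the differences: those with \<open>i < r\<close> form
  the batch for the quantiles, those with \<open>r \<le> i < h\<close> are filtered.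
  \<open>b\<close> is both the number of squarings and the rounding precision, \<open>\<rho>\<close>
  the rank fraction of the quantile, \<open>\<theta>\<close> the factor between quantile and
  cut-off.\<close>

locale filtering =
  fixes n h r b :: nat and \<rho> \<theta> :: real and Y :: "nat \<Rightarrow> nat \<Rightarrow> real"
begin

definition score :: "(nat \<Rightarrow> real) \<Rightarrow> nat \<Rightarrow> real" where
  "score v i = (dot n v (Y i))\<^sup>2"

definition cnt :: "(nat \<Rightarrow> real) \<Rightarrow> nat \<Rightarrow> real" where
  "cnt v i = (\<Sum>j<r. if score v i \<le> score v j then 1 else 0)"

text \<open>The largest batch score that is reached by at least a fraction \<open>\<rho>\<close> of
  the batch, or 0 if there is none. The running maximum has the shape of the program loop and avoids
  sorting.\<close>

primrec quant :: "(nat \<Rightarrow> real) \<Rightarrow> nat \<Rightarrow> real" where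
  "quant v 0 = 0"
| "quant v (Suc i) = (if \<rho> * real r \<le> cnt v i \<and> quant v i < score v i then score v i else quant v i)"

definition filt :: "(nat \<Rightarrow> real) \<Rightarrow> (nat \<Rightarrow> real) \<Rightarrow> nat \<Rightarrow> real" where
  "filt v w = (\<lambda>i. if \<theta> * quant v r < score v i then 0 else w i)"

primrec filts :: "(nat \<Rightarrow> nat \<Rightarrow> real) \<Rightarrow> (nat \<Rightarrow> real) \<Rightarrow> nat \<Rightarrow> nat \<Rightarrow> real" where
  "filts Q w 0 = w"
| "filts Q w (Suc j) = filt (dir n b Q j) (filts Q w j)"

definition gram :: "(nat \<Rightarrow> real) \<Rightarrow> nat \<Rightarrow> nat \<Rightarrow> real" where
  "gram w = (\<lambda>a c. \<Sum>i<h. w i * Y i a * Y i c)"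

text \<open>Starting from the identity matrix lets the same loop body treat the unit vectors. All
  \<open>n\<close> directions of a round come from one matrix, which is replaced only after the
  round.\<close>

primrec run :: "nat \<Rightarrow> (nat \<Rightarrow> real) \<times> (nat \<Rightarrow> nat \<Rightarrow> real)" where
  "run 0 = ((\<lambda>i. if r \<le> i then 1 else 0), (\<lambda>i j. if i = j then 1 else 0))"
| "run (Suc t) = (let w = filts (snd (run t)) (fst (run t)) n in (w, pw n (gram w) b))"

text \<open>A quotient of sums, so zero columns do no harm, and \<open>power_method\<close> bounds
  exactly these sums. \<open>gram\<close> is not normalised: the last divisor accounts for the
  number of filtered differences and for the covariance being doubled.\<close>

definition out :: real where
  "out = (let (w, Q) = run (Suc n) in
    (\<Sum>j<n. qf n (gram w) (\<lambda>k. Q k j)) / (\<Sum>j<n. dot n (\<lambda>k. Q k j) (\<lambda>k. Q k j)) / (2 * (real h - real r)))"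

declare run.simps(2) [simp del]

abbreviation wt :: "nat \<Rightarrow> nat \<Rightarrow> real" where "wt t \<equiv> fst (run t)"
abbreviation dirt :: "nat \<Rightarrow> nat \<Rightarrow> nat \<Rightarrow> real" where "dirt t j \<equiv> dir n b (snd (run t)) j"

lemma run_Suc: "wt (Suc t) = filts (snd (run t)) (wt t) n" "snd (run (Suc t)) = pw n (gram (wt (Suc t))) b"
  by (simp_all add: run.simps(2) Let_def)

lemma filts_eq: "filts Q w J i = (if \<exists>j<J. \<theta> * quant (dir n b Q j) r < score (dir n b Q j) i then 0 else w i)"
  by (induction J) (auto simp: filt_def less_Suc_eq)

lemma wt_Suc: "wt (Suc t) i = (if \<exists>j<n. \<theta> * quant (dirt t j) r < score (dirt t j) i then 0 else wt t i)"
  unfolding run_Suc filts_eq ..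

lemma wt_01: "wt t i = 0 \<or> wt t i = 1"
  by (induction t) (auto simp: wt_Suc)

lemma wt_nonneg: "0 \<le> wt t i" and wt_le_1: "wt t i \<le> 1"
  using wt_01[of t i] by auto

lemma wt_antimono: "s \<le> t \<Longrightarrow> wt t i \<le> wt s i"
proof (induction t rule: dec_induct)
  case (step t)
  then show ?case using wt_nonneg[of s i] by (simp add: wt_Suc)
qed simp

lemma wt_batch: "i < r \<Longrightarrow> wt t i = 0"
  using wt_antimono[of 0 t i] wt_nonneg[of t i] by simp

lemma qf_gram: "qf n (gram w) v = (\<Sum>i<h. w i * score v i)"
proof -
  have "qf n (gram w) v = (\<Sum>a<n. \<Sum>c<n. \<Sum>i<h. w i * ((v a * Y i a) * (v c * Y i c)))"
    by (simp add: qf_def dot_def mv_def gram_def sum_distrib_left sum_distrib_right mult_ac)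
  also have "\<dots> = (\<Sum>a<n. \<Sum>i<h. \<Sum>c<n. w i * ((v a * Y i a) * (v c * Y i c)))"
    by (intro sum.cong refl sum.swap)
  also have "\<dots> = (\<Sum>i<h. \<Sum>a<n. \<Sum>c<n. w i * ((v a * Y i a) * (v c * Y i c)))"
    by (rule sum.swap)
  also have "\<dots> = (\<Sum>i<h. w i * score v i)"
    unfolding score_def dot_def power2_eq_square sum_product by (simp only: sum_distrib_left)
  finally show ?thesis .
qed

lemma psd_form_gram:
  assumes "\<And>i. 0 \<le> w i"
  shows "psd_form n (gram w)"
proof
  show "gram w i j = gram w j i" for i j by (simp add: gram_def mult_ac)
  show "0 \<le> qf n (gram w) v" for v
    unfolding qf_gram using assms by (auto simp: score_def intro!: sum_nonneg)
qed

lemma score_nonneg: "0 \<le> score v i"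
  by (simp add: score_def)

lemma quant_nonneg: "0 \<le> quant v i"
  by (induction i) (auto simp: score_nonneg)

lemma quant_ge: "i < j \<Longrightarrow> \<rho> * real r \<le> cnt v i \<Longrightarrow> score v i \<le> quant v j"
  by (induction j) (auto simp: less_Suc_eq)

lemma quant_cases: "quant v j = 0 \<or> (\<exists>i<j. \<rho> * real r \<le> cnt v i \<and> quant v j = score v i)"
  by (induction j) (auto simp: less_Suc_eq)

lemma cnt_eq_card: "cnt v i = real (card {j. j < r \<and> score v i \<le> score v j})"
proof -
  have "cnt v i = (\<Sum>j\<in>{j\<in>{..<r}. score v i \<le> score v j}. 1)"
    unfolding cnt_def by (rule sum.inter_filter[symmetric]) simp
  then show ?thesis by (simp add: lessThan_def)
qed

text \<open>Among the batch elements of score at least \<open>c\<close>, one of smallest score is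
  reached by all the others, so its count admits it to the maximum.\<close>

lemma quant_lower:
  assumes "\<rho> > 0" "r > 0" and c: "\<rho> * real r \<le> real (card {j. j < r \<and> c \<le> score v j})"
  shows "c \<le> quant v r"
proof -
  let ?A = "{j. j < r \<and> c \<le> score v j}"
  have fin: "finite ?A" by simp
  have ne: "?A \<noteq> {}"
  proof
    assume "?A = {}"
    then have "real (card ?A) = 0" by (simp only: card.empty of_nat_0)
    moreover have "0 < \<rho> * real r" using assms by simp
    ultimately show False using c by linarith
  qed
  obtain i where i: "i \<in> ?A" "\<And>j. j \<in> ?A \<Longrightarrow> score v i \<le> score v j"
    using ex_min_if_finite[of "score v ` ?A"] fin ne by (fastforce simp: not_less)
  have "card ?A \<le> card {j. j < r \<and> score v i \<le> score v j}"
    using i by (intro card_mono) auto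
  then have "\<rho> * real r \<le> cnt v i" using c by (simp add: cnt_eq_card)
  then have "score v i \<le> quant v r" using i by (intro quant_ge) auto
  then show ?thesis using i by auto
qed

lemma quant_upper:
  assumes "0 \<le> c" and card: "real (card {j. j < r \<and> c < score v j}) < \<rho> * real r"
  shows "quant v r \<le> c"
proof (rule ccontr)
  assume *: "\<not> quant v r \<le> c"
  then obtain i where i: "i < r" "\<rho> * real r \<le> cnt v i" "quant v r = score v i"
    using quant_cases[of v r] assms by auto
  have "card {j. j < r \<and> score v i \<le> score v j} \<le> card {j. j < r \<and> c < score v j}"
    using * i by (intro card_mono) auto
  then show False using i card by (simp add: cnt_eq_card)
qed

end

text \<open>Deterministic core: randomness and adversary enter only through the last three
  conditions. \<open>S\<close> stands for the number of filtered differences times the norm of the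
  covariance, so inliers contribute about \<open>2 * S\<close>; \<open>E\<close> is the target
  relative error up to a constant. The two conditions about quantiles concern grid vectors only,
  because a union bound must supply them.\<close>

locale filtering_good = filtering +
  fixes In Out :: "nat set" and \<eta> E S :: real
  assumes n1: "n \<ge> 1" and \<eta>: "0 < \<eta>" "\<eta> \<le> 1/100" and b: "real n / \<eta> \<le> 2 ^ b"
    and split: "In \<union> Out = {r..<h}" "In \<inter> Out = {}" and rh: "r < h"
    and E: "\<eta> \<le> E" and S: "0 \<le> S"
    and In_kept: "\<And>v. (\<And>k. k < n \<Longrightarrow> v k \<in> grid b) \<Longrightarrow>
      card {i \<in> In. \<theta> * quant v r < score v i} \<le> n"
    and Out_cut: "\<And>v. (\<And>k. k < n \<Longrightarrow> v k \<in> grid b) \<Longrightarrow>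
      real (card Out) * (\<theta> * quant v r) \<le> E * S * dot n v v"
    and In_upper: "\<And>v. (\<Sum>i\<in>In. score v i) \<le> (2 + \<eta>) * S * dot n v v"
begin

definition en :: "nat set \<Rightarrow> nat \<Rightarrow> (nat \<Rightarrow> real) \<Rightarrow> real" where
  "en I t v = (\<Sum>i\<in>I. wt t i * score v i)"

definition tr :: "nat \<Rightarrow> real" where
  "tr t = (\<Sum>k<n. en Out t (unit_vec k))"

lemma fin: "finite In" "finite Out"
  using split(1) by (metis finite_Un finite_atLeastLessThan)+

lemma qf_split: "qf n (gram (wt t)) v = en In t v + en Out t v"
proof -
  have "qf n (gram (wt t)) v = (\<Sum>i\<in>{r..<h}. wt t i * score v i)"
    unfolding qf_gram by (intro sum.mono_neutral_right) (auto simp: wt_batch)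
  also have "\<dots> = en In t v + en Out t v"
    unfolding split(1)[symmetric] en_def using fin split(2) by (intro sum.union_disjoint) auto
  finally show ?thesis .
qed

lemma en_nonneg: "0 \<le> en I t v"
  by (auto simp: en_def wt_nonneg score_nonneg intro!: sum_nonneg)

lemma tr_nonneg: "0 \<le> tr t"
  by (auto simp: tr_def en_nonneg intro!: sum_nonneg)

lemma en_antimono: "s \<le> t \<Longrightarrow> en I t v \<le> en I s v"
  unfolding en_def by (intro sum_mono mult_right_mono wt_antimono score_nonneg)

lemma en_In_le: "en In t v \<le> (2 + \<eta>) * S * dot n v v"
proof -
  have "en In t v \<le> (\<Sum>i\<in>In. score v i)"
    unfolding en_def using wt_le_1 score_nonneg by (intro sum_mono) (simp add: mult_left_le_one_le wt_nonneg)
  then show ?thesis using In_upper[of v] by linarith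
qed

lemma dirt_grid: "dirt t j k \<in> grid b"
  by (simp add: dir_def dyadic_in_grid)

text \<open>An outlier surviving round \<open>t\<close> scores at most the cut-off in each direction
  of that round, and \<open>Out_cut\<close> bounds the number of outliers times the cut-off.\<close>

lemma en_Out_filtered:
  assumes "j < n"
  shows "en Out (Suc t) (dirt t j) \<le> E * S * dot n (dirt t j) (dirt t j)"
proof (cases "Out = {}")
  case True
  then show ?thesis using E \<eta> S dot_self_nonneg[of n] by (simp add: en_def)
next
  case False
  \<comment> \<open>The locale does not fix the sign of \<open>\<theta>\<close>, and deleted
    outliers contribute 0; hence \<open>max 0\<close>.\<close>
  have "en Out (Suc t) (dirt t j) \<le> (\<Sum>i\<in>Out. max 0 (\<theta> * quant (dirt t j) r))"
    unfolding en_def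
  proof (intro sum_mono)
    fix i
    show "wt (Suc t) i * score (dirt t j) i \<le> max 0 (\<theta> * quant (dirt t j) r)"
    proof (cases "\<theta> * quant (dirt t j) r < score (dirt t j) i")
      case True
      then have "wt (Suc t) i = 0" unfolding wt_Suc using assms by auto
      then show ?thesis by (simp)
    next
      case False
      have "wt (Suc t) i * score (dirt t j) i \<le> score (dirt t j) i"
        using wt_le_1 score_nonneg wt_nonneg by (intro mult_left_le_one_le) auto
      then show ?thesis using False by linarith
    qed
  qed
  also have "\<dots> = max 0 (real (card Out) * (\<theta> * quant (dirt t j) r))"
    using False fin by (simp add: max_def mult_le_0_iff zero_le_mult_iff)
  also have "\<dots> \<le> E * S * dot n (dirt t j) (dirt t j)"
    using Out_cut[of "dirt t j"] dirt_grid E \<eta> S dot_self_nonneg[of n] by simp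
  finally show ?thesis .
qed

lemma b2: "b \<ge> 2"
proof (rule ccontr)
  assume "\<not> b \<ge> 2"
  then have "(2::real) ^ b \<le> 2 ^ 1" by (intro power_increasing) auto
  moreover have "real n / \<eta> \<ge> 100"
    using n1 \<eta> by (simp add: field_simps)
  ultimately show False using b by simp
qed

lemma colmax_id: "j < J \<Longrightarrow> colmax (\<lambda>i j. if i = j then 1 else 0) j J = 1"
proof -
  have "colmax (\<lambda>i j. if i = j then 1 else 0) j J = (if j < J then 1 else 0)"
    by (induction J) auto
  then show "j < J \<Longrightarrow> ?thesis" by simp
qed

text \<open>The identity columns are rounded to \<open>c\<close> times unit vectors with
  \<open>c = dyadic b 1 > 0\<close>; both sides of \<open>en_Out_filtered\<close> then carry the
  factor \<open>c\<^sup>2\<close>, which cancels.\<close>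

lemma en_Out_unit: 
  assumes "j < n"
  shows "en Out 1 (unit_vec j) \<le> E * S"
proof -
  define c where "c = dyadic b 1"
  have "(1/2::real) ^ b \<le> (1/2) ^ 2" using b2 by (intro power_decreasing) auto
  then have c: "c > 0" by (simp add: c_def dyadic_one power2_eq_square)
  have d: "dirt 0 j = (\<lambda>k. c * unit_vec j k)"
    using assms b2 by (auto simp: dir_def colmax_id unit_vec_def c_def dyadic_zero fun_eq_iff)
  have s: "score (\<lambda>k. c * unit_vec j k) i = c\<^sup>2 * score (unit_vec j) i" for i
    by (simp add: score_def dot_def sum_distrib_left[symmetric] mult.assoc power_mult_distrib)
  have "en Out (Suc 0) (dirt 0 j) = c\<^sup>2 * en Out 1 (unit_vec j)"
    unfolding d en_def s by (simp add: sum_distrib_left mult_ac)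
  moreover have "dot n (dirt 0 j) (dirt 0 j) = c\<^sup>2"
    unfolding d using dot_unit_vec[OF assms, of "unit_vec j"]
    by (simp add: dot_def power2_eq_square mult_ac sum_distrib_left[symmetric])
       (simp add: unit_vec_def mult.assoc[symmetric] sum_distrib_left[symmetric])
  ultimately show ?thesis
    using en_Out_filtered[OF assms, of 0] c by simp
qed

lemma tr_1: "tr 1 \<le> n * (E * S)"
  unfolding tr_def using sum_mono[of "{..<n}" "\<lambda>k. en Out 1 (unit_vec k)" "\<lambda>_. E * S"] en_Out_unit by simp

lemma score_le: "score v i \<le> dot n v v * (\<Sum>k<n. score (unit_vec k) i)"
proof -
  have "score v i \<le> (\<Sum>k<n. (v k)\<^sup>2) * (\<Sum>k<n. (Y i k)\<^sup>2)"
    unfolding score_def dot_def by (rule Cauchy_Schwarz_ineq_sum)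
  also have "(\<Sum>k<n. (Y i k)\<^sup>2) = (\<Sum>k<n. score (unit_vec k) i)"
    by (simp add: score_def dot_unit_vec)
  finally show ?thesis by (simp add: dot_def power2_eq_square)
qed

text \<open>The score of a deleted vector is at most \<open>dot n v v\<close> times its squared
  length, and the squared length is its contribution to \<open>tr\<close>. So energy lost in one
  direction forces a drop of the potential \<open>tr\<close>.\<close>

lemma en_drop:
  assumes "s \<le> t"
  shows "en Out s v - en Out t v \<le> (tr s - tr t) * dot n v v"
proof -
  have tr: "tr t = (\<Sum>i\<in>Out. wt t i * (\<Sum>k<n. score (unit_vec k) i))" for t
    unfolding tr_def en_def sum_distrib_left by (rule sum.swap)
  have "en Out s v - en Out t v = (\<Sum>i\<in>Out. (wt s i - wt t i) * score v i)"
    by (simp add: en_def sum_subtractf algebra_simps)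
  also have "\<dots> \<le> (\<Sum>i\<in>Out. (wt s i - wt t i) * (dot n v v * (\<Sum>k<n. score (unit_vec k) i)))"
    using wt_antimono[OF assms] by (intro sum_mono mult_left_mono score_le) auto
  also have "\<dots> = (tr s - tr t) * dot n v v"
    unfolding tr by (simp add: sum_distrib_left sum_distrib_right sum_subtractf algebra_simps)
  finally show ?thesis .
qed

text \<open>Crude as a bound for the largest eigenvalue, but it is only multiplied by the squared
  length of a rounding error, which is of order \<open>\<eta> ^ 2 / n\<close>.\<close>

lemma trace_gram: "t \<ge> 1 \<Longrightarrow> (\<Sum>k<n. gram (wt t) k k) \<le> n * ((2 + \<eta> + E) * S)"
proof -
  assume t: "t \<ge> 1"
  have "gram (wt t) k k \<le> (2 + \<eta> + E) * S" if k: "k < n" for k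
  proof -
    have "gram (wt t) k k = qf n (gram (wt t)) (unit_vec k)"
      using k by (simp add: qf_def mv_unit_vec dot_unit_vec)
    also have "\<dots> \<le> (2 + \<eta>) * S * dot n (unit_vec k) (unit_vec k) + en Out 1 (unit_vec k)"
      unfolding qf_split by (intro add_mono en_In_le en_antimono t)
    also have "\<dots> \<le> (2 + \<eta>) * S + E * S"
      using k en_Out_unit[OF k] by (simp add: dot_unit_vec) (simp add: unit_vec_def)
    finally show ?thesis by (simp add: algebra_simps)
  qed
  then show ?thesis
    using sum_mono[of "{..<n}" "\<lambda>k. gram (wt t) k k" "\<lambda>_. (2 + \<eta> + E) * S"] by simp
qed

text \<open>The slack between the \<open>100 * E\<close> claimed at the end and the
  \<open>2 * E\<close> needed in a round. It absorbs the loss \<open>1 - \<eta>\<close> of the power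
  method and all rounding losses, using that \<open>\<eta>\<close> is at most \<open>E\<close> and
  at most 1/100.\<close>

lemma coefficient_bound:
  "(1 + \<eta>) * (1 + 9 * \<eta>) * (2 + \<eta> + 2 * E) \<le> (1 - \<eta>) * (2 + \<eta> + 100 * E) - 8 * \<eta> * (3 + E)"
proof -
  have p: "\<eta> * \<eta> \<le> \<eta> / 100" "\<eta> * E \<le> E / 100"
    using \<eta> E mult_left_mono[of \<eta> "1/100" \<eta>] mult_right_mono[of \<eta> "1/100" E] by auto
  have "(1 + \<eta>) * (1 + 9 * \<eta>) = 1 + 10 * \<eta> + 9 * (\<eta> * \<eta>)" by (simp add: algebra_simps)
  then have a: "(1 + \<eta>) * (1 + 9 * \<eta>) \<le> 1 + 11 * \<eta>" using p \<eta> by linarith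
  have "(1 + \<eta>) * (1 + 9 * \<eta>) * (2 + \<eta> + 2 * E) \<le> (1 + 11 * \<eta>) * (2 + \<eta> + 2 * E)"
    using a \<eta> E by (intro mult_right_mono) auto
  also have "\<dots> = 2 + 23 * \<eta> + 2 * E + 11 * (\<eta> * \<eta>) + 22 * (\<eta> * E)"
    by (simp add: algebra_simps)
  also have "\<dots> \<le> 2 - 25 * \<eta> + 100 * E - \<eta> * \<eta> - 108 * (\<eta> * E)"
    using p E \<eta> by linarith
  also have "\<dots> = (1 - \<eta>) * (2 + \<eta> + 100 * E) - 8 * \<eta> * (3 + E)"
    by (simp add: algebra_simps)
  finally show ?thesis .
qed

text \<open>Rounding does not spoil a column whose Rayleigh quotient is nearly \<open>lam\<close>.
  The error vector \<open>e\<close> is split off by the weighted inequality \<open>split_le\<close>,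
  at the price of factors \<open>1 + \<eta>\<close> and \<open>1 + 1 / \<eta>\<close>; the second is
  harmless since the energy of \<open>e\<close> is of order \<open>\<eta> ^ 2\<close>.\<close>

lemma round_direction:
  assumes t: "t \<ge> 1" and Q: "Q = snd (run t)"
    and lam: "(2 + \<eta> + 100 * E) * S < lam"
    and col: "0 < qf n (gram (wt t)) (\<lambda>k. Q k j)"
      "(1 - \<eta>) * lam * dot n (\<lambda>k. Q k j) (\<lambda>k. Q k j) \<le> qf n (gram (wt t)) (\<lambda>k. Q k j)"
  shows "(2 + \<eta> + 2 * E) * S * dot n (dirt t j) (dirt t j) < qf n (gram (wt t)) (dirt t j)"
proof -
  interpret psd_form n "gram (wt t)" using wt_nonneg by (rule psd_form_gram)
  define mx where "mx = colmax Q j n"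
  define u where "u = (\<lambda>k. Q k j / mx)"
  define v where "v = dirt t j"
  define e where "e = (\<lambda>k. u k - v k)"
  have mx: "mx > 0"
  proof (rule ccontr)
    assume "\<not> mx > 0"
    then have "mx = 0" using colmax_nonneg[of Q j n] by (simp add: mx_def)
    then have "Q k j = 0" if "k < n" for k using colmax_ge[OF that, of Q j] by (simp add: mx_def)
    then have "qf n (gram (wt t)) (\<lambda>k. Q k j) = 0" by (simp add: qf_def dot_def)
    then show False using col by simp
  qed
  have v: "v k = dyadic b (u k)" for k by (simp add: v_def dir_def u_def mx_def Q)
  have u_le: "\<bar>u k\<bar> \<le> 1" if "k < n" for k
    using colmax_ge[OF that, of Q j] mx by (simp add: u_def mx_def)
  have half: "(1/2::real) ^ b \<le> \<eta> / n"
  proof -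
    have "(1/2::real) ^ b = 1 / 2 ^ b" by (simp add: power_divide)
    also have "\<dots> \<le> 1 / (n / \<eta>)" using b n1 \<eta> by (intro divide_left_mono) auto
    finally show ?thesis by simp
  qed
  have e_le: "\<bar>e k\<bar> \<le> 2 * (\<eta> / n)" if "k < n" for k
  proof -
    have "\<bar>e k\<bar> \<le> 2 * (1/2) ^ b" using dyadic_bounds[OF u_le[OF that], of b] by (simp add: e_def v)
    then show ?thesis using half by linarith
  qed
  have ee: "dot n e e \<le> 4 * \<eta>\<^sup>2 / n"
  proof -
    have "dot n e e \<le> (\<Sum>k<n. (2 * (\<eta> / n))\<^sup>2)"
      unfolding dot_def power2_eq_square[symmetric] using e_le by (intro sum_mono) (simp add: abs_le_square_iff[symmetric] \<eta>(1) less_imp_le)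
    also have "\<dots> = 4 * \<eta>\<^sup>2 / n" using n1 by (simp add: power2_eq_square field_simps)
    finally show ?thesis .
  qed
  have ee4: "dot n e e \<le> 4 * \<eta>\<^sup>2"
  proof -
    have "4 * \<eta>\<^sup>2 / n \<le> 4 * \<eta>\<^sup>2 / 1" using n1 by (intro divide_left_mono) auto
    then show ?thesis using ee by simp
  qed
  have qe: "qf n (gram (wt t)) e \<le> 4 * \<eta>\<^sup>2 * ((3 + E) * S)"
  proof -
    have "qf n (gram (wt t)) e \<le> dot n e e * (\<Sum>k<n. gram (wt t) k k)" by (rule qf_le_trace)
    also have "\<dots> \<le> dot n e e * (n * ((2 + \<eta> + E) * S))"
      by (intro mult_left_mono trace_gram t dot_self_nonneg)
    also have "\<dots> \<le> (4 * \<eta>\<^sup>2 / n) * (n * ((2 + \<eta> + E) * S))"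
      using ee \<eta> E S by (intro mult_right_mono) auto
    also have "\<dots> = 4 * \<eta>\<^sup>2 * ((2 + \<eta> + E) * S)" using n1 by simp
    also have "\<dots> \<le> 4 * \<eta>\<^sup>2 * ((3 + E) * S)"
      using \<eta> S by (intro mult_left_mono mult_right_mono) auto
    finally show ?thesis .
  qed
  \<comment> \<open>After scaling, some entry has absolute value 1; this turns absolute rounding
    errors into relative ones.\<close>
  have uu: "1 \<le> dot n u u"
  proof -
    obtain k where k: "k < n" "\<bar>Q k j\<bar> = mx" using colmax_attained[of Q j n] mx by (auto simp: mx_def)
    have "1 = (u k)\<^sup>2" using k mx by (simp add: u_def power_divide power2_abs[of "Q k j", symmetric])
    also have "\<dots> \<le> (\<Sum>k<n. (u k)\<^sup>2)" using k by (intro member_le_sum) auto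
    finally show ?thesis by (simp add: dot_def power2_eq_square)
  qed
  have split_le: "2 * x * y \<le> \<eta> * x\<^sup>2 + y\<^sup>2 / \<eta>" for x y :: real
  proof -
    have "0 \<le> (\<eta> * x - y)\<^sup>2 / \<eta>" using \<eta> by simp
    also have "\<dots> = \<eta> * x\<^sup>2 + y\<^sup>2 / \<eta> - 2 * x * y" using \<eta> by (simp add: field_simps power2_eq_square)
    finally show ?thesis by simp
  qed
  have e8: "(1 + 1 / \<eta>) * (4 * \<eta>\<^sup>2) \<le> 8 * \<eta>"
    using \<eta> mult_left_mono[of \<eta> 1 \<eta>] by (simp add: field_simps power2_eq_square)
  have vv: "dot n v v \<le> (1 + 9 * \<eta>) * dot n u u"
  proof -
    have "dot n v v \<le> (\<Sum>k<n. (1 + \<eta>) * (u k)\<^sup>2 + (1 + 1 / \<eta>) * (e k)\<^sup>2)"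
      unfolding dot_def
    proof (intro sum_mono)
      fix k
      have "v k * v k = (u k)\<^sup>2 + 2 * u k * (- e k) + (e k)\<^sup>2" by (simp add: e_def power2_eq_square algebra_simps)
      then show "v k * v k \<le> (1 + \<eta>) * (u k)\<^sup>2 + (1 + 1 / \<eta>) * (e k)\<^sup>2"
        using split_le[of "u k" "- e k"] by (simp add: algebra_simps)
    qed
    also have "\<dots> = (1 + \<eta>) * dot n u u + (1 + 1 / \<eta>) * dot n e e"
      by (simp add: sum.distrib sum_distrib_left dot_def power2_eq_square)
    also have "\<dots> \<le> (1 + \<eta>) * dot n u u + (1 + 1 / \<eta>) * (4 * \<eta>\<^sup>2)"
      using ee4 \<eta> by (intro add_left_mono mult_left_mono) auto
    also have "\<dots> \<le> (1 + \<eta>) * dot n u u + 8 * \<eta> * dot n u u"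
    proof -
      have "8 * \<eta> * 1 \<le> 8 * \<eta> * dot n u u" using uu \<eta> by (intro mult_left_mono) auto
      then show ?thesis using e8 by linarith
    qed
    finally show ?thesis by (simp add: algebra_simps)
  qed
  have qu: "qf n (gram (wt t)) u \<le> (1 + \<eta>) * qf n (gram (wt t)) v + (1 + 1 / \<eta>) * qf n (gram (wt t)) e"
  proof -
    have eq: "u = (\<lambda>k. v k + 1 * e k)" by (simp add: e_def)
    have "(dot n v (mv n (gram (wt t)) e))\<^sup>2 \<le> qf n (gram (wt t)) v * qf n (gram (wt t)) e"
      by (rule cauchy_schwarz)
    then have "dot n v (mv n (gram (wt t)) e) \<le> sqrt (qf n (gram (wt t)) v) * sqrt (qf n (gram (wt t)) e)"
      by (simp add: real_sqrt_mult[symmetric] real_le_rsqrt)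
    then show ?thesis
      using split_le[of "sqrt (qf n (gram (wt t)) v)" "sqrt (qf n (gram (wt t)) e)"] psd
        qf_add[of v 1 e] eq by (simp add: algebra_simps)
  qed
  have scale: "qf n (gram (wt t)) u = qf n (gram (wt t)) (\<lambda>k. Q k j) / mx\<^sup>2"
    "dot n u u = dot n (\<lambda>k. Q k j) (\<lambda>k. Q k j) / mx\<^sup>2"
    by (simp_all add: u_def qf_def dot_def mv_def power2_eq_square sum_divide_distrib[symmetric])
  have qu': "(1 - \<eta>) * lam * dot n u u \<le> qf n (gram (wt t)) u"
    unfolding scale using divide_right_mono[OF col(2), of "mx\<^sup>2"] by simp
  have "(1 + 1 / \<eta>) * qf n (gram (wt t)) e \<le> (1 + 1 / \<eta>) * (4 * \<eta>\<^sup>2 * ((3 + E) * S))"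
    using qe \<eta> by (intro mult_left_mono) auto
  also have "\<dots> = ((1 + 1 / \<eta>) * (4 * \<eta>\<^sup>2)) * ((3 + E) * S)" by simp
  also have "\<dots> \<le> 8 * \<eta> * ((3 + E) * S)" using e8 E \<eta> S by (intro mult_right_mono) auto
  also have "\<dots> \<le> 8 * \<eta> * ((3 + E) * S) * dot n u u"
    using mult_left_mono[OF uu, of "8 * \<eta> * ((3 + E) * S)"] E \<eta> S by simp
  finally have qe': "(1 + 1 / \<eta>) * qf n (gram (wt t)) e \<le> 8 * \<eta> * ((3 + E) * S) * dot n u u" .
  have "(1 + \<eta>) * ((2 + \<eta> + 2 * E) * S * dot n v v) \<le> (1 + \<eta>) * ((2 + \<eta> + 2 * E) * S * ((1 + 9 * \<eta>) * dot n u u))"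
    using vv \<eta> E S by (intro mult_left_mono) auto
  also have "\<dots> = ((1 + \<eta>) * (1 + 9 * \<eta>) * (2 + \<eta> + 2 * E)) * (S * dot n u u)" by (simp add: mult_ac)
  also have "\<dots> \<le> ((1 - \<eta>) * (2 + \<eta> + 100 * E) - 8 * \<eta> * (3 + E)) * (S * dot n u u)"
    using coefficient_bound S uu by (intro mult_right_mono) auto
  also have "\<dots> = (1 - \<eta>) * ((2 + \<eta> + 100 * E) * S) * dot n u u - 8 * \<eta> * ((3 + E) * S) * dot n u u"
    by (simp add: algebra_simps)
  also have "\<dots> < (1 - \<eta>) * lam * dot n u u - 8 * \<eta> * ((3 + E) * S) * dot n u u"
    using lam \<eta> uu by (intro diff_strict_right_mono mult_strict_right_mono mult_strict_left_mono) auto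
  also have "\<dots> \<le> (1 + \<eta>) * qf n (gram (wt t)) v"
    using qu qu' qe' by linarith
  finally show ?thesis using \<eta> by (simp add: v_def)
qed

lemma ln_n_le: "ln (real n) \<le> \<eta> * (2 * 2 ^ b)"
proof -
  have "ln (real n) \<le> real n" using n1 by (simp add: ln_le_minus_one order_trans[OF ln_le_minus_one])
  also have "\<dots> = \<eta> * (real n / \<eta>)" using \<eta> by simp
  also have "\<dots> \<le> \<eta> * (2 * 2 ^ b)"
  proof (intro mult_left_mono)
    have "(2::real) ^ b \<le> 2 * 2 ^ b" by simp
    then show "real n / \<eta> \<le> 2 * 2 ^ b" using b by linarith
  qed (use \<eta> in simp)
  finally show ?thesis .
qed

text \<open>The power method compares sums over all columns, so the comparison holds for some single
  column. Columns with vanishing form satisfy the reverse inequality only weakly; a column with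
  positive form makes the contradiction strict.\<close>

lemma ex_good_column:
  assumes t: "t \<ge> 1" and x: "dot n x x = 1" "0 < qf n (gram (wt t)) x" and Q: "Q = snd (run t)"
  shows "\<exists>j<n. 0 < qf n (gram (wt t)) (\<lambda>k. Q k j) \<and>
    (1 - \<eta>) * qf n (gram (wt t)) x * dot n (\<lambda>k. Q k j) (\<lambda>k. Q k j) \<le> qf n (gram (wt t)) (\<lambda>k. Q k j)"
proof (rule ccontr)
  interpret psd_form n "gram (wt t)" using wt_nonneg by (rule psd_form_gram)
  assume neg: "\<not> ?thesis"
  have Qt: "Q = pw n (gram (wt t)) b" using t Q run_Suc(2)[of "t - 1"] by (simp)
  note pm = power_method[OF x(1) x(2) order_refl \<eta>(1) _ ln_n_le, folded Qt]
  have pos: "0 < (\<Sum>j<n. qf n (gram (wt t)) (\<lambda>k. Q k j))" using pm(2) \<eta> by simp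
  have le: "qf n (gram (wt t)) (\<lambda>k. Q k j) \<le> (1 - \<eta>) * qf n (gram (wt t)) x * dot n (\<lambda>k. Q k j) (\<lambda>k. Q k j)"
    if "j < n" for j
  proof (cases "0 < qf n (gram (wt t)) (\<lambda>k. Q k j)")
    case False
    then have "qf n (gram (wt t)) (\<lambda>k. Q k j) = 0" using psd[of "\<lambda>k. Q k j"] by linarith
    then show ?thesis using x \<eta> dot_self_nonneg[of n "\<lambda>k. Q k j"] by simp
  qed (use neg that in force)
  obtain j0 where j0: "j0 < n" "0 < qf n (gram (wt t)) (\<lambda>k. Q k j0)"
    using pos by (metis lessThan_iff not_less sum_nonpos)
  have "(\<Sum>j<n. qf n (gram (wt t)) (\<lambda>k. Q k j))
      < (\<Sum>j<n. (1 - \<eta>) * qf n (gram (wt t)) x * dot n (\<lambda>k. Q k j) (\<lambda>k. Q k j))"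
    using le j0 neg by (intro sum_strict_mono_ex1) force+
  then show False using pm(1) \<eta> by (simp add: sum_distrib_left)
qed

lemma final_le:
  assumes x: "dot n x x = 1"
  shows "qf n (gram (wt (Suc n))) x \<le> (2 + \<eta> + 100 * E) * S"
proof (rule ccontr)
  assume "\<not> ?thesis"
  then have big: "(2 + \<eta> + 100 * E) * S < qf n (gram (wt (Suc n))) x" by simp
  have drop: "E * S < tr t - tr (Suc t)" if t: "t \<ge> 1" "t \<le> n" for t
  proof -
    define Q where "Q = snd (run t)"
    \<comment> \<open>Weights never increase, so a direction that is too heavy at the end was too
      heavy in every round.\<close>
    have "qf n (gram (wt (Suc n))) x \<le> qf n (gram (wt t)) x"
      unfolding qf_split using t by (intro add_mono en_antimono) auto
    then have lam: "(2 + \<eta> + 100 * E) * S < qf n (gram (wt t)) x" using big by linarith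
    moreover have "0 \<le> (2 + \<eta> + 100 * E) * S" using \<eta> E S by simp
    ultimately have "0 < qf n (gram (wt t)) x" by linarith
    from ex_good_column[OF t(1) x this Q_def] obtain j where j: "j < n"
      "0 < qf n (gram (wt t)) (\<lambda>k. Q k j)"
      "(1 - \<eta>) * qf n (gram (wt t)) x * dot n (\<lambda>k. Q k j) (\<lambda>k. Q k j) \<le> qf n (gram (wt t)) (\<lambda>k. Q k j)"
      by blast
    define v where "v = dirt t j"
    have "(2 + \<eta> + 2 * E) * S * dot n v v < qf n (gram (wt t)) v"
      unfolding v_def by (rule round_direction[OF t(1) Q_def lam j(2,3)])
    also have "\<dots> \<le> (2 + \<eta>) * S * dot n v v + en Out t v"
      unfolding qf_split by (intro add_right_mono en_In_le)
    \<comment> \<open>At most half of this amount survives the filter in direction \<open>v\<close>;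
      the other half is charged to the trace.\<close>
    finally have "2 * (E * S * dot n v v) < en Out t v" by (simp add: algebra_simps)
    moreover have "en Out (Suc t) v \<le> E * S * dot n v v"
      unfolding v_def by (rule en_Out_filtered[OF j(1)])
    moreover have "en Out t v - en Out (Suc t) v \<le> (tr t - tr (Suc t)) * dot n v v"
      by (rule en_drop) simp
    ultimately have "(E * S) * dot n v v < (tr t - tr (Suc t)) * dot n v v" by linarith
    then show ?thesis using dot_self_nonneg[of n v] by (simp add: mult_less_cancel_right)
  qed
  have "real t * (E * S) < tr 1 - tr (Suc t)" if "t \<ge> 1" "t \<le> n" for t
    using that
  proof (induction t rule: dec_induct)
    case base
    then show ?case using drop[of 1] by simp
  next
    case (step t)
    then show ?case using drop[of "Suc t"] by (simp add: algebra_simps)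
  qed
  from this[of n] show False using n1 tr_1 tr_nonneg[of "Suc n"] by simp
qed

lemma out_eq: "out = (\<Sum>j<n. qf n (gram (wt (Suc n))) (\<lambda>k. snd (run (Suc n)) k j)) /
    (\<Sum>j<n. dot n (\<lambda>k. snd (run (Suc n)) k j) (\<lambda>k. snd (run (Suc n)) k j)) / (2 * (real h - real r))"
  unfolding out_def by (simp only: case_prod_beta Let_def)

lemma out_nonneg: "0 \<le> out"
proof -
  interpret psd_form n "gram (wt (Suc n))" using wt_nonneg by (rule psd_form_gram)
  show ?thesis unfolding out_eq using rh psd dot_self_nonneg
    by (intro divide_nonneg_nonneg sum_nonneg) auto
qed

lemma out_le: "out \<le> (2 + \<eta> + 100 * E) * S / (2 * (real h - real r))"
proof -
  interpret psd_form n "gram (wt (Suc n))" using wt_nonneg by (rule psd_form_gram)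
  define Q where "Q = snd (run (Suc n))"
  let ?B = "(2 + \<eta> + 100 * E) * S"
  have B: "0 \<le> ?B" using \<eta> E S by simp
  have le: "qf n (gram (wt (Suc n))) x \<le> ?B * dot n x x" for x
    by (rule qf_le_if_unit) (rule final_le)
  have "(\<Sum>j<n. qf n (gram (wt (Suc n))) (\<lambda>k. Q k j)) \<le> ?B * (\<Sum>j<n. dot n (\<lambda>k. Q k j) (\<lambda>k. Q k j))"
    unfolding sum_distrib_left by (intro sum_mono le)
  then have "(\<Sum>j<n. qf n (gram (wt (Suc n))) (\<lambda>k. Q k j)) / (\<Sum>j<n. dot n (\<lambda>k. Q k j) (\<lambda>k. Q k j)) \<le> ?B"
    using B sum_nonneg[of "{..<n}" "\<lambda>j. dot n (\<lambda>k. Q k j) (\<lambda>k. Q k j)"] dot_self_nonneg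
    by (cases "(\<Sum>j<n. dot n (\<lambda>k. Q k j) (\<lambda>k. Q k j)) = 0") (auto simp: divide_le_eq less_le)
  then show ?thesis unfolding out_eq Q_def[symmetric] using rh by (intro divide_right_mono) auto
qed

lemma card_removed: "card {i \<in> In. wt (Suc n) i = 0} \<le> Suc n * n * n"
proof -
  let ?R = "\<lambda>t j. {i \<in> In. \<theta> * quant (dirt t j) r < score (dirt t j) i}"
  have "wt t i = 0 \<Longrightarrow> i \<in> In \<Longrightarrow> \<exists>t'<t. \<exists>j<n. i \<in> ?R t' j" for t i
  proof (induction t)
    case 0
    then have "i \<in> {r..<h}" using split(1) by blast
    then show ?case using 0 by simp
  next
    case (Suc t)
    then show ?case unfolding wt_Suc by (metis (mono_tags, lifting) less_Suc_eq mem_Collect_eq)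
  qed
  then have "{i \<in> In. wt (Suc n) i = 0} \<subseteq> (\<Union>t<Suc n. \<Union>j<n. ?R t j)"
    by fastforce
  then have "card {i \<in> In. wt (Suc n) i = 0} \<le> card (\<Union>t<Suc n. \<Union>j<n. ?R t j)"
    using fin by (intro card_mono) auto
  also have "\<dots> \<le> (\<Sum>t<Suc n. card (\<Union>j<n. ?R t j))" by (rule card_UN_le) simp
  also have "\<dots> \<le> (\<Sum>t<Suc n. \<Sum>j<n. card (?R t j))" by (intro sum_mono card_UN_le) simp
  also have "\<dots> \<le> (\<Sum>t<Suc n. \<Sum>j<n. n)" by (intro sum_mono In_kept dirt_grid)
  finally show ?thesis by (simp add: algebra_simps)
qed

text \<open>One direction \<open>x\<close> suffices, because the power method transfers its Rayleigh
  quotient to the output. The square root bounds the energy of the removed inliers, from their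
  number and the fourth moment bound \<open>K\<close>.\<close>

lemma out_ge:
  assumes x: "dot n x x = 1" and K: "(\<Sum>i\<in>In. (score x i)\<^sup>2) \<le> K"
    and lam: "lam \<le> (\<Sum>i\<in>In. score x i) - sqrt (real (Suc n * n * n) * K)"
  shows "(1 - \<eta>) * lam / (2 * (real h - real r)) \<le> out"
proof (cases "lam \<le> 0")
  \<comment> \<open>\<open>power_method\<close> needs a positive \<open>lam\<close>; here
    nonnegativity of the output is enough.\<close>
  case True
  then have "(1 - \<eta>) * lam / (2 * (real h - real r)) \<le> 0"
    using \<eta> rh by (intro divide_nonpos_pos) (auto simp: mult_le_0_iff)
  then show ?thesis using out_nonneg by linarith
next
  case False
  interpret psd_form n "gram (wt (Suc n))" using wt_nonneg by (rule psd_form_gram)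
  define Q where "Q = snd (run (Suc n))"
  let ?R = "{i \<in> In. wt (Suc n) i = 0}"
  have "(\<Sum>i\<in>?R. score x i)\<^sup>2 \<le> (\<Sum>i\<in>?R. 1\<^sup>2) * (\<Sum>i\<in>?R. (score x i)\<^sup>2)"
    using Cauchy_Schwarz_ineq_sum[of "\<lambda>_. 1" "score x" ?R] by simp
  also have "\<dots> \<le> real (Suc n * n * n) * K"
  proof (intro mult_mono)
    show "(\<Sum>i\<in>?R. 1\<^sup>2) \<le> real (Suc n * n * n)" 
      using card_removed by (simp only: power_one sum_constant mult_1_right of_nat_le_iff of_nat_mono)
    have "(\<Sum>i\<in>?R. (score x i)\<^sup>2) \<le> (\<Sum>i\<in>In. (score x i)\<^sup>2)" using fin by (intro sum_mono2) auto
    then show "(\<Sum>i\<in>?R. (score x i)\<^sup>2) \<le> K" using K by linarith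
  qed (auto intro: sum_nonneg)
  finally have rem: "(\<Sum>i\<in>?R. score x i) \<le> sqrt (real (Suc n * n * n) * K)"
    by (rule real_le_rsqrt)
  have "en In (Suc n) x = (\<Sum>i\<in>In. score x i - (if wt (Suc n) i = 0 then score x i else 0))"
    unfolding en_def using wt_01[of "Suc n"] by (intro sum.cong refl) (auto)
  also have "\<dots> = (\<Sum>i\<in>In. score x i) - (\<Sum>i\<in>?R. score x i)"
    using fin by (simp only: sum_subtractf sum.inter_filter)
  finally have "lam \<le> en In (Suc n) x" using lam rem by linarith
  then have lam': "lam \<le> qf n (gram (wt (Suc n))) x"
    unfolding qf_split using en_nonneg[of Out "Suc n" x] by linarith
  have Q: "Q = pw n (gram (wt (Suc n))) b" unfolding Q_def by (rule run_Suc)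
  have "0 < lam" using False by simp
  note pm = power_method[OF x this lam' \<eta>(1) _ ln_n_le, folded Q]
  define L where "L = (\<Sum>j<n. dot n (\<lambda>k. Q k j) (\<lambda>k. Q k j))"
  define R where "R = (\<Sum>j<n. qf n (gram (wt (Suc n))) (\<lambda>k. Q k j))"
  have RL: "(1 - \<eta>) * lam * L \<le> R" "0 < R" using pm \<eta> by (auto simp: L_def R_def)
  have "L \<noteq> 0"
  proof
    assume "L = 0"
    then have "\<forall>j<n. dot n (\<lambda>k. Q k j) (\<lambda>k. Q k j) = 0"
      unfolding L_def by (subst (asm) sum_nonneg_eq_0_iff) (auto simp: dot_self_nonneg)
    then have "\<forall>j<n. \<forall>k<n. Q k j = 0"
      unfolding dot_def by (subst (asm) sum_nonneg_eq_0_iff) auto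
    then have "R = 0" by (simp add: R_def qf_def dot_def)
    then show False using RL by simp
  qed
  moreover have "L \<ge> 0" by (simp add: L_def sum_nonneg dot_self_nonneg)
  ultimately have "(1 - \<eta>) * lam \<le> R / L" using RL by (simp add: le_divide_eq)
  then show ?thesis
    unfolding out_eq Q_def[symmetric] L_def[symmetric] R_def[symmetric]
    using rh by (intro divide_right_mono) auto
qed

end


section \<open>A program logic for the real RAM\<close>


text \<open>The memory behind the input is split into 16 interleaved arrays \<open>A t\<close>, which therefore cannot
  overlap, whatever their lengths. \<open>X\<close> is the content of the output cell and the input cells.\<close>

definition mk :: "(nat \<Rightarrow> real) \<Rightarrow> (nat \<Rightarrow> nat) \<Rightarrow> (nat \<Rightarrow> nat \<Rightarrow> real) \<Rightarrow> state" where
  "mk X N A = (N, \<lambda>a. if a \<le> N 0 * N 1 then X a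
     else A ((a - Suc (N 0 * N 1)) mod 16) ((a - Suc (N 0 * N 1)) div 16))"

definition reg :: "nat \<Rightarrow> nexp" where "reg c = NCell (NConst c)"

definition addr :: "nat \<Rightarrow> nexp \<Rightarrow> nexp" where
  "addr t e = NAdd (NAdd (NMul e (NConst 16)) (NConst t)) (NAdd (NMul (reg 0) (reg 1)) (NConst 1))"

definition rd :: "nat \<Rightarrow> nexp \<Rightarrow> rexp" where "rd t e = RCell (addr t e)"
definition wr :: "nat \<Rightarrow> nexp \<Rightarrow> rexp \<Rightarrow> prog" where "wr t e v = RStore (addr t e) v"
definition inp :: "nexp \<Rightarrow> rexp" where "inp e = RCell (NAdd e (NConst 1))"

lemma nval_reg [simp]: "nval (reg c) (mk X N A) = N c"
  by (simp add: reg_def mk_def)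

lemma rval_rd [simp]: "t < 16 \<Longrightarrow> rval (rd t e) (mk X N A) = A t (nval e (mk X N A))"
  by (simp add: rd_def addr_def) (simp add: mk_def)

lemma rval_inp: "nval e (mk X N A) < N 0 * N 1 \<Longrightarrow> rval (inp e) (mk X N A) = X (Suc (nval e (mk X N A)))"
  by (simp add: inp_def) (simp add: mk_def)

lemma exec_NStore_mk:
  assumes "2 \<le> c"
  shows "exec (NStore (NConst c) e) (mk X N A) 1 (mk X (N(c := nval e (mk X N A))) A)"
proof -
  have "mk X (N(c := z)) A = ((fst (mk X N A))(nval (NConst c) (mk X N A) := z), snd (mk X N A))" for z
  proof -
    have e: "(N(c := z)) 0 = N 0" "(N(c := z)) 1 = N 1" using assms by auto
    show ?thesis unfolding mk_def e by simp
  qed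
  then show ?thesis by (simp only: exec.NStore)
qed

lemma exec_wr:
  assumes "t < 16"
  shows "exec (wr t e v) (mk X N A) 1
    (mk X N (A(t := (A t)(nval e (mk X N A) := rval v (mk X N A)))))"
proof -
  have 1: "nval (addr t e) (mk X N A) = nval e (mk X N A) * 16 + t + Suc (N 0 * N 1)"
    by (simp add: addr_def)
  have 2: "d mod 16 = t \<and> d div 16 = i \<longleftrightarrow> d = i * 16 + t" for d i :: nat
    using assms by auto
  have "snd (mk X N (A(t := (A t)(i := z)))) = (snd (mk X N A))(i * 16 + t + Suc (N 0 * N 1) := z)" for i z
  proof
    fix a
    show "snd (mk X N (A(t := (A t)(i := z)))) a = ((snd (mk X N A))(i * 16 + t + Suc (N 0 * N 1) := z)) a"
      using 2[of "a - Suc (N 0 * N 1)" i] by (auto simp: mk_def)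
  qed
  then have "mk X N (A(t := (A t)(nval e (mk X N A) := rval v (mk X N A)))) =
      (fst (mk X N A), (snd (mk X N A))(nval (addr t e) (mk X N A) := rval v (mk X N A)))"
    unfolding 1 by (simp add: prod_eq_iff) (simp add: mk_def)
  then show ?thesis unfolding wr_def by (simp only: exec.RStore)
qed

text \<open>Total correctness with a time bound. Input and number cells are the same before and
  after, so the state between two commands is described by the arrays alone.\<close>

definition does :: "(nat \<Rightarrow> real) \<Rightarrow> (nat \<Rightarrow> nat) \<Rightarrow> prog \<Rightarrow> (nat \<Rightarrow> nat \<Rightarrow> real) \<Rightarrow> nat \<Rightarrow>
    ((nat \<Rightarrow> nat \<Rightarrow> real) \<Rightarrow> bool) \<Rightarrow> bool" where
  "does X N p A T Q \<longleftrightarrow> (\<exists>t A'. exec p (mk X N A) t (mk X N A') \<and> t \<le> T \<and> Q A')"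

lemma does_Skip: "Q A \<Longrightarrow> 1 \<le> T \<Longrightarrow> does X N Skip A T Q"
  unfolding does_def using exec.Skip by blast

lemma does_wr:
  "t < 16 \<Longrightarrow> Q (A(t := (A t)(nval e (mk X N A) := rval v (mk X N A)))) \<Longrightarrow> 1 \<le> T \<Longrightarrow>
    does X N (wr t e v) A T Q"
  unfolding does_def using exec_wr by blast

lemma does_Seq:
  assumes "does X N p A T1 R" "\<And>A'. R A' \<Longrightarrow> does X N q A' T2 Q" "T1 + T2 \<le> T"
  shows "does X N (Seq p q) A T Q"
  using assms unfolding does_def by (meson add_mono order_trans exec.Seq)

lemma does_Seq_wr:
  assumes "t < 16" "does X N q (A(t := (A t)(nval e (mk X N A) := rval v (mk X N A)))) T Q" "Suc T \<le> T'"
  shows "does X N (Seq (wr t e v) q) A T' Q"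
  by (rule does_Seq[where R = "\<lambda>A'. A' = A(t := (A t)(nval e (mk X N A) := rval v (mk X N A)))"
      and ?T1.0 = 1 and ?T2.0 = T]) (use assms in \<open>auto intro: does_wr\<close>)

lemma does_Cond:
  assumes "tval c (mk X N A) \<Longrightarrow> does X N p A T Q" "\<not> tval c (mk X N A) \<Longrightarrow> does X N q A T Q"
    "Suc T \<le> T'"
  shows "does X N (Cond c p q) A T' Q"
  using assms unfolding does_def by (metis Suc_le_mono exec.CondFalse exec.CondTrue order_trans)

text \<open>Each iteration costs a test and an increment besides the body, and leaving costs the
  last test and the reset; hence the bounds of the form \<open>K * (T + 2) + 2\<close>.\<close>

definition For :: "nat \<Rightarrow> nexp \<Rightarrow> prog \<Rightarrow> prog" where
  "For c e p = Seq (Loop (NLess (reg c) e) (Seq p (NStore (NConst c) (NAdd (reg c) (NConst 1)))))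
     (NStore (NConst c) (NConst 0))"

text \<open>Every loop resets its counter, so outside of its loop each counter is zero.\<close>

lemma does_For:
  assumes c: "2 \<le> c" "N c = 0"
    and K: "\<And>i A. nval e (mk X (N(c := i)) A) = K"
    and init: "I 0 A"
    and step: "\<And>i A. i < K \<Longrightarrow> I i A \<Longrightarrow> does X (N(c := i)) p A T (I (Suc i))"
    and post: "\<And>A'. I K A' \<Longrightarrow> Q A'"
    and T': "K * (T + 2) + 2 \<le> T'"
  shows "does X N (For c e p) A T' Q"
proof -
  let ?L = "Loop (NLess (reg c) e) (Seq p (NStore (NConst c) (NAdd (reg c) (NConst 1))))"
  have loop: "i \<le> K \<Longrightarrow> I i A \<Longrightarrow> \<exists>t A'. exec ?L (mk X (N(c := i)) A) t (mk X (N(c := K)) A') \<and>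
      t \<le> (K - i) * (T + 2) + 1 \<and> I K A'" for i A
  proof (induction "K - i" arbitrary: i A)
    case 0
    then have "i = K" by simp
    moreover have "\<not> tval (NLess (reg c) e) (mk X (N(c := K)) A)" by (simp add: K)
    ultimately have "exec ?L (mk X (N(c := i)) A) 1 (mk X (N(c := K)) A)"
      using exec.LoopFalse by simp
    moreover have "I K A" using 0 \<open>i = K\<close> by simp
    ultimately show ?case by (intro exI conjI) (assumption, simp, assumption)
  next
    case (Suc d)
    then have i: "i < K" by simp
    obtain t A1 where t: "exec p (mk X (N(c := i)) A) t (mk X (N(c := i)) A1)" "t \<le> T" "I (Suc i) A1"
      using step[OF i Suc.prems(2)] by (auto simp: does_def)
    have "exec (NStore (NConst c) (NAdd (reg c) (NConst 1))) (mk X (N(c := i)) A1) 1 (mk X (N(c := Suc i)) A1)"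
      using exec_NStore_mk[OF c(1), of "NAdd (reg c) (NConst 1)" X "N(c := i)" A1] by simp
    from exec.Seq[OF t(1) this]
    have body: "exec (Seq p (NStore (NConst c) (NAdd (reg c) (NConst 1)))) (mk X (N(c := i)) A) (t + 1)
        (mk X (N(c := Suc i)) A1)" .
    obtain u A' where u: "exec ?L (mk X (N(c := Suc i)) A1) u (mk X (N(c := K)) A')"
      "u \<le> (K - Suc i) * (T + 2) + 1" "I K A'"
    proof -
      have "d = K - Suc i" "Suc i \<le> K" using Suc.hyps(2) i by simp_all
      then show thesis using that Suc.hyps(1)[of "Suc i" A1] t(3) by blast
    qed
    have "tval (NLess (reg c) e) (mk X (N(c := i)) A)" using i by (simp add: K)
    from exec.LoopTrue[OF this body u(1)]
    have "exec ?L (mk X (N(c := i)) A) (Suc (t + 1 + u)) (mk X (N(c := K)) A')" .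
    moreover have "Suc (t + 1 + u) \<le> (K - i) * (T + 2) + 1"
    proof -
      have "K - i = Suc (K - Suc i)" using i by simp
      then show ?thesis using t(2) u(2) by simp
    qed
    ultimately show ?case using u(3) by blast
  qed
  have N: "N(c := 0) = N" using c by auto
  obtain t A' where t: "exec ?L (mk X N A) t (mk X (N(c := K)) A')" "t \<le> K * (T + 2) + 1" "I K A'"
    using loop[of 0 A] init by (auto simp: N)
  have "exec (NStore (NConst c) (NConst 0)) (mk X (N(c := K)) A') 1 (mk X N A')"
    using exec_NStore_mk[OF c(1), of "NConst 0" X "N(c := K)" A'] by (simp add: N)
  from exec.Seq[OF t(1) this] show ?thesis
    unfolding does_def For_def using t(2) post[OF t(3)] T' by force
qed

definition SumTo :: "nat \<Rightarrow> nat \<Rightarrow> nexp \<Rightarrow> rexp \<Rightarrow> prog" where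
  "SumTo t c e x = Seq (wr t (NConst 0) (RConst 0)) (For c e (wr t (NConst 0) (RAdd (rd t (NConst 0)) x)))"

lemma does_SumTo:
  assumes "t < 16" "2 \<le> c" "N c = 0" "\<And>i A. nval e (mk X (N(c := i)) A) = K"
    and x: "\<And>i a. i < K \<Longrightarrow> rval x (mk X (N(c := i)) (A(t := a))) = f i"
    and Q: "Q (A(t := (A t)(0 := \<Sum>i<K. f i)))" and T: "3 * K + 3 \<le> T"
  shows "does X N (SumTo t c e x) A T Q"
  unfolding SumTo_def
proof (rule does_Seq_wr[where T = "3 * K + 2"], goal_cases)
  case 2
  show ?case
  proof (rule does_For[where I = "\<lambda>j A'. A' = A(t := (A t)(0 := \<Sum>i<j. f i))" and T = 1])
    show "does X (N(c := i)) (wr t (NConst 0) (RAdd (rd t (NConst 0)) x)) A1 1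
        (\<lambda>A'. A' = A(t := (A t)(0 := \<Sum>i<Suc i. f i)))"
      if "i < K" "A1 = A(t := (A t)(0 := \<Sum>i<i. f i))" for i A1
      using that assms(1) by (intro does_wr) (auto simp: x)
  qed (use assms in auto)
qed (use assms in auto)

text \<open>Arrays: differences, weights, Gram matrix, current power, product buffer, rounded
  direction, scores, and, in cell 0, cut-off factor, column maximum, accumulator, power of two,
  quantile, count, number being rounded (\<open>tY\<close>, \<open>tW\<close>, \<open>tM\<close>,
  \<open>tQ\<close>, \<open>tR\<close>, \<open>tV\<close>, \<open>tS\<close>, \<open>tTH\<close>,
  \<open>tMX\<close>, \<open>tAC\<close>, \<open>tHH\<close>, \<open>tQU\<close>,
  \<open>tCN\<close>, \<open>tU\<close>). \<open>tHH\<close> and \<open>tCN\<close> are reused for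
  the final quotient. Number cells 0 to 4 hold \<open>n\<close>, \<open>m\<close>, \<open>h\<close>,
  \<open>b\<close>, \<open>r\<close>; cells 5 to 9 are loop counters, with 8 and 9 for the loops
  around code that already uses 5 to 7.\<close>

abbreviation (input) "tY \<equiv> 0 :: nat"
abbreviation (input) "tW \<equiv> 14 :: nat"
abbreviation (input) "tM \<equiv> 2 :: nat"
abbreviation (input) "tQ \<equiv> 3 :: nat"
abbreviation (input) "tR \<equiv> 4 :: nat"
abbreviation (input) "tV \<equiv> 5 :: nat"
abbreviation (input) "tS \<equiv> 6 :: nat"
abbreviation (input) "tTH \<equiv> 7 :: nat"
abbreviation (input) "tMX \<equiv> 8 :: nat"
abbreviation (input) "tAC \<equiv> 9 :: nat"
abbreviation (input) "tHH \<equiv> 10 :: nat"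
abbreviation (input) "tQU \<equiv> 11 :: nat"
abbreviation (input) "tCN \<equiv> 12 :: nat"
abbreviation (input) "tU \<equiv> 13 :: nat"

definition idx :: "nat \<Rightarrow> nat \<Rightarrow> nexp" where
  "idx c d = NAdd (NMul (reg c) (reg 0)) (reg d)"

lemma nval_idx [simp]: "nval (idx c d) (mk X N A) = N c * N 0 + N d"
  by (simp add: idx_def)

definition flat_mat :: "nat \<Rightarrow> (nat \<Rightarrow> real) \<Rightarrow> nat \<Rightarrow> nat \<Rightarrow> real" where
  "flat_mat n a = (\<lambda>i j. a (i * n + j))"

lemma index_inj: "c < n \<Longrightarrow> c' < n \<Longrightarrow> a * n + c = a' * n + c' \<longleftrightarrow> a = a' \<and> c = (c' :: nat)"
proof
  assume c: "c < n" "c' < n" and e: "a * n + c = a' * n + c'"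
  have "a = a'" using arg_cong[OF e, of "\<lambda>x. x div n"] c by simp
  then show "a = a' \<and> c = c'" using e by simp
qed auto

definition MaxWith :: "nat \<Rightarrow> rexp \<Rightarrow> prog" where
  "MaxWith t x = Cond (RLess (rd t (NConst 0)) x) (wr t (NConst 0) x) Skip"

lemma does_MaxWith:
  assumes "t < 16" "rval x (mk X N A) = z" "Q (A(t := (A t)(0 := max (A t 0) z)))" "2 \<le> T"
  shows "does X N (MaxWith t x) A T Q"
  unfolding MaxWith_def
proof (rule does_Cond[where T = 1])
  assume "tval (RLess (rd t (NConst 0)) x) (mk X N A)"
  then show "does X N (wr t (NConst 0) x) A 1 Q"
    using assms by (intro does_wr) (auto simp: max_def)
next
  assume "\<not> tval (RLess (rd t (NConst 0)) x) (mk X N A)"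
  then have "A(t := (A t)(0 := max (A t 0) z)) = A" using assms by (auto simp: max_def fun_eq_iff)
  then show "does X N Skip A 1 Q" using assms by (intro does_Skip) auto
qed (use assms in auto)

definition ColMax :: prog where
  "ColMax = Seq (wr tMX (NConst 0) (RConst 0)) (For 6 (reg 0)
    (Seq (MaxWith tMX (rd tQ (idx 6 5))) (MaxWith tMX (RSub (RConst 0) (rd tQ (idx 6 5))))))"

lemma does_ColMax:
  assumes "N 6 = 0" "N 0 = n" "N 5 = j"
    and Q: "Q (A(tMX := (A tMX)(0 := colmax (flat_mat n (A tQ)) j n)))" and T: "6 * n + 3 \<le> T"
  shows "does X N ColMax A T Q"
  unfolding ColMax_def
proof (rule does_Seq_wr[where T = "6 * n + 2"], goal_cases)
  case 2
  show ?case
  proof (rule does_For[where I = "\<lambda>k A'. A' = A(tMX := (A tMX)(0 := colmax (flat_mat n (A tQ)) j k))" and T = 4])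
    fix k A1
    assume A1: "A1 = A(tMX := (A tMX)(0 := colmax (flat_mat n (A tQ)) j k))"
    show "does X (N(6 := k)) (Seq (MaxWith tMX (rd tQ (idx 6 5)))
        (MaxWith tMX (RSub (RConst 0) (rd tQ (idx 6 5))))) A1 4
        (\<lambda>A'. A' = A(tMX := (A tMX)(0 := colmax (flat_mat n (A tQ)) j (Suc k))))"
      by (rule does_Seq[where R = "\<lambda>A'. A' = A(tMX := (A tMX)(0 := max (colmax (flat_mat n (A tQ)) j k) (A tQ (k * n + j))))"
            and ?T1.0 = 2 and ?T2.0 = 2])
        (auto simp: A1 assms flat_mat_def max_def intro!: does_MaxWith)
  qed (use assms in auto)
qed (use T in auto)

definition RoundBit :: prog where
  "RoundBit = Seq (Cond (RLess (rd tU (NConst 0)) (RAdd (rd tV (reg 6)) (rd tHH (NConst 0)))) Skip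
      (wr tV (reg 6) (RAdd (rd tV (reg 6)) (rd tHH (NConst 0)))))
    (wr tHH (NConst 0) (RMul (rd tHH (NConst 0)) (RConst (1/2))))"

definition RoundOne :: prog where
  "RoundOne = Seq (wr tU (NConst 0) (RDiv (rd tQ (idx 6 5)) (rd tMX (NConst 0))))
    (Seq (wr tV (reg 6) (RConst (- 1)))
    (Seq (wr tHH (NConst 0) (RConst 1)) (For 7 (reg 3) RoundBit)))"

definition Round :: prog where "Round = For 6 (reg 0) RoundOne"

lemma does_RoundBit:
  fixes A u k
  defines "S \<equiv> \<lambda>l. A(tU := (A tU)(0 := u), tV := (A tV)(k := dyadic l u), tHH := (A tHH)(0 := (1/2) ^ l))"
  assumes "N 6 = k"
  shows "does X N RoundBit (S l) 3 (\<lambda>A'. A' = S (Suc l))"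
  unfolding RoundBit_def
proof (rule does_Seq[where R = "\<lambda>A'. A' = (S l)(tV := (S l tV)(k := dyadic (Suc l) u))"
      and ?T1.0 = 2 and ?T2.0 = 1])
  show "does X N (Cond (RLess (rd tU (NConst 0)) (RAdd (rd tV (reg 6)) (rd tHH (NConst 0)))) Skip
      (wr tV (reg 6) (RAdd (rd tV (reg 6)) (rd tHH (NConst 0))))) (S l) 2
      (\<lambda>A'. A' = (S l)(tV := (S l tV)(k := dyadic (Suc l) u)))"
    by (rule does_Cond[where T = 1]) (auto simp: S_def assms fun_eq_iff intro!: does_Skip does_wr)
qed (auto simp: S_def assms fun_eq_iff intro!: does_wr)

lemma does_RoundOne:
  assumes N: "N 6 = k" "N 7 = 0" "N 0 = n" "N 5 = j" "N 3 = b"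
    and Q: "Q (A(tU := (A tU)(0 := A tQ (k * n + j) / A tMX 0),
      tV := (A tV)(k := dyadic b (A tQ (k * n + j) / A tMX 0)), tHH := (A tHH)(0 := (1/2) ^ b)))"
  shows "does X N RoundOne A (5 * b + 5) Q"
  unfolding RoundOne_def
proof (rule does_Seq_wr[where T = "5 * b + 4"], goal_cases)
  case 2
  let ?u = "A tQ (k * n + j) / A tMX 0"
  show ?case
  proof (rule does_Seq_wr[where T = "5 * b + 3"], goal_cases)
    case 2
    show ?case
    proof (rule does_Seq_wr[where T = "5 * b + 2"], goal_cases)
      case 2
      let ?S = "\<lambda>l. A(tU := (A tU)(0 := ?u), tV := (A tV)(k := dyadic l ?u), tHH := (A tHH)(0 := (1/2) ^ l))"
      show ?case
      proof (rule does_For[where T = 3 and K = b and I = "\<lambda>l A'. A' = ?S l"], goal_cases)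
        case (5 l A1)
        then show ?case using does_RoundBit[of "N(7 := l)" k X A ?u l] N by simp
      next
        case (6 A')
        then show ?case using Q by simp
      qed (use N in \<open>auto simp: fun_eq_iff\<close>)
    qed auto
  qed auto
qed auto

lemma does_Round:
  assumes N: "N 6 = 0" "N 7 = 0" "N 0 = n" "N 5 = j" "N 3 = b"
    and mx: "A tMX 0 = colmax (flat_mat n (A tQ)) j n"
    and Q: "\<And>A'. (\<And>k. k < n \<Longrightarrow> A' tV k = dir n b (flat_mat n (A tQ)) j k) \<Longrightarrow>
      (\<And>t. t \<notin> {tU, tV, tHH} \<Longrightarrow> A' t = A t) \<Longrightarrow> Q A'"
    and T: "n * (5 * b + 7) + 2 \<le> T"
  shows "does X N Round A T Q"
  unfolding Round_def
proof (rule does_For[where I = "\<lambda>k A'. (\<forall>i<k. A' tV i = dir n b (flat_mat n (A tQ)) j i) \<and>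
    (\<forall>t. t \<notin> {tU, tV, tHH} \<longrightarrow> A' t = A t)" and T = "5 * b + 5" and K = n])
  fix k A1
  assume k: "k < n" and A1: "(\<forall>i<k. A1 tV i = dir n b (flat_mat n (A tQ)) j i) \<and>
    (\<forall>t. t \<notin> {tU, tV, tHH} \<longrightarrow> A1 t = A t)"
  show "does X (N(6 := k)) RoundOne A1 (5 * b + 5)
    (\<lambda>A'. (\<forall>i<Suc k. A' tV i = dir n b (flat_mat n (A tQ)) j i) \<and> (\<forall>t. t \<notin> {tU, tV, tHH} \<longrightarrow> A' t = A t))"
    by (rule does_RoundOne[where n = n and j = j and k = k])
      (use A1 N mx in \<open>auto simp: less_Suc_eq dir_def flat_mat_def\<close>)
qed (use N Q T in \<open>auto simp: algebra_simps\<close>)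

text \<open>The range \<open>r + h\<close> covers the batch and the filtered part also when
  \<open>h < r\<close>. This occurs: without samples \<open>h\<close> is 0, but \<open>r\<close> is
  computed from \<open>n\<close> and \<open>b\<close> all the same.\<close>

definition Scores :: prog where
  "Scores = For 6 (NAdd (reg 4) (reg 2))
    (Seq (SumTo tAC 7 (reg 0) (RMul (rd tV (reg 7)) (rd tY (idx 6 7))))
      (wr tS (reg 6) (RMul (rd tAC (NConst 0)) (rd tAC (NConst 0)))))"

definition Count :: prog where
  "Count = Seq (wr tCN (NConst 0) (RConst 0)) (For 7 (reg 4)
    (Cond (RLess (rd tS (reg 7)) (rd tS (reg 6))) Skip
      (wr tCN (NConst 0) (RAdd (rd tCN (NConst 0)) (RConst 1)))))"

definition Quant :: "real \<Rightarrow> prog" where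
  "Quant \<rho> = Seq (wr tQU (NConst 0) (RConst 0)) (For 6 (reg 4) (Seq Count
    (Cond (Conj (Neg (RLess (rd tCN (NConst 0)) (RMul (RConst \<rho>) (ROfNat (reg 4)))))
        (RLess (rd tQU (NConst 0)) (rd tS (reg 6))))
      (wr tQU (NConst 0) (rd tS (reg 6))) Skip)))"

definition Filt :: prog where
  "Filt = For 6 (reg 2) (Cond (RLess (RMul (rd tTH (NConst 0)) (rd tQU (NConst 0))) (rd tS (reg 6)))
    (wr tW (reg 6) (RConst 0)) Skip)"

definition DirStep :: "real \<Rightarrow> prog" where
  "DirStep \<rho> = Seq ColMax (Seq Round (Seq Scores (Seq (Quant \<rho>) Filt)))"

definition Filters :: "real \<Rightarrow> prog" where "Filters \<rho> = For 5 (reg 0) (DirStep \<rho>)"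

definition MatP :: "nat \<Rightarrow> nexp \<Rightarrow> rexp \<Rightarrow> prog" where
  "MatP t e x = For 5 (reg 0) (For 6 (reg 0) (Seq (SumTo tAC 7 e x) (wr t (idx 5 6) (rd tAC (NConst 0)))))"

definition Copy :: "nat \<Rightarrow> nat \<Rightarrow> prog" where
  "Copy s t = For 5 (NMul (reg 0) (reg 0)) (wr t (reg 5) (rd s (reg 5)))"

text \<open>Squaring in place would overwrite entries that are still to be read, so the product is
  built in \<open>tR\<close> and copied back.\<close>

definition Square :: prog where
  "Square = Seq (MatP tR (reg 0) (RMul (rd tQ (idx 5 7)) (rd tQ (idx 7 6)))) (Copy tR tQ)"

definition Power :: prog where "Power = For 8 (reg 3) Square"

definition Gram :: prog where
  "Gram = MatP tM (reg 2) (RMul (RMul (rd tW (reg 7)) (rd tY (idx 7 5))) (rd tY (idx 7 6)))"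

definition Step :: "real \<Rightarrow> prog" where
  "Step \<rho> = Seq (Filters \<rho>) (Seq Gram (Seq (Copy tM tQ) Power))"

definition Main :: "real \<Rightarrow> prog" where "Main \<rho> = For 9 (NAdd (reg 0) (NConst 1)) (Step \<rho>)"

definition Ratio :: prog where
  "Ratio = Seq (MatP tR (reg 0) (RMul (rd tM (idx 5 7)) (rd tQ (idx 7 6))))
    (Seq (SumTo tHH 5 (NMul (reg 0) (reg 0)) (RMul (rd tQ (reg 5)) (rd tR (reg 5))))
      (SumTo tCN 5 (NMul (reg 0) (reg 0)) (RMul (rd tQ (reg 5)) (rd tQ (reg 5)))))"

lemma does_MatP:
  assumes t: "t < 16" "t \<noteq> tAC" and N: "N 0 = n" "N 5 = 0" "N 6 = 0" "N 7 = 0"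
    and K: "\<And>a c i A. nval e (mk X (N(5 := a, 6 := c, 7 := i)) A) = K"
    and x: "\<And>a c i A'. a < n \<Longrightarrow> c < n \<Longrightarrow> i < K \<Longrightarrow> (\<And>s. s \<notin> {t, tAC} \<Longrightarrow> A' s = A s) \<Longrightarrow>
      rval x (mk X (N(5 := a, 6 := c, 7 := i)) A') = f a c i"
    and Q: "\<And>A'. (\<And>a c. a < n \<Longrightarrow> c < n \<Longrightarrow> flat_mat n (A' t) a c = (\<Sum>i<K. f a c i)) \<Longrightarrow>
      (\<And>s. s \<notin> {t, tAC} \<Longrightarrow> A' s = A s) \<Longrightarrow> Q A'"
    and T: "n * (n * (3 * K + 6) + 4) + 2 \<le> T"
  shows "does X N (MatP t e x) A T Q"
proof -
  \<comment> \<open>Row-major progress: the entries lexicographically before \<open>(a, c)\<close>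
    are final.\<close>
  define J where "J = (\<lambda>a c A'. (\<forall>a'<n. \<forall>c'<n. (a' < a \<or> a' = a \<and> c' < c) \<longrightarrow> flat_mat n (A' t) a' c' = (\<Sum>i<K. f a' c' i)) \<and>
      (\<forall>s. s \<notin> {t, tAC} \<longrightarrow> A' s = A s))"
  have one: "does X (N(5 := a, 6 := c)) (Seq (SumTo tAC 7 e x) (wr t (idx 5 6) (rd tAC (NConst 0)))) A1
      (3 * K + 4) (J a (Suc c))" if ac: "a < n" "c < n" and A1: "J a c A1" for a c A1
  proof (rule does_Seq[where ?T1.0 = "3 * K + 3" and ?T2.0 = 1 and R = "\<lambda>A'. A' = A1(tAC := (A1 tAC)(0 := \<Sum>i<K. f a c i))"])
    show "does X (N(5 := a, 6 := c)) (SumTo tAC 7 e x) A1 (3 * K + 3) (\<lambda>A'. A' = A1(tAC := (A1 tAC)(0 := \<Sum>i<K. f a c i)))"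
    proof (rule does_SumTo[where K = K and f = "f a c"])
      show "rval x (mk X (N(5 := a, 6 := c, 7 := i)) (A1(tAC := aa))) = f a c i" if "i < K" for i aa
        by (rule x[OF ac that]) (use A1 in \<open>simp add: J_def\<close>)
    qed (use N K in auto)
    fix A2 assume A2: "A2 = A1(tAC := (A1 tAC)(0 := \<Sum>i<K. f a c i))"
    show "does X (N(5 := a, 6 := c)) (wr t (idx 5 6) (rd tAC (NConst 0))) A2 1 (J a (Suc c))"
    proof (rule does_wr)
      show "J a (Suc c) (A2(t := (A2 t)(nval (idx 5 6) (mk X (N(5 := a, 6 := c)) A2) :=
          rval (rd tAC (NConst 0)) (mk X (N(5 := a, 6 := c)) A2))))"
        using A1 ac N t index_inj[of _ n c _ a] unfolding J_def A2 flat_mat_def by (auto simp: less_Suc_eq)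
    qed (use t in auto)
  qed auto
  have row: "does X (N(5 := a)) (For 6 (reg 0) (Seq (SumTo tAC 7 e x) (wr t (idx 5 6) (rd tAC (NConst 0))))) A1
      (n * (3 * K + 6) + 2) (J (Suc a) 0)" if a: "a < n" and A1: "J a 0 A1" for a A1
  proof (rule does_For[where I = "J a" and T = "3 * K + 4" and K = n])
    show "J (Suc a) 0 A'" if "J a n A'" for A'
      using that unfolding J_def by (auto simp: less_Suc_eq)
  qed (use one a A1 N in \<open>auto simp: algebra_simps\<close>)
  show ?thesis
    unfolding MatP_def
  proof (rule does_For[where I = "\<lambda>a. J a 0" and T = "n * (3 * K + 6) + 2" and K = n])
    show "J 0 0 A" by (simp add: J_def)
    show "Q A'" if "J n 0 A'" for A'
      using that by (intro Q) (auto simp: J_def)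
  qed (use row N T in \<open>auto simp: algebra_simps\<close>)
qed

lemma does_Copy:
  assumes "s < 16" "t < 16" "s \<noteq> t" "N 5 = 0" "N 0 = n"
    and Q: "\<And>A'. (\<And>i. i < n * n \<Longrightarrow> A' t i = A s i) \<Longrightarrow> (\<And>u. u \<noteq> t \<Longrightarrow> A' u = A u) \<Longrightarrow> Q A'"
    and T: "3 * (n * n) + 2 \<le> T"
  shows "does X N (Copy s t) A T Q"
  unfolding Copy_def
proof (rule does_For[where T = 1 and K = "n * n" and
    I = "\<lambda>i A'. (\<forall>j<i. A' t j = A s j) \<and> (\<forall>u. u \<noteq> t \<longrightarrow> A' u = A u)"])
  show "does X (N(5 := i)) (wr t (reg 5) (rd s (reg 5))) A1 1
      (\<lambda>A'. (\<forall>j<Suc i. A' t j = A s j) \<and> (\<forall>u. u \<noteq> t \<longrightarrow> A' u = A u))"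
    if "(\<forall>j<i. A1 t j = A s j) \<and> (\<forall>u. u \<noteq> t \<longrightarrow> A1 u = A u)" for i A1
    using that assms by (intro does_wr) (auto simp: less_Suc_eq)
qed (use assms in auto)

lemma index_less: "a < n \<Longrightarrow> c < n \<Longrightarrow> a * n + c < n * (n :: nat)"
proof -
  assume "a < n" "c < n"
  then have "a * n + c < Suc a * n" by simp
  also have "\<dots> \<le> n * n" using \<open>a < n\<close> by (intro mult_right_mono) auto
  finally show ?thesis .
qed

text \<open>A flat array determines a matrix only on the block of indices below \<open>n\<close>;
  \<open>flat_mat\<close> is arbitrary elsewhere, so equality of functions would be too much to
  ask.\<close>

definition eqm :: "nat \<Rightarrow> (nat \<Rightarrow> nat \<Rightarrow> real) \<Rightarrow> (nat \<Rightarrow> nat \<Rightarrow> real) \<Rightarrow> bool" where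
  "eqm n P Q \<longleftrightarrow> (\<forall>a<n. \<forall>c<n. P a c = Q a c)"

lemma does_Square:
  assumes N: "N 0 = n" "N 5 = 0" "N 6 = 0" "N 7 = 0" and A: "eqm n (flat_mat n (A tQ)) P"
    and Q: "\<And>A'. eqm n (flat_mat n (A' tQ)) (mm n P P) \<Longrightarrow> (\<And>s. s \<notin> {tR, tAC, tQ} \<Longrightarrow> A' s = A s) \<Longrightarrow> Q A'"
    and T: "n * (n * (3 * n + 9) + 4) + 4 \<le> T"
  shows "does X N Square A T Q"
  unfolding Square_def
proof (rule does_Seq[where R = "\<lambda>A'. eqm n (flat_mat n (A' tR)) (mm n P P) \<and> (\<forall>s. s \<notin> {tR, tAC} \<longrightarrow> A' s = A s)"
    and ?T1.0 = "n * (n * (3 * n + 6) + 4) + 2" and ?T2.0 = "3 * (n * n) + 2"])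
  show "does X N (MatP tR (reg 0) (RMul (rd tQ (idx 5 7)) (rd tQ (idx 7 6)))) A (n * (n * (3 * n + 6) + 4) + 2)
      (\<lambda>A'. eqm n (flat_mat n (A' tR)) (mm n P P) \<and> (\<forall>s. s \<notin> {tR, tAC} \<longrightarrow> A' s = A s))"
    by (rule does_MatP[where K = n and n = n and f = "\<lambda>a c k. P a k * P k c"])
      (use N A in \<open>auto simp: mm_def flat_mat_def eqm_def\<close>)
  fix A1 assume A1: "eqm n (flat_mat n (A1 tR)) (mm n P P) \<and> (\<forall>s. s \<notin> {tR, tAC} \<longrightarrow> A1 s = A s)"
  show "does X N (Copy tR tQ) A1 (3 * (n * n) + 2) Q"
    by (rule does_Copy[where n = n], (use N in simp)+, rule Q)
      (use A1 index_less in \<open>auto simp: eqm_def flat_mat_def\<close>)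
qed (use T in \<open>auto simp: algebra_simps\<close>)

lemma does_Power:
  assumes N: "N 0 = n" "N 3 = b" "N 5 = 0" "N 6 = 0" "N 7 = 0" "N 8 = 0" and A: "eqm n (flat_mat n (A tQ)) P"
    and Q: "\<And>A'. eqm n (flat_mat n (A' tQ)) (pw n P b) \<Longrightarrow> (\<And>s. s \<notin> {tR, tAC, tQ} \<Longrightarrow> A' s = A s) \<Longrightarrow> Q A'"
    and T: "b * (n * (n * (3 * n + 9) + 4) + 6) + 2 \<le> T"
  shows "does X N Power A T Q"
  unfolding Power_def
proof (rule does_For[where K = b and T = "n * (n * (3 * n + 9) + 4) + 4" and
    I = "\<lambda>l A'. eqm n (flat_mat n (A' tQ)) (pw n P l) \<and> (\<forall>s. s \<notin> {tR, tAC, tQ} \<longrightarrow> A' s = A s)"])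
  fix l A1 assume "eqm n (flat_mat n (A1 tQ)) (pw n P l) \<and> (\<forall>s. s \<notin> {tR, tAC, tQ} \<longrightarrow> A1 s = A s)"
  then show "does X (N(8 := l)) Square A1 (n * (n * (3 * n + 9) + 4) + 4)
      (\<lambda>A'. eqm n (flat_mat n (A' tQ)) (pw n P (Suc l)) \<and> (\<forall>s. s \<notin> {tR, tAC, tQ} \<longrightarrow> A' s = A s))"
    using N by (intro does_Square[where n = n and P = "pw n P l"]) auto
qed (use N A Q T in \<open>auto simp: algebra_simps\<close>)

lemma colmax_cong: "(\<And>k. k < n \<Longrightarrow> P k j = P' k j) \<Longrightarrow> colmax P j n = colmax P' j n"
  by (induction n) simp_all

lemma sum_square_index: "(\<Sum>i<n * n. f i) = (\<Sum>a<n. \<Sum>c<n. f (a * n + c))"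
  for f :: "nat \<Rightarrow> real"
proof -
  have "(\<Sum>i<n * n. f i) = (\<Sum>a<n. sum f {a * n..<a * n + n})" by (rule sum.nat_group[symmetric])
  also have "\<dots> = (\<Sum>a<n. \<Sum>c<n. f (a * n + c))"
  proof (rule sum.cong[OF refl])
    fix a
    show "sum f {a * n..<a * n + n} = (\<Sum>c<n. f (a * n + c))"
      using sum.shift_bounds_nat_ivl[of f 0 "a * n" n] by (simp add: atLeast0LessThan add.commute)
  qed
  finally show ?thesis .
qed

section \<open>Correctness and cost of the filtering rounds\<close>

context filtering
begin

lemma score_cong: "(\<And>k. k < n \<Longrightarrow> v k = v' k) \<Longrightarrow> score v = score v'"
  by (auto simp: score_def dot_def)

lemma quant_cong: "score v = score v' \<Longrightarrow> quant v i = quant v' i"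
  by (induction i) (simp_all add: cnt_def)

lemma filt_cong: "(\<And>k. k < n \<Longrightarrow> v k = v' k) \<Longrightarrow> w i = w' i \<Longrightarrow> filt v w i = filt v' w' i"
  using score_cong[of v v'] quant_cong[of v v' r] by (simp add: filt_def)

lemma does_Scores:
  assumes N: "N 0 = n" "N 2 = h" "N 4 = r" "N 6 = 0" "N 7 = 0" and Y: "flat_mat n (A tY) = Y"
    and Q: "\<And>A'. (\<And>i. i < r + h \<Longrightarrow> A' tS i = score (A tV) i) \<Longrightarrow> (\<And>s. s \<notin> {tS, tAC} \<Longrightarrow> A' s = A s) \<Longrightarrow> Q A'"
    and T: "(r + h) * (3 * n + 6) + 2 \<le> T"
  shows "does X N Scores A T Q"
  unfolding Scores_def
proof (rule does_For[where K = "r + h" and T = "3 * n + 4" and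
    I = "\<lambda>i A'. (\<forall>j<i. A' tS j = score (A tV) j) \<and> (\<forall>s. s \<notin> {tS, tAC} \<longrightarrow> A' s = A s)"])
  fix i A1 assume A1: "(\<forall>j<i. A1 tS j = score (A tV) j) \<and> (\<forall>s. s \<notin> {tS, tAC} \<longrightarrow> A1 s = A s)"
  let ?d = "dot n (A tV) (Y i)"
  show "does X (N(6 := i)) (Seq (SumTo tAC 7 (reg 0) (RMul (rd tV (reg 7)) (rd tY (idx 6 7))))
      (wr tS (reg 6) (RMul (rd tAC (NConst 0)) (rd tAC (NConst 0))))) A1 (3 * n + 4)
      (\<lambda>A'. (\<forall>j<Suc i. A' tS j = score (A tV) j) \<and> (\<forall>s. s \<notin> {tS, tAC} \<longrightarrow> A' s = A s))"
  proof (rule does_Seq[where R = "\<lambda>A'. A' = A1(tAC := (A1 tAC)(0 := ?d))" and ?T1.0 = "3 * n + 3" and ?T2.0 = 1])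
    show "does X (N(6 := i)) (SumTo tAC 7 (reg 0) (RMul (rd tV (reg 7)) (rd tY (idx 6 7)))) A1 (3 * n + 3)
      (\<lambda>A'. A' = A1(tAC := (A1 tAC)(0 := ?d)))"
      by (rule does_SumTo[where K = n and f = "\<lambda>k. A tV k * Y i k"])
        (use N A1 in \<open>auto simp: dot_def Y[symmetric] flat_mat_def\<close>)
  next
    fix A2 assume "A2 = A1(tAC := (A1 tAC)(0 := ?d))"
    then show "does X (N(6 := i)) (wr tS (reg 6) (RMul (rd tAC (NConst 0)) (rd tAC (NConst 0)))) A2 1
      (\<lambda>A'. (\<forall>j<Suc i. A' tS j = score (A tV) j) \<and> (\<forall>s. s \<notin> {tS, tAC} \<longrightarrow> A' s = A s))"
      using A1 by (intro does_wr) (auto simp: less_Suc_eq score_def power2_eq_square)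
  qed auto
qed (use N Q T in \<open>auto simp: algebra_simps\<close>)

lemma does_Count:
  assumes N: "N 4 = r" "N 7 = 0" "N 6 = i" and i: "i < r" and S: "\<And>j. j < r \<Longrightarrow> A tS j = score v j"
    and Q: "Q (A(tCN := (A tCN)(0 := cnt v i)))"
  shows "does X N Count A (4 * r + 3) Q"
  unfolding Count_def
proof (rule does_Seq_wr[where T = "4 * r + 2"], goal_cases)
  case 2
  let ?f = "\<lambda>j. if score v i \<le> score v j then 1 else 0 :: real"
  show ?case
  proof (rule does_For[where K = r and T = 2 and I = "\<lambda>l A'. A' = A(tCN := (A tCN)(0 := \<Sum>j<l. ?f j))"])
    fix l A1 assume l: "l < r" and A1: "A1 = A(tCN := (A tCN)(0 := \<Sum>j<l. ?f j))"
    show "does X (N(7 := l)) (Cond (RLess (rd tS (reg 7)) (rd tS (reg 6))) Skip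
      (wr tCN (NConst 0) (RAdd (rd tCN (NConst 0)) (RConst 1)))) A1 2
      (\<lambda>A'. A' = A(tCN := (A tCN)(0 := \<Sum>j<Suc l. ?f j)))"
      by (rule does_Cond[where T = 1])
        (use N i l S in \<open>auto simp: A1 not_le not_less intro!: does_Skip does_wr\<close>)
  qed (use N Q in \<open>auto simp: cnt_def\<close>)
qed auto

lemma does_Quant:
  assumes N: "N 4 = r" "N 6 = 0" "N 7 = 0" and S: "\<And>j. j < r \<Longrightarrow> A tS j = score v j"
    and Q: "\<And>A'. A' tQU 0 = quant v r \<Longrightarrow> (\<And>s. s \<notin> {tQU, tCN} \<Longrightarrow> A' s = A s) \<Longrightarrow> Q A'"
    and T: "r * (4 * r + 7) + 3 \<le> T"
  shows "does X N (Quant \<rho>) A T Q"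
  unfolding Quant_def
proof (rule does_Seq_wr[where T = "r * (4 * r + 7) + 2"], goal_cases)
  case 2
  show ?case
  proof (rule does_For[where K = r and T = "4 * r + 5" and
      I = "\<lambda>l A'. A' tQU 0 = quant v l \<and> (\<forall>s. s \<notin> {tQU, tCN} \<longrightarrow> A' s = A s)"])
    fix l A1 assume l: "l < r" and A1: "A1 tQU 0 = quant v l \<and> (\<forall>s. s \<notin> {tQU, tCN} \<longrightarrow> A1 s = A s)"
    let ?c = "Cond (Conj (Neg (RLess (rd tCN (NConst 0)) (RMul (RConst \<rho>) (ROfNat (reg 4)))))
        (RLess (rd tQU (NConst 0)) (rd tS (reg 6))))
      (wr tQU (NConst 0) (rd tS (reg 6))) Skip"
    show "does X (N(6 := l)) (Seq Count ?c) A1 (4 * r + 5)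
        (\<lambda>A'. A' tQU 0 = quant v (Suc l) \<and> (\<forall>s. s \<notin> {tQU, tCN} \<longrightarrow> A' s = A s))"
    proof (rule does_Seq[where R = "\<lambda>A'. A' = A1(tCN := (A1 tCN)(0 := cnt v l))" and ?T1.0 = "4 * r + 3" and ?T2.0 = 2])
      show "does X (N(6 := l)) Count A1 (4 * r + 3) (\<lambda>A'. A' = A1(tCN := (A1 tCN)(0 := cnt v l)))"
        by (rule does_Count[where i = l and v = v]) (use N l S A1 in auto)
      fix A2 assume A2: "A2 = A1(tCN := (A1 tCN)(0 := cnt v l))"
      show "does X (N(6 := l)) ?c A2 2 (\<lambda>A'. A' tQU 0 = quant v (Suc l) \<and> (\<forall>s. s \<notin> {tQU, tCN} \<longrightarrow> A' s = A s))"
        by (rule does_Cond[where T = 1]) (use N l S A1 in \<open>auto simp: A2 not_less intro!: does_Skip does_wr\<close>)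
    qed auto
  qed (use N Q in \<open>auto simp: algebra_simps\<close>)
qed (use T in auto)

lemma does_Filt:
  assumes N: "N 2 = h" "N 6 = 0" and S: "\<And>j. j < h \<Longrightarrow> A tS j = score v j"
    and A: "A tQU 0 = quant v r" "A tTH 0 = \<theta>"
    and Q: "\<And>A'. (\<And>i. i < h \<Longrightarrow> A' tW i = filt v (A tW) i) \<Longrightarrow> (\<And>s. s \<noteq> tW \<Longrightarrow> A' s = A s) \<Longrightarrow> Q A'"
    and T: "4 * h + 2 \<le> T"
  shows "does X N Filt A T Q"
  unfolding Filt_def
proof (rule does_For[where K = h and T = 2 and
    I = "\<lambda>l A'. (\<forall>i. A' tW i = (if i < l \<and> A tTH 0 * A tQU 0 < score v i then 0 else A tW i)) \<and>
      (\<forall>s. s \<noteq> tW \<longrightarrow> A' s = A s)"])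
  fix l A1 assume l: "l < h" and
    A1: "(\<forall>i. A1 tW i = (if i < l \<and> A tTH 0 * A tQU 0 < score v i then 0 else A tW i)) \<and>
      (\<forall>s. s \<noteq> tW \<longrightarrow> A1 s = A s)"
  show "does X (N(6 := l)) (Cond (RLess (RMul (rd tTH (NConst 0)) (rd tQU (NConst 0))) (rd tS (reg 6)))
    (wr tW (reg 6) (RConst 0)) Skip) A1 2
    (\<lambda>A'. (\<forall>i. A' tW i = (if i < Suc l \<and> A tTH 0 * A tQU 0 < score v i then 0 else A tW i)) \<and>
      (\<forall>s. s \<noteq> tW \<longrightarrow> A' s = A s))"
    by (rule does_Cond[where T = 1]) (use N l S A1 in \<open>auto simp: less_Suc_eq intro!: does_Skip does_wr\<close>)
next
  fix A' assume "(\<forall>i. A' tW i = (if i < h \<and> A tTH 0 * A tQU 0 < score v i then 0 else A tW i)) \<and>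
      (\<forall>s. s \<noteq> tW \<longrightarrow> A' s = A s)"
  then show "Q A'" by (intro Q) (simp_all add: filt_def A)
qed (use N T in \<open>auto simp: algebra_simps\<close>)

definition T_dir :: nat where
  "T_dir = (6 * n + 3) + ((n * (5 * b + 7) + 2) + (((r + h) * (3 * n + 6) + 2) + ((r * (4 * r + 7) + 3) + (4 * h + 2))))"

lemma does_DirStep:
  assumes N: "N 0 = n" "N 2 = h" "N 3 = b" "N 4 = r" "N 5 = j" "N 6 = 0" "N 7 = 0"
    and Y: "flat_mat n (A tY) = Y" and th: "A tTH 0 = \<theta>"
    and Q: "\<And>A'. (\<And>i. i < h \<Longrightarrow> A' tW i = filt (dir n b (flat_mat n (A tQ)) j) (A tW) i) \<Longrightarrow>
      (\<And>s. s \<in> {tY, tQ, tTH} \<Longrightarrow> A' s = A s) \<Longrightarrow> Q A'"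
  shows "does X N (DirStep \<rho>) A T_dir Q"
  unfolding DirStep_def T_dir_def
proof (rule does_Seq[OF _ _ order_refl,
    where R = "\<lambda>A'. A' = A(tMX := (A tMX)(0 := colmax (flat_mat n (A tQ)) j n))"], goal_cases)
  case 1
  show ?case by (rule does_ColMax[where n = n and j = j]) (use N in auto)
next
  case (2 A1)
  show ?case
  proof (rule does_Seq[OF _ _ order_refl, where R = "\<lambda>A'. (\<forall>k<n. A' tV k = dir n b (flat_mat n (A tQ)) j k) \<and> (\<forall>t. t \<in> {tY, tQ, tTH, tW} \<longrightarrow> A' t = A t)"], goal_cases)
    case 1
    show ?case
      by (rule does_Round[where n = n and j = j and b = b]) (use N 2 in auto)
  next
    case (2 A2)
    show ?case
    proof (rule does_Seq[OF _ _ order_refl, where R = "\<lambda>A'. (\<forall>i<r+h. A' tS i = score (A2 tV) i) \<and> (\<forall>t. t \<in> {tY, tQ, tTH, tW} \<longrightarrow> A' t = A t)"], goal_cases)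
      case 1
      show ?case by (rule does_Scores) (use N 2 Y in auto)
    next
      case (2 A3)
      show ?case
      proof (rule does_Seq[OF _ _ order_refl, where R = "\<lambda>A'. A' tQU 0 = quant (A2 tV) r \<and> (\<forall>i<r+h. A' tS i = score (A2 tV) i) \<and> (\<forall>t. t \<in> {tY, tQ, tTH, tW} \<longrightarrow> A' t = A t)"], goal_cases)
        case 1
        show ?case by (rule does_Quant[where v = "A2 tV"]) (use N 2 in auto)
      next
        case (2 A4)
        have f: "filt (A2 tV) w i = filt (dir n b (flat_mat n (A tQ)) j) w i" for w i
          by (rule filt_cong) (use 2 \<open>(\<forall>k<n. A2 tV k = dir n b (flat_mat n (A tQ)) j k) \<and> _\<close> in auto)
        show ?case
        proof (rule does_Filt[where v = "A2 tV"])
          fix A' assume "\<And>i. i < h \<Longrightarrow> A' tW i = filt (A2 tV) (A4 tW) i" "\<And>s. s \<noteq> tW \<Longrightarrow> A' s = A4 s"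
          then show "Q A'" using 2 by (intro Q) (auto simp: f)
        qed (use N 2 th in auto)
      qed
    qed
  qed
qed

definition T_filters :: nat where "T_filters = n * (T_dir + 2) + 2"

lemma does_Filters:
  assumes N: "N 0 = n" "N 2 = h" "N 3 = b" "N 4 = r" "N 5 = 0" "N 6 = 0" "N 7 = 0"
    and Y: "flat_mat n (A tY) = Y" and th: "A tTH 0 = \<theta>"
    and Q: "\<And>A'. (\<And>i. i < h \<Longrightarrow> A' tW i = filts (flat_mat n (A tQ)) (A tW) n i) \<Longrightarrow>
      (\<And>s. s \<in> {tY, tQ, tTH} \<Longrightarrow> A' s = A s) \<Longrightarrow> Q A'"
  shows "does X N (Filters \<rho>) A T_filters Q"
  unfolding Filters_def T_filters_def
proof (rule does_For[where K = n and T = T_dir and I = "\<lambda>j A'. (\<forall>i<h. A' tW i = filts (flat_mat n (A tQ)) (A tW) j i) \<and>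
    (\<forall>s. s \<in> {tY, tQ, tTH} \<longrightarrow> A' s = A s)"])
  fix j A1 assume A1: "(\<forall>i<h. A1 tW i = filts (flat_mat n (A tQ)) (A tW) j i) \<and> (\<forall>s. s \<in> {tY, tQ, tTH} \<longrightarrow> A1 s = A s)"
  show "does X (N(5 := j)) (DirStep \<rho>) A1 T_dir
    (\<lambda>A'. (\<forall>i<h. A' tW i = filts (flat_mat n (A tQ)) (A tW) (Suc j) i) \<and> (\<forall>s. s \<in> {tY, tQ, tTH} \<longrightarrow> A' s = A s))"
  proof (rule does_DirStep[where j = j])
    fix A' assume "\<And>i. i < h \<Longrightarrow> A' tW i = filt (dir n b (flat_mat n (A1 tQ)) j) (A1 tW) i"
      "\<And>s. s \<in> {tY, tQ, tTH} \<Longrightarrow> A' s = A1 s"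
    then show "(\<forall>i<h. A' tW i = filts (flat_mat n (A tQ)) (A tW) (Suc j) i) \<and> (\<forall>s. s \<in> {tY, tQ, tTH} \<longrightarrow> A' s = A s)"
      using A1 by (auto simp: filt_def)
  qed (use A1 N Y th in auto)
qed (use N Q in auto)

definition T_step :: nat where
  "T_step = T_filters + ((n * (n * (3 * h + 6) + 4) + 2) + ((3 * (n * n) + 2) + (b * (n * (n * (3 * n + 9) + 4) + 6) + 2)))"

lemma filts_cong:
  assumes "eqm n P P'" "w i = w' i" "J \<le> n"
  shows "filts P w J i = filts P' w' J i"
  using assms(3)
proof (induction J)
  case (Suc J)
  have "dir n b P J k = dir n b P' J k" if "k < n" for k
    using assms(1) Suc.prems that colmax_cong[of n P J P'] by (simp add: dir_def eqm_def)
  then show ?case using Suc by (simp add: filt_cong[of "dir n b P J" "dir n b P' J"])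
qed (use assms in simp)

text \<open>Before the first round no Gram matrix has been stored, hence the guard
  \<open>0 < t\<close>. The differences are fixed as a whole function, since rows from
  \<open>h\<close> on may also be read.\<close>

definition loop_inv :: "nat \<Rightarrow> (nat \<Rightarrow> nat \<Rightarrow> real) \<Rightarrow> bool" where
  "loop_inv t A \<longleftrightarrow> (\<forall>i<h. A tW i = wt t i) \<and> eqm n (flat_mat n (A tQ)) (snd (run t)) \<and>
    (0 < t \<longrightarrow> eqm n (flat_mat n (A tM)) (gram (wt t))) \<and> flat_mat n (A tY) = Y \<and> A tTH 0 = \<theta>"

lemma does_Step:
  assumes N: "N 0 = n" "N 2 = h" "N 3 = b" "N 4 = r" "N 5 = 0" "N 6 = 0" "N 7 = 0" "N 8 = 0"
    and A: "loop_inv t A"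
  shows "does X N (Step \<rho>) A T_step (loop_inv (Suc t))"
  unfolding Step_def T_step_def
proof (rule does_Seq[OF _ _ order_refl, where R = "\<lambda>A'. (\<forall>i<h. A' tW i = wt (Suc t) i) \<and> flat_mat n (A' tY) = Y \<and> A' tTH 0 = \<theta>"], goal_cases)
  case 1
  show ?case
  proof (rule does_Filters)
    fix A' assume "\<And>i. i < h \<Longrightarrow> A' tW i = filts (flat_mat n (A tQ)) (A tW) n i" "\<And>s. s \<in> {tY, tQ, tTH} \<Longrightarrow> A' s = A s"
    then show "(\<forall>i<h. A' tW i = wt (Suc t) i) \<and> flat_mat n (A' tY) = Y \<and> A' tTH 0 = \<theta>"
      using A filts_cong[of "flat_mat n (A tQ)" "snd (run t)" "A tW" _ "wt t" n] by (auto simp: loop_inv_def run_Suc)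
  qed (use N A in \<open>auto simp: loop_inv_def\<close>)
next
  case (2 A1)
  let ?R = "\<lambda>A'. (\<forall>i<h. A' tW i = wt (Suc t) i) \<and> flat_mat n (A' tY) = Y \<and> A' tTH 0 = \<theta> \<and> eqm n (flat_mat n (A' tM)) (gram (wt (Suc t)))"
  show ?case
  proof (rule does_Seq[OF _ _ order_refl, where R = ?R], goal_cases)
    case 1
    show ?case unfolding Gram_def
    proof (rule does_MatP[where n = n and K = h and f = "\<lambda>a c i. wt (Suc t) i * Y i a * Y i c"])
      fix A' assume "\<And>a c. a < n \<Longrightarrow> c < n \<Longrightarrow> flat_mat n (A' tM) a c = (\<Sum>i<h. wt (Suc t) i * Y i a * Y i c)"
        "\<And>s. s \<notin> {tM, tAC} \<Longrightarrow> A' s = A1 s"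
      then show "?R A'" using 2 by (auto simp: eqm_def gram_def)
    qed (use N 2 in \<open>auto simp: flat_mat_def\<close>)
  next
    case (2 A2)
    show ?case
    proof (rule does_Seq[OF _ _ order_refl, where R = "\<lambda>A'. ?R A' \<and> eqm n (flat_mat n (A' tQ)) (gram (wt (Suc t)))"], goal_cases)
      case 1
      show ?case by (rule does_Copy[where n = n]) (use N 2 index_less in \<open>auto simp: eqm_def flat_mat_def\<close>)
    next
      case (2 A3)
      show ?case
        by (rule does_Power[where n = n and b = b and P = "gram (wt (Suc t))"])
          (use N 2 in \<open>auto simp: loop_inv_def run_Suc\<close>)
    qed
  qed
qed

definition T_main :: nat where "T_main = (n + 1) * (T_step + 2) + 2"

lemma does_Main:
  assumes N: "N 0 = n" "N 2 = h" "N 3 = b" "N 4 = r" "N 5 = 0" "N 6 = 0" "N 7 = 0" "N 8 = 0" "N 9 = 0"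
    and A: "loop_inv 0 A"
  shows "does X N (Main \<rho>) A T_main (loop_inv (Suc n))"
  unfolding Main_def T_main_def
proof (rule does_For[where K = "n + 1" and T = T_step and I = loop_inv])
  show "does X (N(9 := t)) (Step \<rho>) A1 T_step (loop_inv (Suc t))" if "loop_inv t A1" for t A1
    by (rule does_Step) (use N that in auto)
qed (use N A in auto)

definition T_ratio :: nat where
  "T_ratio = (n * (n * (3 * n + 6) + 4) + 2) + ((3 * (n * n) + 3) + (3 * (n * n) + 3))"

lemma does_Ratio:
  assumes N: "N 0 = n" "N 5 = 0" "N 6 = 0" "N 7 = 0"
    and A: "loop_inv (Suc n) A"
  shows "does X N Ratio A T_ratio (\<lambda>A'. A' tHH 0 / A' tCN 0 / (2 * (real h - real r)) = out)"
  unfolding Ratio_def T_ratio_def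
proof -
  define P where "P = snd (run (Suc n))"
  define G where "G = gram (wt (Suc n))"
  have PG: "eqm n (flat_mat n (A tQ)) P" "eqm n (flat_mat n (A tM)) G" using A by (auto simp: loop_inv_def P_def G_def)
  let ?p1 = "MatP tR (reg 0) (RMul (rd tM (idx 5 7)) (rd tQ (idx 7 6)))"
  let ?p2 = "SumTo tHH 5 (NMul (reg 0) (reg 0)) (RMul (rd tQ (reg 5)) (rd tR (reg 5)))"
  let ?p3 = "SumTo tCN 5 (NMul (reg 0) (reg 0)) (RMul (rd tQ (reg 5)) (rd tQ (reg 5)))"
  \<comment> \<open>Numerator and denominator are computed as entrywise inner products of flattened
    matrices; exchanging the two sums turns them into the sums over columns in
    \<open>out\<close>.\<close>
  let ?num = "\<Sum>a<n. \<Sum>c<n. P a c * mm n G P a c"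
  let ?den = "\<Sum>a<n. \<Sum>c<n. P a c * P a c"
  have num: "?num = (\<Sum>j<n. qf n G (\<lambda>k. P k j))"
    unfolding qf_def dot_def mv_def mm_def by (rule sum.swap)
  have den: "?den = (\<Sum>j<n. dot n (\<lambda>k. P k j) (\<lambda>k. P k j))"
    unfolding dot_def by (rule sum.swap)
  have out: "out = ?num / ?den / (2 * (real h - real r))"
    unfolding num den by (simp only: out_def P_def G_def case_prod_beta Let_def)
  let ?R1 = "\<lambda>A'. eqm n (flat_mat n (A' tQ)) P \<and> eqm n (flat_mat n (A' tR)) (mm n G P)"
  show "does X N (Seq ?p1 (Seq ?p2 ?p3)) A
      ((n * (n * (3 * n + 6) + 4) + 2) + ((3 * (n * n) + 3) + (3 * (n * n) + 3)))
      (\<lambda>A'. A' tHH 0 / A' tCN 0 / (2 * (real h - real r)) = out)"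
  proof (rule does_Seq[OF _ _ order_refl, where R = ?R1], goal_cases)
    case 1
    show ?case
      by (rule does_MatP[where n = n and K = n and f = "\<lambda>a c k. G a k * P k c"])
        (use N PG in \<open>auto simp: eqm_def mm_def flat_mat_def\<close>)
  next
    case (2 A1)
    show ?case
    proof (rule does_Seq[OF _ _ order_refl, where R = "\<lambda>A'. ?R1 A' \<and> A' tHH 0 = ?num"], goal_cases)
      case 1
      show ?case
      proof (rule does_SumTo[where K = "n * n" and f = "\<lambda>i. A1 tQ i * A1 tR i"])
        have "(\<Sum>i<n * n. A1 tQ i * A1 tR i) = ?num"
          unfolding sum_square_index using 2 by (intro sum.cong refl) (auto simp: eqm_def flat_mat_def)
        then show "?R1 (A1(tHH := (A1 tHH)(0 := \<Sum>i<n * n. A1 tQ i * A1 tR i))) \<and>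
            (A1(tHH := (A1 tHH)(0 := \<Sum>i<n * n. A1 tQ i * A1 tR i))) tHH 0 = ?num"
          using 2 by simp
      qed (use N in auto)
    next
      case (2 A2)
      show ?case
      proof (rule does_SumTo[where K = "n * n" and f = "\<lambda>i. A2 tQ i * A2 tQ i"])
        have "(\<Sum>i<n * n. A2 tQ i * A2 tQ i) = ?den"
          unfolding sum_square_index using 2 by (intro sum.cong refl) (auto simp: eqm_def flat_mat_def)
        then show "(A2(tCN := (A2 tCN)(0 := \<Sum>i<n * n. A2 tQ i * A2 tQ i))) tHH 0 /
            (A2(tCN := (A2 tCN)(0 := \<Sum>i<n * n. A2 tQ i * A2 tQ i))) tCN 0 / (2 * (real h - real r)) = out"
          using 2 out by simp
      qed (use N in auto)
    qed
  qed
qed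

end


section \<open>Initialisation and running time\<close>


lemma snd_mk_0: "snd (mk X N A) 0 = X 0"
  by (simp add: mk_def)

text \<open>For the initial loops, which stop on a data-dependent test and partly change number
  cells that \<open>does\<close> keeps fixed. The states along the loop are given
  explicitly.\<close>

lemma exec_Loop_iterate:
  assumes "\<And>i. i < K \<Longrightarrow> tval c (s i) \<and> exec p (s i) t (s (Suc i))" "\<not> tval c (s K)"
  shows "exec (Loop c p) (s 0) (K * Suc t + 1) (s K)"
  using assms
proof (induction K arbitrary: s)
  case 0
  then show ?case using exec.LoopFalse by simp
next
  case (Suc K)
  have "exec (Loop c p) (s (Suc 0)) (K * Suc t + 1) (s (Suc K))"
    using Suc.IH[of "\<lambda>i. s (Suc i)"] Suc.prems by simp
  then have "exec (Loop c p) (s 0) (Suc (t + (K * Suc t + 1))) (s (Suc K))"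
    using exec.LoopTrue[of c "s 0" p t "s (Suc 0)"] Suc.prems(1)[of 0] by blast
  moreover have "Suc (t + (K * Suc t + 1)) = Suc K * Suc t + 1" by simp
  ultimately show ?case by metis
qed

text \<open>There is no division of naturals, so the number of pairs is found by counting
  up.\<close>

definition Half :: prog where
  "Half = Loop (NLess (NMul (NConst 2) (reg 2)) (reg 1)) (NStore (NConst 2) (NAdd (reg 2) (NConst 1)))"

definition Bits :: prog where
  "Bits = Seq (wr tHH (NConst 0) (RConst 1))
    (Loop (RLess (RMul (rd tHH (NConst 0)) (RCell (NConst 0))) (ROfNat (reg 0)))
      (Seq (wr tHH (NConst 0) (RAdd (rd tHH (NConst 0)) (rd tHH (NConst 0))))
        (NStore (NConst 3) (NAdd (reg 3) (NConst 1)))))"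

text \<open>In the absence of powers with real exponents, \<open>b powr (2 / \<gamma>)\<close> is replaced by
  \<open>(2 ^ j) powr (2 / \<gamma>) = (2 powr (2 / \<gamma>)) ^ j\<close> for the least \<open>j\<close> with \<open>b \<le> 2 ^ j\<close>; the factor
  \<open>\<kappa> = 2 powr (2 / \<gamma>)\<close> is a constant of the program.\<close>

definition Thresh :: "real \<Rightarrow> real \<Rightarrow> prog" where
  "Thresh \<theta>0 \<kappa> = Seq (wr tTH (NConst 0) (RConst \<theta>0)) (Seq (wr tHH (NConst 0) (RConst 1))
    (Loop (RLess (rd tHH (NConst 0)) (ROfNat (reg 3)))
      (Seq (wr tTH (NConst 0) (RMul (rd tTH (NConst 0)) (RConst \<kappa>)))
        (wr tHH (NConst 0) (RAdd (rd tHH (NConst 0)) (rd tHH (NConst 0)))))))"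

definition Pairs :: prog where
  "Pairs = For 5 (reg 2) (For 6 (reg 0) (wr tY (idx 5 6) (RSub
      (inp (NAdd (NMul (NMul (NConst 2) (reg 5)) (reg 0)) (reg 6)))
      (inp (NAdd (NMul (NAdd (NMul (NConst 2) (reg 5)) (NConst 1)) (reg 0)) (reg 6))))))"

definition Weights :: prog where
  "Weights = For 5 (reg 2) (Cond (NLess (reg 5) (reg 4)) Skip (wr tW (reg 5) (RConst 1)))"

definition Ident :: prog where
  "Ident = For 5 (reg 0) (wr tQ (idx 5 5) (RConst 1))"

definition Estimator :: "real \<Rightarrow> real \<Rightarrow> real \<Rightarrow> nat \<Rightarrow> prog" where
  "Estimator \<rho> \<theta>0 \<kappa> c = Seq Half (Seq Bits (Seq (NStore (NConst 4) (NMul (NConst c) (NMul (reg 0) (reg 3))))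
    (Seq (Thresh \<theta>0 \<kappa>) (Seq (Seq Pairs (Seq Weights (Seq Ident (Seq (Main \<rho>) Ratio))))
      (RStore (NConst 0) (RDiv (RDiv (rd tHH (NConst 0)) (rd tCN (NConst 0)))
        (RMul (RConst 2) (RSub (ROfNat (reg 2)) (ROfNat (reg 4))))))))))"

text \<open>The base-2 logarithm of \<open>n / \<eta>\<close>, rounded up, and 0 if negative.
  \<open>Bits\<close> finds it by doubling, as the machine has no logarithm; multiplying by
  \<open>\<eta>\<close> avoids a division in the test.\<close>

definition bits :: "nat \<Rightarrow> real \<Rightarrow> nat" where
  "bits n \<eta> = (LEAST b. real n \<le> 2 ^ b * \<eta>)"

definition level :: "nat \<Rightarrow> nat" where
  "level b = (LEAST j. b \<le> 2 ^ j)"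

lemma bits_props:
  assumes "0 < \<eta>"
  shows "real n \<le> 2 ^ bits n \<eta> * \<eta>" "i < bits n \<eta> \<Longrightarrow> 2 ^ i * \<eta> < real n"
proof -
  obtain b where "real n / \<eta> < 2 ^ b" using real_arch_pow[of 2 "real n / \<eta>"] by auto
  then have "real n \<le> 2 ^ b * \<eta>" using assms by (simp add: divide_less_eq)
  then show "real n \<le> 2 ^ bits n \<eta> * \<eta>" unfolding bits_def by (rule LeastI)
  show "2 ^ i * \<eta> < real n" if "i < bits n \<eta>"
    using not_less_Least[OF that[unfolded bits_def]] by simp
qed

lemma level_props:
  shows "b \<le> 2 ^ level b" "j < level b \<Longrightarrow> 2 ^ j < b" "level b \<le> b"
proof -
  have b: "b \<le> 2 ^ b" by (simp add: less_imp_le)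
  then show "b \<le> 2 ^ level b" unfolding level_def by (rule LeastI)
  show "2 ^ j < b" if "j < level b"
    using not_less_Least[OF that[unfolded level_def]] by simp
  show "level b \<le> b" unfolding level_def using b by (rule Least_le)
qed

lemma exec_Half:
  assumes "N 1 = 2 * h" "N 2 = 0"
  shows "exec Half (mk X N A) (2 * h + 1) (mk X (N(2 := h)) A)"
proof -
  have "exec Half (mk X (N(2 := 0)) A) (h * Suc 1 + 1) (mk X (N(2 := h)) A)"
    unfolding Half_def
  proof (rule exec_Loop_iterate)
    show "tval (NLess (NMul (NConst 2) (reg 2)) (reg 1)) (mk X (N(2 := i)) A) \<and>
        exec (NStore (NConst 2) (NAdd (reg 2) (NConst 1))) (mk X (N(2 := i)) A) 1 (mk X (N(2 := Suc i)) A)"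
      if "i < h" for i
      using exec_NStore_mk[of 2 "NAdd (reg 2) (NConst 1)" X "N(2 := i)" A] that assms by simp
  qed (use assms in simp)
  moreover have "N(2 := 0) = N" using assms by auto
  moreover have "h * Suc 1 + 1 = 2 * h + 1" by simp
  ultimately show ?thesis by metis
qed

lemma exec_Bits:
  assumes "X 0 = \<eta>" "0 < \<eta>" "N 0 = n" "N 3 = 0"
  defines "b \<equiv> bits n \<eta>"
  shows "\<exists>a. exec Bits (mk X N A) (3 * b + 2) (mk X (N(3 := b)) (A(tHH := a)))"
proof -
  let ?s = "\<lambda>i. mk X (N(3 := i)) (A(tHH := (A tHH)(0 := 2 ^ i)))"
  let ?c = "RLess (RMul (rd tHH (NConst 0)) (RCell (NConst 0))) (ROfNat (reg 0))"
  let ?w = "wr tHH (NConst 0) (RAdd (rd tHH (NConst 0)) (rd tHH (NConst 0)))"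
  let ?n = "NStore (NConst 3) (NAdd (reg 3) (NConst 1))"
  have "exec (Loop ?c (Seq ?w ?n)) (?s 0) (b * Suc 2 + 1) (?s b)"
  proof (rule exec_Loop_iterate)
    fix i assume i: "i < b"
    have "exec ?w (?s i) 1 (mk X (N(3 := i)) (A(tHH := (A tHH)(0 := 2 ^ Suc i))))"
      using exec_wr[of tHH "NConst 0" "RAdd (rd tHH (NConst 0)) (rd tHH (NConst 0))" X "N(3 := i)" "A(tHH := (A tHH)(0 := 2 ^ i))"]
      by simp
    moreover have "exec ?n (mk X (N(3 := i)) (A(tHH := (A tHH)(0 := 2 ^ Suc i)))) 1 (?s (Suc i))"
      using exec_NStore_mk[of 3 "NAdd (reg 3) (NConst 1)" X "N(3 := i)" "A(tHH := (A tHH)(0 := 2 ^ Suc i))"] by simp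
    ultimately have "exec (Seq ?w ?n) (?s i) 2 (?s (Suc i))"
      unfolding one_add_one[symmetric] by (rule exec.Seq)
    moreover have "tval ?c (?s i)" using bits_props(2)[of \<eta> i n] i assms by (simp add: snd_mk_0)
    ultimately show "tval ?c (?s i) \<and> exec (Seq ?w ?n) (?s i) 2 (?s (Suc i))" by (rule conjI[rotated])
  next
    show "\<not> tval ?c (?s b)" using bits_props(1)[of \<eta> n] assms by (simp add: not_less snd_mk_0)
  qed
  moreover have "exec (wr tHH (NConst 0) (RConst 1)) (mk X N A) 1 (?s 0)"
  proof -
    have "N(3 := 0) = N" using assms by auto
    then show ?thesis using exec_wr[of tHH "NConst 0" "RConst 1" X N A] by simp
  qed
  ultimately have "exec Bits (mk X N A) (1 + (b * Suc 2 + 1)) (?s b)"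
    unfolding Bits_def by (intro exec.Seq)
  moreover have "1 + (b * Suc 2 + 1) = 3 * b + 2" by simp
  ultimately show ?thesis by metis
qed

lemma exec_Thresh:
  assumes "N 3 = b"
  defines "J \<equiv> level b"
  shows "\<exists>a. exec (Thresh \<theta>0 \<kappa>) (mk X N A) (3 * J + 3) (mk X N (A(tTH := (A tTH)(0 := \<theta>0 * \<kappa> ^ J), tHH := a)))"
proof -
  let ?A = "\<lambda>i. A(tTH := (A tTH)(0 := \<theta>0 * \<kappa> ^ i), tHH := (A tHH)(0 := 2 ^ i))"
  let ?s = "\<lambda>i. mk X N (?A i)"
  let ?c = "RLess (rd tHH (NConst 0)) (ROfNat (reg 3))"
  let ?t = "wr tTH (NConst 0) (RMul (rd tTH (NConst 0)) (RConst \<kappa>))"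
  let ?w = "wr tHH (NConst 0) (RAdd (rd tHH (NConst 0)) (rd tHH (NConst 0)))"
  have "exec (Loop ?c (Seq ?t ?w)) (?s 0) (J * Suc 2 + 1) (?s J)"
  proof (rule exec_Loop_iterate)
    fix i assume i: "i < J"
    let ?B = "(?A i)(tTH := (?A i tTH)(0 := \<theta>0 * \<kappa> ^ Suc i))"
    have "exec ?t (?s i) 1 (mk X N ?B)"
      using exec_wr[of tTH "NConst 0" "RMul (rd tTH (NConst 0)) (RConst \<kappa>)" X N "?A i"]
      by (simp add: mult_ac)
    moreover have "exec ?w (mk X N ?B) 1 (?s (Suc i))"
    proof -
      have "?B(tHH := (?B tHH)(0 := 2 * 2 ^ i)) = ?A (Suc i)" by (auto simp: fun_eq_iff)
      then show ?thesis
        using exec_wr[of tHH "NConst 0" "RAdd (rd tHH (NConst 0)) (rd tHH (NConst 0))" X N ?B]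
        by (simp only: rval.simps rval_rd nval.simps) simp
    qed
    ultimately have "exec (Seq ?t ?w) (?s i) 2 (?s (Suc i))"
      unfolding one_add_one[symmetric] by (rule exec.Seq)
    moreover have "(2::real) ^ i < real b"
      using level_props(2)[of i b] i unfolding J_def by (metis of_nat_less_iff of_nat_numeral of_nat_power)
    then have "tval ?c (?s i)" using assms(1) by simp
    ultimately show "tval ?c (?s i) \<and> exec (Seq ?t ?w) (?s i) 2 (?s (Suc i))" by (rule conjI[rotated])
  next
    have "real b \<le> 2 ^ J"
      using level_props(1)[of b] unfolding J_def by (metis of_nat_le_iff of_nat_numeral of_nat_power)
    then show "\<not> tval ?c (?s J)" using assms(1) by (simp add: not_less)
  qed
  moreover have "exec (wr tHH (NConst 0) (RConst 1)) (mk X N (A(tTH := (A tTH)(0 := \<theta>0)))) 1 (?s 0)"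
    using exec_wr[of tHH "NConst 0" "RConst 1" X N "A(tTH := (A tTH)(0 := \<theta>0))"] by simp
  moreover have "exec (wr tTH (NConst 0) (RConst \<theta>0)) (mk X N A) 1 (mk X N (A(tTH := (A tTH)(0 := \<theta>0))))"
    using exec_wr[of tTH "NConst 0" "RConst \<theta>0" X N A] by simp
  ultimately have "exec (Thresh \<theta>0 \<kappa>) (mk X N A) (1 + (1 + (J * Suc 2 + 1))) (?s J)"
    unfolding Thresh_def by (intro exec.Seq)
  moreover have "1 + (1 + (J * Suc 2 + 1)) = 3 * J + 3" by simp
  ultimately show ?thesis by metis
qed

section \<open>Loading the differences and the initial arrays\<close>

lemma does_Pairs:
  assumes N: "N 0 = n" "N 1 = 2 * h" "N 2 = h" "N 5 = 0" "N 6 = 0"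
    and X: "\<And>i k. i < 2 * h \<Longrightarrow> k < n \<Longrightarrow> X (Suc (i * n + k)) = x i k"
    and Q: "\<And>A'. (\<And>i k. i < h \<Longrightarrow> k < n \<Longrightarrow> flat_mat n (A' tY) i k = x (2 * i) k - x (2 * i + 1) k) \<Longrightarrow>
      (\<And>s. s \<noteq> tY \<Longrightarrow> A' s = A s) \<Longrightarrow> Q A'"
    and T: "h * (3 * n + 4) + 2 \<le> T"
  shows "does X N Pairs A T Q"
proof -
  define J where "J = (\<lambda>a c A'. (\<forall>i<h. \<forall>k<n. (i < a \<or> i = a \<and> k < c) \<longrightarrow> flat_mat n (A' tY) i k = x (2 * i) k - x (2 * i + 1) k) \<and>
      (\<forall>s. s \<noteq> tY \<longrightarrow> A' s = A s))"
  let ?w = "wr tY (idx 5 6) (RSub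
      (inp (NAdd (NMul (NMul (NConst 2) (reg 5)) (reg 0)) (reg 6)))
      (inp (NAdd (NMul (NAdd (NMul (NConst 2) (reg 5)) (NConst 1)) (reg 0)) (reg 6))))"
  have one: "does X (N(5 := i, 6 := k)) ?w A1 1 (J i (Suc k))"
    if i: "i < h" and k: "k < n" and A1: "J i k A1" for i k A1
  proof (rule does_wr)
    have less: "(2 * i) * n + k < n * (2 * h)" "Suc (2 * i) * n + k < n * (2 * h)"
    proof -
      have "Suc (2 * i) * n + k < Suc (Suc (2 * i)) * n" using k by simp
      also have "\<dots> \<le> (2 * h) * n" using i by (intro mult_right_mono) auto
      finally show "Suc (2 * i) * n + k < n * (2 * h)" by (simp add: mult.commute)
      then show "(2 * i) * n + k < n * (2 * h)" by simp
    qed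
    have v: "rval (RSub
      (inp (NAdd (NMul (NMul (NConst 2) (reg 5)) (reg 0)) (reg 6)))
      (inp (NAdd (NMul (NAdd (NMul (NConst 2) (reg 5)) (NConst 1)) (reg 0)) (reg 6)))) (mk X (N(5 := i, 6 := k)) A1) =
      x (2 * i) k - x (2 * i + 1) k"
      using less N X[of "2 * i" k] X[of "Suc (2 * i)" k] i k by (simp add: rval_inp)
    show "J i (Suc k) (A1(tY := (A1 tY)(nval (idx 5 6) (mk X (N(5 := i, 6 := k)) A1) := rval (RSub
      (inp (NAdd (NMul (NMul (NConst 2) (reg 5)) (reg 0)) (reg 6)))
      (inp (NAdd (NMul (NAdd (NMul (NConst 2) (reg 5)) (NConst 1)) (reg 0)) (reg 6)))) (mk X (N(5 := i, 6 := k)) A1))))"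
      unfolding v using A1 i k N index_inj[of _ n k _ i] unfolding J_def flat_mat_def by (auto simp: less_Suc_eq)
  qed auto
  have row: "does X (N(5 := i)) (For 6 (reg 0) ?w) A1 (3 * n + 2) (J (Suc i) 0)" if "i < h" "J i 0 A1" for i A1
  proof (rule does_For[where I = "J i" and T = 1 and K = n])
    show "J (Suc i) 0 A'" if "J i n A'" for A'
      using that unfolding J_def by (auto simp: less_Suc_eq)
  qed (use one that N in auto)
  show ?thesis
    unfolding Pairs_def
  proof (rule does_For[where I = "\<lambda>i. J i 0" and T = "3 * n + 2" and K = h])
    show "J 0 0 A" by (simp add: J_def)
    show "Q A'" if "J h 0 A'" for A'
      using that by (intro Q) (auto simp: J_def)
  qed (use row N T in \<open>auto simp: algebra_simps\<close>)
qed

lemma does_Weights: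
  assumes N: "N 2 = h" "N 4 = r" "N 5 = 0" and A: "A tW = (\<lambda>_. 0)"
    and Q: "\<And>A'. (\<And>i. i < h \<Longrightarrow> A' tW i = (if r \<le> i then 1 else 0)) \<Longrightarrow> (\<And>s. s \<noteq> tW \<Longrightarrow> A' s = A s) \<Longrightarrow> Q A'"
    and T: "4 * h + 2 \<le> T"
  shows "does X N Weights A T Q"
  unfolding Weights_def
proof (rule does_For[where K = h and T = 2 and
    I = "\<lambda>l A'. (\<forall>i. A' tW i = (if i < l \<and> r \<le> i then 1 else 0)) \<and> (\<forall>s. s \<noteq> tW \<longrightarrow> A' s = A s)"])
  show "does X (N(5 := l)) (Cond (NLess (reg 5) (reg 4)) Skip (wr tW (reg 5) (RConst 1))) A1 2
    (\<lambda>A'. (\<forall>i. A' tW i = (if i < Suc l \<and> r \<le> i then 1 else 0)) \<and> (\<forall>s. s \<noteq> tW \<longrightarrow> A' s = A s))"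
    if A1: "(\<forall>i. A1 tW i = (if i < l \<and> r \<le> i then 1 else 0)) \<and> (\<forall>s. s \<noteq> tW \<longrightarrow> A1 s = A s)" for l A1
    by (rule does_Cond[where T = 1]) (use N A1 in \<open>auto simp: less_Suc_eq intro!: does_Skip does_wr\<close>)
qed (use N Q T A in \<open>auto simp: algebra_simps\<close>)

lemma does_Ident:
  assumes N: "N 0 = n" "N 5 = 0" and A: "A tQ = (\<lambda>_. 0)"
    and Q: "\<And>A'. eqm n (flat_mat n (A' tQ)) (\<lambda>a c. if a = c then 1 else 0) \<Longrightarrow> (\<And>s. s \<noteq> tQ \<Longrightarrow> A' s = A s) \<Longrightarrow> Q A'"
    and T: "3 * n + 2 \<le> T"
  shows "does X N Ident A T Q"
  unfolding Ident_def
proof (rule does_For[where K = n and T = 1 and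
    I = "\<lambda>l A'. (\<forall>a<n. \<forall>c<n. flat_mat n (A' tQ) a c = (if a = c \<and> a < l then 1 else 0)) \<and> (\<forall>s. s \<noteq> tQ \<longrightarrow> A' s = A s)"])
  show "does X (N(5 := l)) (wr tQ (idx 5 5) (RConst 1)) A1 1
    (\<lambda>A'. (\<forall>a<n. \<forall>c<n. flat_mat n (A' tQ) a c = (if a = c \<and> a < Suc l then 1 else 0)) \<and> (\<forall>s. s \<noteq> tQ \<longrightarrow> A' s = A s))"
    if l: "l < n" and A1: "(\<forall>a<n. \<forall>c<n. flat_mat n (A1 tQ) a c = (if a = c \<and> a < l then 1 else 0)) \<and> (\<forall>s. s \<noteq> tQ \<longrightarrow> A1 s = A s)" for l A1
    using A1 l N index_inj[of _ n l _ l] by (intro does_wr) (auto simp: flat_mat_def less_Suc_eq)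
next
  fix A' assume "(\<forall>a<n. \<forall>c<n. flat_mat n (A' tQ) a c = (if a = c \<and> a < n then 1 else 0)) \<and> (\<forall>s. s \<noteq> tQ \<longrightarrow> A' s = A s)"
  then show "Q A'" by (intro Q) (auto simp: eqm_def)
qed (use N T A in \<open>auto simp: flat_mat_def algebra_simps\<close>)

definition T_core :: "nat \<Rightarrow> nat \<Rightarrow> nat \<Rightarrow> nat \<Rightarrow> nat" where
  "T_core n h b r = (h * (3 * n + 4) + 2) + ((4 * h + 2) + ((3 * n + 2) +
    (filtering.T_main n h r b + filtering.T_ratio n)))"

lemma does_core:
  assumes N: "N 0 = n" "N 1 = 2 * h" "N 2 = h" "N 3 = b" "N 4 = r" "\<And>c. 5 \<le> c \<Longrightarrow> N c = 0"
    and X: "\<And>i k. i < 2 * h \<Longrightarrow> k < n \<Longrightarrow> X (Suc (i * n + k)) = x i k"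
    and A: "A tTH 0 = \<theta>" "A tW = (\<lambda>_. 0)" "A tQ = (\<lambda>_. 0)"
  shows "\<exists>Y. (\<forall>i<h. \<forall>k<n. Y i k = x (2 * i) k - x (2 * i + 1) k) \<and>
    does X N (Seq Pairs (Seq Weights (Seq Ident (Seq (Main \<rho>) Ratio)))) A (T_core n h b r)
      (\<lambda>A'. A' tHH 0 / A' tCN 0 / (2 * (real h - real r)) = filtering.out n h r b \<rho> \<theta> Y)"
proof -
  let ?P = "\<lambda>A'. (\<forall>i<h. \<forall>k<n. flat_mat n (A' tY) i k = x (2 * i) k - x (2 * i + 1) k) \<and>
    A' tTH 0 = \<theta> \<and> A' tW = (\<lambda>_. 0) \<and> A' tQ = (\<lambda>_. 0)"
  have "does X N Pairs A (h * (3 * n + 4) + 2) ?P"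
    by (rule does_Pairs[where x = x and n = n and h = h]) (use N X A in auto)
  then obtain t A1 where t: "exec Pairs (mk X N A) t (mk X N A1)" "t \<le> h * (3 * n + 4) + 2" and A1: "?P A1"
    unfolding does_def by blast
  define Y where "Y = flat_mat n (A1 tY)"
  interpret filtering n h r b \<rho> \<theta> Y .
  have "does X N (Seq Weights (Seq Ident (Seq (Main \<rho>) Ratio))) A1
      ((4 * h + 2) + ((3 * n + 2) + (T_main + T_ratio)))
      (\<lambda>A'. A' tHH 0 / A' tCN 0 / (2 * (real h - real r)) = out)"
  proof (rule does_Seq[OF _ _ order_refl, where R = "\<lambda>A'. (\<forall>i<h. A' tW i = wt 0 i) \<and> (\<forall>s. s \<noteq> tW \<longrightarrow> A' s = A1 s)"], goal_cases)
    case 1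
    show ?case by (rule does_Weights[where r = r]) (use N A1 in auto)
  next
    case (2 A2)
    show ?case
    proof (rule does_Seq[OF _ _ order_refl, where R = "loop_inv 0"], goal_cases)
      case 1
      show ?case
      proof (rule does_Ident[where n = n])
        fix A' assume "eqm n (flat_mat n (A' tQ)) (\<lambda>a c. if a = c then 1 else 0)" "\<And>s. s \<noteq> tQ \<Longrightarrow> A' s = A2 s"
        then show "loop_inv 0 A'" using 2 A1 by (simp add: loop_inv_def Y_def[symmetric])
      qed (use N A1 2 in auto)
    next
      case (2 A3)
      show ?case
      proof (rule does_Seq[OF _ _ order_refl, where R = "loop_inv (Suc n)"], goal_cases)
        case 1
        show ?case by (rule does_Main) (use N 2 in auto)
      next
        case (2 A4)
        show ?case by (rule does_Ratio) (use N 2 in auto)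
      qed
    qed
  qed
  then have "does X N (Seq Pairs (Seq Weights (Seq Ident (Seq (Main \<rho>) Ratio)))) A (T_core n h b r)
      (\<lambda>A'. A' tHH 0 / A' tCN 0 / (2 * (real h - real r)) = out)"
    using t unfolding does_def T_core_def by (meson add_mono exec.Seq)
  then show ?thesis using A1 unfolding Y_def by blast
qed

text \<open>Only the rows of \<open>Y\<close> below \<open>h\<close> are prescribed. The others are
  what the memory happens to hold, which is why \<open>Y\<close> is existentially quantified; they
  are read if \<open>h < r\<close>.\<close>

theorem computes_Estimator:
  fixes n h c :: nat and \<eta> \<rho> \<theta>0 \<kappa> :: real and x :: "nat \<Rightarrow> nat \<Rightarrow> real"
  assumes \<eta>: "0 < \<eta>"
  defines "b \<equiv> bits n \<eta>"
  defines "r \<equiv> c * (n * b)" and "\<theta> \<equiv> \<theta>0 * \<kappa> ^ level b"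
  shows "\<exists>Y t. (\<forall>i<h. \<forall>k<n. Y i k = x (2 * i) k - x (2 * i + 1) k) \<and>
    t \<le> 2 * h + 6 * b + 8 + T_core n h b r \<and>
    computes (Estimator \<rho> \<theta>0 \<kappa> c) n (2 * h) \<eta> x t (filtering.out n h r b \<rho> \<theta> Y)"
proof -
  \<comment> \<open>No cut-off at the end of the input is needed here, because \<open>mk\<close>
    consults \<open>X\<close> only up to cell \<open>n * (2 * h)\<close>.\<close>
  define X where "X = (\<lambda>k :: nat. if k = 0 then \<eta> else x ((k - 1) div n) ((k - 1) mod n))"
  define N0 where "N0 = (\<lambda>k :: nat. if k = 0 then n else if k = 1 then 2 * h else 0 :: nat)"
  have init: "input_state n (2 * h) \<eta> x = mk X N0 (\<lambda>_ _. 0)"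
    by (auto simp: input_state_def mk_def X_def N0_def fun_eq_iff mult.commute)
  define N1 where "N1 = N0(2 := h)"
  define N2 where "N2 = N1(3 := b)"
  define N3 where "N3 = N2(4 := r)"
  note Nd = N0_def N1_def N2_def N3_def
  have e1: "exec Half (mk X N0 (\<lambda>_ _. 0)) (2 * h + 1) (mk X N1 (\<lambda>_ _. 0))"
    unfolding N1_def by (rule exec_Half) (auto simp: N0_def)
  obtain a where e2: "exec Bits (mk X N1 (\<lambda>_ _. 0)) (3 * b + 2) (mk X N2 ((\<lambda>_ _. 0)(tHH := a)))"
    using exec_Bits[of X \<eta> N1 n "\<lambda>_ _. 0"] \<eta> unfolding N2_def b_def by (auto simp: X_def Nd)
  define A2 where "A2 = ((\<lambda>_ _. 0)(tHH := a) :: nat \<Rightarrow> nat \<Rightarrow> real)"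
  have e3: "exec (NStore (NConst 4) (NMul (NConst c) (NMul (reg 0) (reg 3)))) (mk X N2 A2) 1 (mk X N3 A2)"
    using exec_NStore_mk[of 4 "NMul (NConst c) (NMul (reg 0) (reg 3))" X N2 A2]
    by (simp add: N3_def r_def) (simp add: Nd)
  obtain a' where e4: "exec (Thresh \<theta>0 \<kappa>) (mk X N3 A2) (3 * level b + 3)
      (mk X N3 (A2(tTH := (A2 tTH)(0 := \<theta>), tHH := a')))"
    using exec_Thresh[of N3 b \<theta>0 \<kappa> X A2] unfolding \<theta>_def by (auto simp: Nd)
  define A4 where "A4 = A2(tTH := (A2 tTH)(0 := \<theta>), tHH := a')"
  have "X (Suc (i * n + k)) = x i k" if "k < n" for i k
    using that by (simp add: X_def)
  then obtain Y where Y: "\<forall>i<h. \<forall>k<n. Y i k = x (2 * i) k - x (2 * i + 1) k" and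
    d: "does X N3 (Seq Pairs (Seq Weights (Seq Ident (Seq (Main \<rho>) Ratio)))) A4 (T_core n h b r)
      (\<lambda>A'. A' tHH 0 / A' tCN 0 / (2 * (real h - real r)) = filtering.out n h r b \<rho> \<theta> Y)"
    using does_core[of N3 n h b r X x A4 \<theta> \<rho>] by (auto simp: Nd A4_def A2_def)
  obtain t5 A5 where e5: "exec (Seq Pairs (Seq Weights (Seq Ident (Seq (Main \<rho>) Ratio)))) (mk X N3 A4) t5 (mk X N3 A5)"
    and t5: "t5 \<le> T_core n h b r"
    and o: "A5 tHH 0 / A5 tCN 0 / (2 * (real h - real r)) = filtering.out n h r b \<rho> \<theta> Y"
    using d unfolding does_def by blast
  let ?o = "RDiv (RDiv (rd tHH (NConst 0)) (rd tCN (NConst 0))) (RMul (RConst 2) (RSub (ROfNat (reg 2)) (ROfNat (reg 4))))"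
  let ?s = "(fst (mk X N3 A5), (snd (mk X N3 A5))(nval (NConst 0) (mk X N3 A5) := rval ?o (mk X N3 A5)))"
  have e6: "exec (RStore (NConst 0) ?o) (mk X N3 A5) 1 ?s" by (rule exec.RStore)
  have "rval ?o (mk X N3 A5) = filtering.out n h r b \<rho> \<theta> Y"
    using o by (simp add: Nd)
  then have s0: "snd ?s 0 = filtering.out n h r b \<rho> \<theta> Y" by simp
  have "exec (Estimator \<rho> \<theta>0 \<kappa> c) (input_state n (2 * h) \<eta> x)
      ((2 * h + 1) + ((3 * b + 2) + (1 + ((3 * level b + 3) + (t5 + 1))))) ?s"
    unfolding Estimator_def init
    using e1 e2 e3 e4 e5 e6 unfolding A2_def[symmetric] A4_def[symmetric] by (intro exec.Seq)
  then have "computes (Estimator \<rho> \<theta>0 \<kappa> c) n (2 * h) \<eta> x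
      ((2 * h + 1) + ((3 * b + 2) + (1 + ((3 * level b + 3) + (t5 + 1))))) (filtering.out n h r b \<rho> \<theta> Y)"
    unfolding computes_def using s0 by blast
  moreover have "(2 * h + 1) + ((3 * b + 2) + (1 + ((3 * level b + 3) + (t5 + 1)))) \<le> 2 * h + 6 * b + 8 + T_core n h b r"
    using t5 level_props(3)[of b] by simp
  ultimately show ?thesis using Y by blast
qed

text \<open>\<open>h\<close> enters only linearly, since the quadratic cost of ranking falls on the
  small batch. Everything else is collected in \<open>z\<close>, and each monomial is bounded by
  \<open>z ^ 5 * H\<close>.\<close>

lemma time_bound:
  fixes n h b r :: nat
  defines "z \<equiv> n + b + r + 1" and "H \<equiv> h + 1"
  shows "2 * h + 6 * b + 8 + T_core n h b r \<le> 250 * (z ^ 5 * H)"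
proof -
  have le: "n \<le> z" "b \<le> z" "r \<le> z" "h \<le> H" "n + 1 \<le> z" "1 \<le> z" "1 \<le> H" by (auto simp: z_def H_def)
  have p: "z ^ i * H ^ j \<le> z ^ k * H ^ l" if "i \<le> k" "j \<le> l" for i j k l
    using that le by (intro mult_mono power_increasing) auto
  have q: "z ^ i \<le> z ^ k * H" "H \<le> z ^ k * H" "z \<le> z ^ Suc k * H" "1 \<le> z ^ k * H" if "i \<le> k" for i k
    using p[of i k 0 1] p[of 0 k 1 1] p[of 1 "Suc k" 0 1] p[of 0 k 0 1] that by simp_all
  interpret filtering n h r b 0 0 "\<lambda>_ _. 0" .
  have "T_dir \<le> (6 * z + 3) + ((z * (5 * z + 7) + 2) + (((z + H) * (3 * z + 6) + 2) + ((z * (4 * z + 7) + 3) + (4 * H + 2))))"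
    unfolding T_dir_def using le by (intro add_mono mult_mono order_refl) auto
  also have "\<dots> = 12 * z^2 + 26 * z + 3 * (z * H) + 10 * H + 12"
    by (simp add: algebra_simps power2_eq_square)
  also have "\<dots> \<le> 63 * (z ^ 2 * H)"
    using q(1)[of 2 2] q(1)[of 1 2, unfolded power_one_right] q(2)[of 0 2] q(4)[of 0 2]
      p[of 1 2 1 1, unfolded power_one_right] by linarith
  finally have d: "T_dir \<le> 63 * (z ^ 2 * H)" .
  have "T_filters \<le> z * (63 * (z ^ 2 * H) + 2) + 2"
    unfolding T_filters_def using le d by (intro add_mono mult_mono order_refl) auto
  also have "\<dots> = 63 * (z ^ 3 * H) + 2 * z + 2" by (simp add: algebra_simps power_numeral_reduce)
  also have "\<dots> \<le> 67 * (z ^ 3 * H)" using q(1)[of 1 3, unfolded power_one_right] q(4)[of 0 3] by linarith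
  finally have f: "T_filters \<le> 67 * (z ^ 3 * H)" .
  have "T_step \<le> 67 * (z ^ 3 * H) + ((z * (z * (3 * H + 6) + 4) + 2) + ((3 * (z * z) + 2) + (z * (z * (z * (3 * z + 9) + 4) + 6) + 2)))"
    unfolding T_step_def using le f by (intro add_mono mult_mono order_refl) auto
  also have "\<dots> = 67 * (z ^ 3 * H) + 3 * (z ^ 2 * H) + 3 * z ^ 4 + 9 * z ^ 3 + 13 * z ^ 2 + 10 * z + 6"
    by (simp add: algebra_simps power_numeral_reduce)
  also have "\<dots> \<le> 111 * (z ^ 4 * H)"
    using q(1)[of 4 4] q(1)[of 3 4] q(1)[of 2 4] q(1)[of 1 4, unfolded power_one_right] q(4)[of 0 4]
      p[of 3 4 1 1, unfolded power_one_right] p[of 2 4 1 1, unfolded power_one_right] by linarith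
  finally have s: "T_step \<le> 111 * (z ^ 4 * H)" .
  have "T_main \<le> z * (111 * (z ^ 4 * H) + 2) + 2"
    unfolding T_main_def using le s by (intro add_mono mult_mono order_refl) auto
  also have "\<dots> = 111 * (z ^ 5 * H) + 2 * z + 2" by (simp add: algebra_simps power_numeral_reduce)
  finally have m: "T_main \<le> 111 * (z ^ 5 * H) + 2 * z + 2" .
  have "T_ratio \<le> (z * (z * (3 * z + 6) + 4) + 2) + ((3 * (z * z) + 3) + (3 * (z * z) + 3))"
    unfolding T_ratio_def using le by (intro add_mono mult_mono order_refl) auto
  also have "\<dots> = 3 * z ^ 3 + 12 * z ^ 2 + 4 * z + 8" by (simp add: algebra_simps power_numeral_reduce)
  finally have r: "T_ratio \<le> 3 * z ^ 3 + 12 * z ^ 2 + 4 * z + 8" .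
  have "T_core n h b r \<le> (H * (3 * z + 4) + 2) + ((4 * H + 2) + ((3 * z + 2) + (T_main + T_ratio)))"
    unfolding T_core_def using le by (intro add_mono mult_mono order_refl) auto
  also have "\<dots> = 3 * (z * H) + 8 * H + 3 * z + 6 + T_main + T_ratio" by (simp add: algebra_simps)
  finally have "2 * h + 6 * b + 8 + T_core n h b r \<le>
      2 * H + 6 * z + 8 + (3 * (z * H) + 8 * H + 3 * z + 6 + (111 * (z ^ 5 * H) + 2 * z + 2) + (3 * z ^ 3 + 12 * z ^ 2 + 4 * z + 8))"
    using m r le by linarith
  also have "\<dots> = 111 * (z ^ 5 * H) + 3 * (z * H) + 3 * z ^ 3 + 12 * z ^ 2 + 15 * z + 10 * H + 24" by simp
  also have "\<dots> \<le> 250 * (z ^ 5 * H)"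
    using q(1)[of 3 5] q(2)[of 0 5] q(1)[of 2 5] q(1)[of 1 5, unfolded power_one_right] q(4)[of 0 5]
      p[of 1 5 1 1, unfolded power_one_right] by linarith
  finally show ?thesis .
qed


section \<open>Counts and moments\<close>


text \<open>Markov's inequality for the strict event, which also covers \<open>c = 0\<close>: then
  the expectation is 0 and the event is null. Directions of zero variance need this case.\<close>

lemma (in prob_space) markov_strict:
  assumes "X \<in> borel_measurable M" "integrable M X" "\<And>\<omega>. 0 \<le> X \<omega>" "0 \<le> c" "0 \<le> q" "expectation X \<le> q * c"
  shows "prob {\<omega> \<in> space M. c < X \<omega>} \<le> q"
proof (cases "c = 0")
  case True
  then have "expectation X = 0" using assms by (intro antisym) (auto intro: integral_nonneg_AE)
  then have "AE \<omega> in M. X \<omega> = 0"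
    using integral_nonneg_eq_0_iff_AE[OF assms(2)] assms(3) by auto
  then have "AE \<omega> in M. \<not> c < X \<omega>" using True by auto
  then have "prob {\<omega> \<in> space M. c < X \<omega>} = 0"
    using assms(1) by (subst prob_Collect_eq_0) auto
  then show ?thesis using assms by simp
next
  case False
  then have c: "c > 0" using assms by simp
  have "prob {\<omega> \<in> space M. c < X \<omega>} \<le> prob {\<omega> \<in> space M. X \<omega> \<ge> c}"
    using assms(1) by (intro finite_measure_mono) auto
  also have "\<dots> \<le> expectation X / c"
    using assms c by (intro integral_Markov_inequality_measure[where A = "{}"]) auto
  also have "\<dots> \<le> q" using assms c by (simp add: divide_le_eq)
  finally show ?thesis .
qed

text \<open>Markov's inequality for \<open>K\<close> to the power of the count. One proof serves
  both tails: \<open>K > 1\<close> gives the upper and \<open>K < 1\<close> the lower one, and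
  multiplying the hypothesis on \<open>p\<close> by \<open>K - 1\<close> turns it into an upper or a
  lower bound accordingly.\<close>

lemma (in prob_space) chernoff_count:
  assumes I: "finite I" "indep_vars (\<lambda>_. N) W I" and G: "G \<in> sets N" and K: "0 < K"
    and p: "\<And>i. i \<in> I \<Longrightarrow> (K - 1) * prob {\<omega> \<in> space M. W i \<omega> \<in> G} \<le> (K - 1) * p"
  shows "prob {\<omega> \<in> space M. K powr a \<le> K ^ card {i \<in> I. W i \<omega> \<in> G}} \<le>
    exp (real (card I) * ((K - 1) * p)) / K powr a"
proof -
  define X where "X = (\<lambda>i \<omega>. 1 + (K - 1) * indicator G (W i \<omega>) :: real)"
  have W: "W i \<in> measurable M N" if "i \<in> I" for i using I(2) that by (auto simp: indep_vars_def)
  have ind: "indep_vars (\<lambda>_. borel) X I"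
    unfolding X_def by (rule indep_vars_compose2[OF I(2)]) (use G in measurable)
  have X01: "X i \<omega> = (if W i \<omega> \<in> G then K else 1)" for i \<omega> by (simp add: X_def)
  have int: "integrable M (X i)" if "i \<in> I" for i
    unfolding X_def using W[OF that] G
    by (intro Bochner_Integration.integrable_add integrable_mult_right integrable_const integrable_real_indicator[where A = "W i -` G \<inter> space M", THEN Bochner_Integration.integrable_cong[THEN iffD1, rotated -1]])
      (auto simp: emeasure_eq_measure indicator_def)
  have ex: "expectation (X i) \<le> exp ((K - 1) * p)" if i: "i \<in> I" for i
  proof -
    have "expectation (\<lambda>\<omega>. indicator G (W i \<omega>) :: real) = expectation (indicator {\<omega> \<in> space M. W i \<omega> \<in> G})"
      by (intro Bochner_Integration.integral_cong) (auto simp: indicator_def)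
    also have "\<dots> = prob {\<omega> \<in> space M. W i \<omega> \<in> G}" using W[OF i] G by simp
    finally have e: "expectation (\<lambda>\<omega>. indicator G (W i \<omega>) :: real) = prob {\<omega> \<in> space M. W i \<omega> \<in> G}" .
    have "integrable M (\<lambda>\<omega>. indicator G (W i \<omega>) :: real)"
      using W[OF i] G by (intro integrable_const_bound[where B = 1]) auto
    then have "expectation (X i) = 1 + (K - 1) * prob {\<omega> \<in> space M. W i \<omega> \<in> G}"
      unfolding X_def by (simp add: e prob_space)
    also have "\<dots> \<le> 1 + (K - 1) * p" using p[OF i] by simp
    also have "\<dots> \<le> exp ((K - 1) * p)" by (rule exp_ge_add_one_self)
    finally show ?thesis .
  qed
  have prod: "(\<Prod>i\<in>I. X i \<omega>) = K ^ card {i \<in> I. W i \<omega> \<in> G}" for \<omega>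
    using I(1) by (simp add: X01 prod.If_cases Int_def)
  have "expectation (\<lambda>\<omega>. \<Prod>i\<in>I. X i \<omega>) = (\<Prod>i\<in>I. expectation (X i))"
    using I ind int by (intro indep_vars_lebesgue_integral) auto
  also have "\<dots> \<le> (\<Prod>i\<in>I. exp ((K - 1) * p))"
    using ex K by (intro prod_mono) (auto simp: X01 intro!: integral_nonneg_AE)
  also have "\<dots> = exp (real (card I) * ((K - 1) * p))" by (simp add: exp_of_nat_mult)
  finally have le: "expectation (\<lambda>\<omega>. \<Prod>i\<in>I. X i \<omega>) \<le> exp (real (card I) * ((K - 1) * p))" .
  have nn: "0 \<le> (\<Prod>i\<in>I. X i \<omega>)" for \<omega> using K by (auto simp: X01 intro!: prod_nonneg)
  have "prob {\<omega> \<in> space M. K powr a \<le> (\<Prod>i\<in>I. X i \<omega>)} \<le> expectation (\<lambda>\<omega>. \<Prod>i\<in>I. X i \<omega>) / K powr a"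
    using K I ind int by (intro integral_Markov_inequality_measure[where A = "{}"] indep_vars_integrable)
      (auto simp: nn)
  also have "\<dots> \<le> exp (real (card I) * ((K - 1) * p)) / K powr a"
    using le by (intro divide_right_mono) auto
  finally show ?thesis by (simp add: prod)
qed

lemma (in prob_space) count_ge:
  assumes "finite I" "indep_vars (\<lambda>_. N) W I" "G \<in> sets N" "1 < K"
    and "\<And>i. i \<in> I \<Longrightarrow> prob {\<omega> \<in> space M. W i \<omega> \<in> G} \<le> p"
  shows "prob {\<omega> \<in> space M. a \<le> real (card {i \<in> I. W i \<omega> \<in> G})} \<le> exp (real (card I) * ((K - 1) * p)) / K powr a"
proof -
  have "K powr a \<le> K ^ k \<longleftrightarrow> a \<le> real k" for k
    using assms(4) by (simp add: powr_realpow[symmetric])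
  then show ?thesis using chernoff_count[OF assms(1-3), of K p a] assms by simp
qed

lemma (in prob_space) count_le:
  assumes "finite I" "indep_vars (\<lambda>_. N) W I" "G \<in> sets N"
    and "\<And>i. i \<in> I \<Longrightarrow> p \<le> prob {\<omega> \<in> space M. W i \<omega> \<in> G}"
  shows "prob {\<omega> \<in> space M. real (card {i \<in> I. W i \<omega> \<in> G}) \<le> a} \<le> exp (a - real (card I) * (p / 2))"
proof -
  define K :: real where "K = exp (- 1)"
  have K: "0 < K" "K \<le> 1/2" 
    using exp_ge_add_one_self[of 1] by (auto simp: K_def exp_minus inverse_eq_divide divide_le_eq)
  have eq: "K powr a \<le> K ^ k \<longleftrightarrow> real k \<le> a" for k
    by (simp add: K_def exp_powr_real exp_of_nat_mult[symmetric])
  have "prob {\<omega> \<in> space M. K powr a \<le> K ^ card {i \<in> I. W i \<omega> \<in> G}} \<le>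
      exp (real (card I) * ((K - 1) * max p 0)) / K powr a"
    by (rule chernoff_count[OF assms(1-3) K(1)]) (use assms(4) K in \<open>auto intro!: mult_left_mono_neg\<close>)
  also have "\<dots> = exp (a - real (card I) * ((1 - K) * max p 0))"
  proof -
    have Kp: "K powr a = exp (- a)" by (simp add: K_def exp_powr_real)
    show ?thesis unfolding Kp by (simp add: exp_diff[symmetric] algebra_simps)
  qed
  also have "\<dots> \<le> exp (a - real (card I) * (p / 2))"
  proof -
    \<comment> \<open>With \<open>K = exp (- 1)\<close> the factor \<open>1 - K\<close> is at least
      1/2; a negative \<open>p\<close> makes the left side negative.\<close>
    have "p / 2 \<le> (1 - K) * max p 0"
    proof (cases "p \<le> 0")
      case False
      then show ?thesis using K mult_right_mono[of "1/2" "1 - K" p] by simp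
    qed auto
    from mult_left_mono[OF this, of "real (card I)"] show ?thesis by simp
  qed
  finally show ?thesis by (simp add: eq)
qed

lemma (in prob_space) second_moment_sum:
  fixes X :: "'i \<Rightarrow> 'a \<Rightarrow> real"
  assumes I: "finite I" "indep_vars (\<lambda>_. borel) X I"
    and sq: "\<And>i. i \<in> I \<Longrightarrow> integrable M (\<lambda>\<omega>. (X i \<omega>)\<^sup>2)" and zero: "\<And>i. i \<in> I \<Longrightarrow> expectation (X i) = 0"
  shows "integrable M (\<lambda>\<omega>. (\<Sum>i\<in>I. X i \<omega>)\<^sup>2)"
    and "expectation (\<lambda>\<omega>. (\<Sum>i\<in>I. X i \<omega>)\<^sup>2) = (\<Sum>i\<in>I. expectation (\<lambda>\<omega>. (X i \<omega>)\<^sup>2))"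
proof -
  have rv: "random_variable borel (X i)" if "i \<in> I" for i using I(2) that by (auto simp: indep_vars_def)
  have int: "integrable M (X i)" if "i \<in> I" for i
    by (rule square_integrable_imp_integrable[OF rv[OF that] sq[OF that]])
  have ij: "integrable M (\<lambda>\<omega>. X i \<omega> * X j \<omega>)"
    "expectation (\<lambda>\<omega>. X i \<omega> * X j \<omega>) = (if i = j then expectation (\<lambda>\<omega>. (X i \<omega>)\<^sup>2) else 0)"
    if "i \<in> I" "j \<in> I" for i j
  proof -
    have "integrable M (\<lambda>\<omega>. X i \<omega> * X j \<omega>) \<and>
      expectation (\<lambda>\<omega>. X i \<omega> * X j \<omega>) = (if i = j then expectation (\<lambda>\<omega>. (X i \<omega>)\<^sup>2) else 0)"
    proof (cases "i = j")
      case True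
      then show ?thesis using sq[OF that(1)] by (simp add: power2_eq_square)
    next
      case False
      have s: "indep_vars (\<lambda>_. borel) X {i, j}" using that by (intro indep_vars_subset[OF I(2)]) auto
      show ?thesis
        using indep_vars_integrable[OF _ s] indep_vars_lebesgue_integral[OF _ s] that int zero False by auto
    qed
    then show "integrable M (\<lambda>\<omega>. X i \<omega> * X j \<omega>)"
      "expectation (\<lambda>\<omega>. X i \<omega> * X j \<omega>) = (if i = j then expectation (\<lambda>\<omega>. (X i \<omega>)\<^sup>2) else 0)" by auto
  qed
  have eq: "(\<Sum>i\<in>I. X i \<omega>)\<^sup>2 = (\<Sum>i\<in>I. \<Sum>j\<in>I. X i \<omega> * X j \<omega>)" for \<omega>
    by (simp add: power2_eq_square sum_product)
  show "integrable M (\<lambda>\<omega>. (\<Sum>i\<in>I. X i \<omega>)\<^sup>2)"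
    unfolding eq using ij by (intro Bochner_Integration.integrable_sum) auto
  show "expectation (\<lambda>\<omega>. (\<Sum>i\<in>I. X i \<omega>)\<^sup>2) = (\<Sum>i\<in>I. expectation (\<lambda>\<omega>. (X i \<omega>)\<^sup>2))"
    unfolding eq using ij I(1) by (subst Bochner_Integration.integral_sum; simp)+
qed

text \<open>Bound for a \<open>q\<close>-th absolute moment in units of the standard deviation, by
  cutting the range into layers of unit width. Through such constants \<open>\<gamma>\<close> enters
  all later ones.\<close>

definition tail_moment :: "real \<Rightarrow> nat \<Rightarrow> real" where
  "tail_moment \<gamma> q = (\<Sum>j. (real j + 1) ^ q * exp (- (real j powr \<gamma>)))"

lemma summable_tail_moment:
  assumes "\<gamma> > 0"
  shows "summable (\<lambda>j. (real j + 1) ^ q * exp (- (real j powr \<gamma>)))"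
proof (rule summable_comparison_test_bigo)
  show "summable (\<lambda>j. norm (1 / real j ^ 2))"
    using inverse_power_summable[of 2, where 'a = real] by (simp add: inverse_eq_divide)
  have "(\<lambda>x. (x + 1) powr real q * exp (- (x powr \<gamma>))) \<in> O[at_top](\<lambda>x :: real. 1 / x ^ 2)"
    using assms by real_asymp
  from landau_o.big.compose[OF this filterlim_real_sequentially]
  have "(\<lambda>j. (real j + 1) powr real q * exp (- (real j powr \<gamma>))) \<in> O(\<lambda>j. 1 / real j ^ 2)" .
  also have "(\<lambda>j. (real j + 1) powr real q) = (\<lambda>j. (real j + 1) ^ q)"
    by (intro ext powr_realpow) auto
  finally show "(\<lambda>j. (real j + 1) ^ q * exp (- (real j powr \<gamma>))) \<in> O(\<lambda>j. 1 / real j ^ 2)" .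
qed

lemma tail_moment_ge_1: "\<gamma> > 0 \<Longrightarrow> 1 \<le> tail_moment \<gamma> q"
  unfolding tail_moment_def
  using sum_le_suminf[OF summable_tail_moment[of \<gamma> q], of "{0}"] by simp

lemma (in prob_space) moment_from_tail:
  assumes \<gamma>: "\<gamma> > 0" and Z: "Z \<in> borel_measurable M" and \<sigma>: "0 \<le> \<sigma>" and q: "q \<ge> 1"
    and tail: "\<And>t. 0 \<le> t \<Longrightarrow> prob {\<omega> \<in> space M. t * \<sigma> < \<bar>Z \<omega>\<bar>} \<le> exp (- (t powr \<gamma>))"
  shows "(\<integral>\<^sup>+\<omega>. ennreal (\<bar>Z \<omega>\<bar> ^ q) \<partial>M) \<le> ennreal (tail_moment \<gamma> q * \<sigma> ^ q)"
proof -
  let ?B = "\<lambda>j. {\<omega> \<in> space M. real j * \<sigma> < \<bar>Z \<omega>\<bar>}"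
  \<comment> \<open>For \<open>\<sigma> = 0\<close> the layers degenerate; all tail events are then
    the same event, and growing \<open>t\<close> shows that it is null.\<close>
  have zero: "AE \<omega> in M. \<sigma> = 0 \<longrightarrow> Z \<omega> = 0"
  proof (cases "\<sigma> = 0")
    case True
    have "prob {\<omega> \<in> space M. 0 < \<bar>Z \<omega>\<bar>} \<le> e" if e: "e > 0" for e
    proof -
      \<comment> \<open>Solves \<open>exp (- (t powr \<gamma>)) \<le> e\<close>.\<close>
      define t where "t = (max 0 (- ln e)) powr (1 / \<gamma>)"
      have "t powr \<gamma> = max 0 (- ln e)" using \<gamma> by (simp add: t_def powr_powr)
      then have "exp (- (t powr \<gamma>)) \<le> e" using e by (simp add: max_def exp_minus)
      then show ?thesis using tail[of t] True by (simp add: t_def)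
    qed
    then have "prob {\<omega> \<in> space M. 0 < \<bar>Z \<omega>\<bar>} \<le> 0" by (rule field_le_epsilon[of _ 0, simplified])
    then have "prob {\<omega> \<in> space M. 0 < \<bar>Z \<omega>\<bar>} = 0" by (simp add: measure_le_0_iff)
    then have "AE \<omega> in M. \<not> 0 < \<bar>Z \<omega>\<bar>" using Z by (subst (asm) prob_Collect_eq_0) auto
    then show ?thesis by auto
  qed auto
  have "(\<integral>\<^sup>+\<omega>. ennreal (\<bar>Z \<omega>\<bar> ^ q) \<partial>M) \<le>
      (\<integral>\<^sup>+\<omega>. (\<Sum>j. ennreal (((real j + 1) * \<sigma>) ^ q) * indicator (?B j) \<omega>) \<partial>M)"
  proof (rule nn_integral_mono_AE)
    show "AE \<omega> in M. ennreal (\<bar>Z \<omega>\<bar> ^ q) \<le> (\<Sum>j. ennreal (((real j + 1) * \<sigma>) ^ q) * indicator (?B j) \<omega>)"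
      using zero AE_space
    proof eventually_elim
      case (elim \<omega>)
      show ?case
      proof (cases "Z \<omega> = 0")
        case True
        then show ?thesis using q by (simp add: power_0_left)
      next
        case False
        then have s: "\<sigma> > 0" using elim \<sigma> by auto
        \<comment> \<open>Ceiling minus one, not the floor: the event for layer \<open>j\<close> is
          a strict inequality.\<close>
        define j where "j = nat (\<lceil>\<bar>Z \<omega>\<bar> / \<sigma>\<rceil> - 1)"
        have "\<bar>Z \<omega>\<bar> / \<sigma> > 0" using False s by simp
        then have c: "\<lceil>\<bar>Z \<omega>\<bar> / \<sigma>\<rceil> \<ge> 1" by linarith
        then have j: "real j < \<bar>Z \<omega>\<bar> / \<sigma>" "\<bar>Z \<omega>\<bar> / \<sigma> \<le> real j + 1"
          unfolding j_def by linarith+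
        then have j': "real j * \<sigma> < \<bar>Z \<omega>\<bar>" "\<bar>Z \<omega>\<bar> \<le> (real j + 1) * \<sigma>"
          using s by (auto simp: field_simps)
        define f where "f = (\<lambda>i. ennreal (((real i + 1) * \<sigma>) ^ q) * indicator (?B i) \<omega>)"
        have "ennreal (\<bar>Z \<omega>\<bar> ^ q) \<le> f j"
          unfolding f_def using j' elim(2) by (auto intro!: ennreal_leI power_mono)
        also have "f j = (\<Sum>i\<in>{j}. f i)" by simp
        also have "\<dots> \<le> (\<Sum>i. f i)" by (rule sum_le_suminf) auto
        finally show ?thesis unfolding f_def .
      qed
    qed
  qed
  also have "\<dots> = (\<Sum>j. \<integral>\<^sup>+\<omega>. ennreal (((real j + 1) * \<sigma>) ^ q) * indicator (?B j) \<omega> \<partial>M)"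
    using Z by (intro nn_integral_suminf) measurable
  also have "\<dots> = (\<Sum>j. ennreal (((real j + 1) * \<sigma>) ^ q * prob (?B j)))"
  proof (intro suminf_cong)
    fix j
    have "?B j \<in> sets M" using Z by measurable
    then show "(\<integral>\<^sup>+\<omega>. ennreal (((real j + 1) * \<sigma>) ^ q) * indicator (?B j) \<omega> \<partial>M) = ennreal (((real j + 1) * \<sigma>) ^ q * prob (?B j))"
      using \<sigma> by (simp add: nn_integral_cmult_indicator emeasure_eq_measure ennreal_mult)
  qed
  also have "\<dots> \<le> (\<Sum>j. ennreal (((real j + 1) ^ q * exp (- (real j powr \<gamma>))) * \<sigma> ^ q))"
  proof (intro suminf_le ennreal_leI)
    fix j
    have "((real j + 1) * \<sigma>) ^ q * prob (?B j) \<le> ((real j + 1) * \<sigma>) ^ q * exp (- (real j powr \<gamma>))"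
      using \<sigma> tail[of "real j"] by (intro mult_left_mono) auto
    then show "((real j + 1) * \<sigma>) ^ q * prob (?B j) \<le> ((real j + 1) ^ q * exp (- (real j powr \<gamma>))) * \<sigma> ^ q"
      by (simp add: power_mult_distrib mult_ac)
  qed auto
  also have "\<dots> = ennreal (\<Sum>j. ((real j + 1) ^ q * exp (- (real j powr \<gamma>))) * \<sigma> ^ q)"
    using summable_tail_moment[OF \<gamma>, of q] \<sigma> by (intro suminf_ennreal2 summable_mult2) auto
  also have "(\<Sum>j. ((real j + 1) ^ q * exp (- (real j powr \<gamma>))) * \<sigma> ^ q) = tail_moment \<gamma> q * \<sigma> ^ q"
    unfolding tail_moment_def using summable_tail_moment[OF \<gamma>, of q] by (rule suminf_mult2[symmetric])
  finally show ?thesis .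
qed


section \<open>Differences of two noisy samples\<close>


lemma distr_pair_snd':
  assumes "prob_space A" "prob_space B"
  shows "distr (A \<Otimes>\<^sub>M B) B snd = B"
proof -
  interpret A: prob_space A by fact
  interpret B: prob_space B by fact
  interpret pair_prob_space A B ..
  show ?thesis
  proof (rule measure_eqI)
    fix X assume "X \<in> sets (distr (A \<Otimes>\<^sub>M B) B snd)"
    then have X: "X \<in> sets B" by simp
    then have "snd -` X \<inter> space (A \<Otimes>\<^sub>M B) = space A \<times> X"
      using sets.sets_into_space[OF X] by (auto simp: space_pair_measure)
    then show "emeasure (distr (A \<Otimes>\<^sub>M B) B snd) X = emeasure B X"
      using X by (simp add: emeasure_distr B.emeasure_pair_measure_Times A.emeasure_space_1)
  qed simp
qed

lemma
  fixes f :: "'a \<Rightarrow> real" and g :: "'b \<Rightarrow> real"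
  assumes "prob_space A" "prob_space B" and f: "integrable A f" and g: "integrable B g"
  shows integrable_pair_mult: "integrable (A \<Otimes>\<^sub>M B) (\<lambda>z. f (fst z) * g (snd z))"
    and integral_pair_mult: "(\<integral>z. f (fst z) * g (snd z) \<partial>(A \<Otimes>\<^sub>M B)) = (\<integral>x. f x \<partial>A) * (\<integral>y. g y \<partial>B)"
proof -
  interpret A: prob_space A by fact
  interpret B: prob_space B by fact
  interpret pair_prob_space A B ..
  note [measurable] = borel_measurable_integrable[OF f] borel_measurable_integrable[OF g]
  show i: "integrable (A \<Otimes>\<^sub>M B) (\<lambda>z. f (fst z) * g (snd z))"
    by (rule Fubini_integrable) (use f g in \<open>auto simp: abs_mult\<close>)
  show "(\<integral>z. f (fst z) * g (snd z) \<partial>(A \<Otimes>\<^sub>M B)) = (\<integral>x. f x \<partial>A) * (\<integral>y. g y \<partial>B)"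
    using integral_fst'[OF i] by simp
qed

text \<open>Bounds the moment of order \<open>2 * q\<close> of a difference.
  \<open>2 ^ (2 * q)\<close> comes from bounding a power of a sum by powers of its two terms, and
  one more factor 2 from there being two equally distributed terms.\<close>

definition moment_const :: "real \<Rightarrow> nat \<Rightarrow> real" where
  "moment_const \<gamma> q = 2 ^ (2 * q + 1) * tail_moment \<gamma> (2 * q)"

lemma moment_const_ge_1:
  assumes "0 < \<gamma>"
  shows "1 \<le> moment_const \<gamma> q"
proof -
  have "1 * 1 \<le> 2 ^ (2 * q + 1) * tail_moment \<gamma> (2 * q)"
    using tail_moment_ge_1[OF assms, of "2 * q"] one_le_power[of "2 :: real" "2 * q + 1"]
    by (intro mult_mono) auto
  then show ?thesis by (simp add: moment_const_def)
qed

section \<open>Moments and tails of the difference of two clean draws\<close>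

locale noisy =
  fixes n :: nat and D :: "(nat \<Rightarrow> real) measure" and \<mu> :: "nat \<Rightarrow> real" and S :: "nat \<Rightarrow> nat \<Rightarrow> real"
    and \<gamma> \<eta> :: real
  assumes dist: "distribution_on n D" and mc: "has_mean_and_covariance n D \<mu> S"
    and conc: "concentrated n D \<mu> S \<gamma>" and \<gamma>: "0 < \<gamma>" and \<eta>: "0 < \<eta>" "\<eta> < 1"
begin

sublocale D: prob_space D using dist by (simp add: distribution_on_def)

definition N :: "(bool \<times> (nat \<Rightarrow> real)) measure" where "N = measure_pmf (bernoulli_pmf \<eta>) \<Otimes>\<^sub>M D"
definition NN :: "((bool \<times> (nat \<Rightarrow> real)) \<times> (bool \<times> (nat \<Rightarrow> real))) measure" where "NN = N \<Otimes>\<^sub>M N"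

sublocale N: prob_space N
  unfolding N_def by (intro prob_space_pair measure_pmf.prob_space_axioms D.prob_space_axioms)
sublocale NN: prob_space NN
  unfolding NN_def by (intro prob_space_pair N.prob_space_axioms)

lemma measurable_coord [measurable]: "k < n \<Longrightarrow> (\<lambda>x. x k) \<in> borel_measurable D"
  using dist measurable_component_singleton[of k "{..<n}" "\<lambda>_. borel :: real measure"]
  by (auto simp: distribution_on_def cong: measurable_cong_sets)

definition Z :: "(nat \<Rightarrow> real) \<Rightarrow> (nat \<Rightarrow> real) \<Rightarrow> real" where
  "Z v x = (\<Sum>i<n. (x i - \<mu> i) * v i)"

lemma measurable_Z [measurable]: "Z v \<in> borel_measurable D"
  unfolding Z_def by measurable

definition s2 :: "(nat \<Rightarrow> real) \<Rightarrow> real" where "s2 v = qf n S v"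

lemma s2_eq: "s2 v = (\<Sum>i<n. \<Sum>j<n. v i * S i j * v j)"
  by (simp add: s2_def qf_def dot_def mv_def sum_distrib_left mult.assoc)

lemma cov: "i < n \<Longrightarrow> j < n \<Longrightarrow> has_bochner_integral D (\<lambda>x. (x i - \<mu> i) * (x j - \<mu> j)) (S i j)"
  and mean: "i < n \<Longrightarrow> has_bochner_integral D (\<lambda>x. x i) (\<mu> i)"
  using mc by (auto simp: has_mean_and_covariance_def)

lemma S_sym: "i < n \<Longrightarrow> j < n \<Longrightarrow> S i j = S j i"
  using cov[of i j] cov[of j i] by (metis (no_types, lifting) has_bochner_integral_eq has_bochner_integral_cong mult.commute)

lemma Z_square: "has_bochner_integral D (\<lambda>x. (Z v x)\<^sup>2) (s2 v)"
proof -
  have "has_bochner_integral D (\<lambda>x. \<Sum>i<n. \<Sum>j<n. v i * v j * ((x i - \<mu> i) * (x j - \<mu> j)))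
      (\<Sum>i<n. \<Sum>j<n. v i * v j * S i j)"
    using cov by (intro has_bochner_integral_sum has_bochner_integral_mult_right) auto
  moreover have "(\<Sum>i<n. \<Sum>j<n. v i * v j * ((x i - \<mu> i) * (x j - \<mu> j))) = (Z v x)\<^sup>2" for x
    by (simp add: Z_def power2_eq_square sum_product mult_ac)
  ultimately show ?thesis by (simp add: s2_eq mult_ac)
qed

lemma s2_nonneg: "0 \<le> s2 v"
  using Z_square[of v] Bochner_Integration.integral_nonneg[of D "\<lambda>x. (Z v x)\<^sup>2"]
  by (simp add: has_bochner_integral_iff)

sublocale S: psd_form n S
  by unfold_locales (use S_sym s2_nonneg in \<open>auto simp: s2_def\<close>)

definition sd :: "(nat \<Rightarrow> real) \<Rightarrow> real" where "sd v = sqrt (s2 v)"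

lemma sd_nonneg: "0 \<le> sd v" and sd_square: "(sd v)\<^sup>2 = s2 v"
  using s2_nonneg by (auto simp: sd_def)

lemma tail_D:
  assumes t: "0 \<le> t"
  shows "D.prob {x \<in> space D. t * sd v < \<bar>Z v x\<bar>} \<le> exp (- (t powr \<gamma>))"
proof (cases "\<forall>k<n. v k = 0")
  case True
  then have "Z v x = 0" for x by (simp add: Z_def)
  then have e: "{x \<in> space D. t * sd v < \<bar>Z v x\<bar>} = {}"
    using t sd_nonneg[of v] by (auto simp: not_less)
  show ?thesis unfolding e by simp
next
  case False
  define L where "L = L2_set v {..<n}"
  have L: "L > 0"
  proof -
    have "L \<noteq> 0" unfolding L_def using False by (subst L2_set_eq_0_iff) auto
    then show ?thesis unfolding L_def using L2_set_nonneg[of v "{..<n}"] by linarith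
  qed
  define u where "u = (\<lambda>k. v k / L)"
  have "L2_set u {..<n} = 1"
  proof -
    have "L2_set u {..<n} = L2_set (\<lambda>k. (1 / L) * v k) {..<n}" by (simp add: u_def)
    also have "\<dots> = (1 / L) * L2_set v {..<n}" using L by (subst L2_set_right_distrib[symmetric]) auto
    finally show ?thesis using L by (simp add: L_def)
  qed
  then have "D.prob {x \<in> space D. \<bar>\<Sum>i<n. (x i - \<mu> i) * u i\<bar> > t * sqrt (\<Sum>i<n. \<Sum>j<n. u i * S i j * u j)} \<le> exp (- (t powr \<gamma>))"
    using conc t unfolding concentrated_def by blast
  moreover have "(\<Sum>i<n. (x i - \<mu> i) * u i) = Z v x / L" for x
    by (simp add: u_def Z_def sum_divide_distrib)
  moreover have "sqrt (\<Sum>i<n. \<Sum>j<n. u i * S i j * u j) = sd v / L"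
  proof -
    have "(\<Sum>i<n. \<Sum>j<n. u i * S i j * u j) = s2 v / L\<^sup>2"
      by (simp add: u_def s2_eq sum_divide_distrib power2_eq_square)
    then show ?thesis using L by (simp add: sd_def real_sqrt_divide)
  qed
  moreover have "t * (sd v / L) < \<bar>Z v x / L\<bar> \<longleftrightarrow> t * sd v < \<bar>Z v x\<bar>" for x
    using L by (simp add: abs_divide divide_less_cancel)
  ultimately show ?thesis by simp
qed

text \<open>Uses the clean draws even where a coin says outlier. So \<open>U v\<close> never
  involves the adversary; \<open>inl\<close> tells when it is the projection that the algorithm
  sees.\<close>

definition U :: "(nat \<Rightarrow> real) \<Rightarrow> (bool \<times> (nat \<Rightarrow> real)) \<times> (bool \<times> (nat \<Rightarrow> real)) \<Rightarrow> real" where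
  "U v z = dot n v (\<lambda>k. snd (fst z) k - snd (snd z) k)"

lemma U_eq: "U v z = Z v (snd (fst z)) - Z v (snd (snd z))"
  by (simp add: U_def dot_def Z_def sum_subtractf algebra_simps)

lemma measurable_draws [measurable]: "(\<lambda>z. snd (fst z)) \<in> measurable NN D" "(\<lambda>z. snd (snd z)) \<in> measurable NN D"
  unfolding NN_def N_def by measurable

lemma measurable_coins [measurable]: "(\<lambda>z. fst (fst z)) \<in> measurable NN (count_space UNIV)"
  "(\<lambda>z. fst (snd z)) \<in> measurable NN (count_space UNIV)"
  unfolding NN_def N_def by (measurable; simp)+

lemma measurable_U [measurable]: "U v \<in> borel_measurable NN"
  unfolding U_eq[abs_def] by measurable

definition inl :: "(bool \<times> (nat \<Rightarrow> real)) \<times> (bool \<times> (nat \<Rightarrow> real)) \<Rightarrow> bool" where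
  "inl z \<longleftrightarrow> \<not> fst (fst z) \<and> \<not> fst (snd z)"

lemma measurable_inl [measurable]: "Measurable.pred NN inl"
  unfolding inl_def[abs_def] by measurable

lemma distr_draws: "distr NN D (\<lambda>z. snd (fst z)) = D" "distr NN D (\<lambda>z. snd (snd z)) = D"
proof -
  have s: "distr N D snd = D"
    unfolding N_def by (intro distr_pair_snd' measure_pmf.prob_space_axioms D.prob_space_axioms)
  have m: "snd \<in> measurable N D" unfolding N_def by measurable
  have "distr NN N fst = N" unfolding NN_def by (rule N.distr_pair_fst)
  then have "distr (distr NN N fst) D snd = D" using s by simp
  then show "distr NN D (\<lambda>z. snd (fst z)) = D"
    using m by (subst (asm) distr_distr) (auto simp: NN_def comp_def)
  have "distr NN N snd = N" unfolding NN_def by (intro distr_pair_snd' N.prob_space_axioms)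
  then have "distr (distr NN N snd) D snd = D" using s by simp
  then show "distr NN D (\<lambda>z. snd (snd z)) = D"
    using m by (subst (asm) distr_distr) (auto simp: NN_def comp_def)
qed

lemma distr_coins:
  "distr NN (count_space UNIV) (\<lambda>z. fst (fst z)) = distr (measure_pmf (bernoulli_pmf \<eta>)) (count_space UNIV) (\<lambda>x. x)"
  "distr NN (count_space UNIV) (\<lambda>z. fst (snd z)) = distr (measure_pmf (bernoulli_pmf \<eta>)) (count_space UNIV) (\<lambda>x. x)"
proof -
  have s: "distr N (measure_pmf (bernoulli_pmf \<eta>)) fst = measure_pmf (bernoulli_pmf \<eta>)"
    unfolding N_def by (rule D.distr_pair_fst)
  have c: "distr N (count_space UNIV) fst = distr (measure_pmf (bernoulli_pmf \<eta>)) (count_space UNIV) (\<lambda>x. x)"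
    by (subst s[symmetric], subst distr_distr) (auto simp: N_def comp_def)
  have m: "fst \<in> measurable N (count_space UNIV)" unfolding N_def by (measurable; simp)
  have f: "distr NN N fst = N" unfolding NN_def by (rule N.distr_pair_fst)
  have g: "distr NN N snd = N" unfolding NN_def by (intro distr_pair_snd' N.prob_space_axioms)
  have "fst \<in> measurable NN N" "snd \<in> measurable NN N" by (simp_all add: NN_def)
  then have "distr (distr NN N fst) (count_space UNIV) fst = distr NN (count_space UNIV) (\<lambda>z. fst (fst z))"
    "distr (distr NN N snd) (count_space UNIV) fst = distr NN (count_space UNIV) (\<lambda>z. fst (snd z))"
    using distr_distr[OF m] by (simp_all add: comp_def)
  then show "distr NN (count_space UNIV) (\<lambda>z. fst (fst z)) = distr (measure_pmf (bernoulli_pmf \<eta>)) (count_space UNIV) (\<lambda>x. x)"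
    "distr NN (count_space UNIV) (\<lambda>z. fst (snd z)) = distr (measure_pmf (bernoulli_pmf \<eta>)) (count_space UNIV) (\<lambda>x. x)"
    unfolding f g c by simp_all
qed

lemma prob_coin: "NN.prob {z \<in> space NN. fst (fst z)} = \<eta>" "NN.prob {z \<in> space NN. fst (snd z)} = \<eta>"
proof -
  have b: "measure (distr (measure_pmf (bernoulli_pmf \<eta>)) (count_space UNIV) (\<lambda>x. x)) {True} = \<eta>"
    using \<eta> by (subst measure_distr) (auto simp: measure_pmf_single)
  have "NN.prob {z \<in> space NN. fst (fst z)} = measure (distr NN (count_space UNIV) (\<lambda>z. fst (fst z))) {True}"
    by (subst measure_distr) (auto simp: vimage_def intro!: arg_cong[where f = "measure NN"])
  then show "NN.prob {z \<in> space NN. fst (fst z)} = \<eta>" unfolding distr_coins b .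
  have "NN.prob {z \<in> space NN. fst (snd z)} = measure (distr NN (count_space UNIV) (\<lambda>z. fst (snd z))) {True}"
    by (subst measure_distr) (auto simp: vimage_def intro!: arg_cong[where f = "measure NN"])
  then show "NN.prob {z \<in> space NN. fst (snd z)} = \<eta>" unfolding distr_coins b .
qed

lemma prob_outlier: "NN.prob {z \<in> space NN. \<not> inl z} \<le> 2 * \<eta>"
proof -
  have "NN.prob {z \<in> space NN. \<not> inl z} = NN.prob ({z \<in> space NN. fst (fst z)} \<union> {z \<in> space NN. fst (snd z)})"
    by (rule arg_cong[where f = NN.prob]) (auto simp: inl_def)
  also have "\<dots> \<le> NN.prob {z \<in> space NN. fst (fst z)} + NN.prob {z \<in> space NN. fst (snd z)}"
    by (rule measure_Un_le) measurable
  finally show ?thesis by (simp add: prob_coin)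
qed

text \<open>If the difference exceeds \<open>2 * t * sd v\<close>, one of the two centred
  projections exceeds \<open>t * sd v\<close>.\<close>

lemma tail_NN:
  assumes t: "0 \<le> t"
  shows "NN.prob {z \<in> space NN. 4 * t\<^sup>2 * s2 v < (U v z)\<^sup>2} \<le> 2 * exp (- (t powr \<gamma>))"
proof -
  let ?A = "{x \<in> space D. t * sd v < \<bar>Z v x\<bar>}"
  have A: "?A \<in> sets D" by measurable
  have p: "NN.prob {z \<in> space NN. t * sd v < \<bar>Z v (snd (fst z))\<bar>} = D.prob ?A"
    "NN.prob {z \<in> space NN. t * sd v < \<bar>Z v (snd (snd z))\<bar>} = D.prob ?A"
  proof -
    have "(\<lambda>z. snd (fst z)) -` ?A \<inter> space NN = {z \<in> space NN. t * sd v < \<bar>Z v (snd (fst z))\<bar>}"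
      "(\<lambda>z. snd (snd z)) -` ?A \<inter> space NN = {z \<in> space NN. t * sd v < \<bar>Z v (snd (snd z))\<bar>}"
      using measurable_space[OF measurable_draws(1)] measurable_space[OF measurable_draws(2)] by auto
    then show "NN.prob {z \<in> space NN. t * sd v < \<bar>Z v (snd (fst z))\<bar>} = D.prob ?A"
      "NN.prob {z \<in> space NN. t * sd v < \<bar>Z v (snd (snd z))\<bar>} = D.prob ?A"
      using measure_distr[OF measurable_draws(1) A] measure_distr[OF measurable_draws(2) A]
      unfolding distr_draws by simp_all
  qed
  have "NN.prob {z \<in> space NN. 4 * t\<^sup>2 * s2 v < (U v z)\<^sup>2} \<le>
      NN.prob ({z \<in> space NN. t * sd v < \<bar>Z v (snd (fst z))\<bar>} \<union> {z \<in> space NN. t * sd v < \<bar>Z v (snd (snd z))\<bar>})"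
  proof (intro NN.finite_measure_mono subsetI)
    fix z assume z: "z \<in> {z \<in> space NN. 4 * t\<^sup>2 * s2 v < (U v z)\<^sup>2}"
    have "(2 * (t * sd v))\<^sup>2 < (U v z)\<^sup>2" using z by (simp add: power_mult_distrib sd_square mult.assoc)
    then have "2 * (t * sd v) < \<bar>U v z\<bar>"
      using power2_less_imp_less[of "2 * (t * sd v)" "\<bar>U v z\<bar>"] by simp
    then show "z \<in> {z \<in> space NN. t * sd v < \<bar>Z v (snd (fst z))\<bar>} \<union> {z \<in> space NN. t * sd v < \<bar>Z v (snd (snd z))\<bar>}"
      using z by (auto simp: U_eq)
  qed measurable
  also have "\<dots> \<le> NN.prob {z \<in> space NN. t * sd v < \<bar>Z v (snd (fst z))\<bar>} + NN.prob {z \<in> space NN. t * sd v < \<bar>Z v (snd (snd z))\<bar>}"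
    by (rule measure_Un_le) measurable
  also have "\<dots> \<le> 2 * exp (- (t powr \<gamma>))" unfolding p using tail_D[OF t, of v] by simp
  finally show ?thesis .
qed

abbreviation \<kappa> :: "nat \<Rightarrow> real" where "\<kappa> \<equiv> moment_const \<gamma>"

lemmas \<kappa>_ge_1 = moment_const_ge_1[OF \<gamma>]

lemma U_moment:
  assumes q: "1 \<le> q"
  shows "integrable NN (\<lambda>z. (U v z) ^ (2 * q))" "NN.expectation (\<lambda>z. (U v z) ^ (2 * q)) \<le> \<kappa> q * s2 v ^ q"
proof -
  let ?K = "tail_moment \<gamma> (2 * q) * sd v ^ (2 * q)"
  have K0: "0 \<le> ?K" using tail_moment_ge_1[OF \<gamma>, of "2 * q"] sd_nonneg by simp
  have D: "(\<integral>\<^sup>+x. ennreal (\<bar>Z v x\<bar> ^ (2 * q)) \<partial>D) \<le> ennreal ?K"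
    using q by (intro D.moment_from_tail \<gamma> sd_nonneg tail_D) auto
  have M: "(\<lambda>x. ennreal (\<bar>Z v x\<bar> ^ (2 * q))) \<in> borel_measurable (distr NN D T)" for T
    by (subst measurable_distr_eq1) measurable
  have d: "(\<integral>\<^sup>+z. ennreal (\<bar>Z v (snd (fst z))\<bar> ^ (2 * q)) \<partial>NN) \<le> ennreal ?K"
    "(\<integral>\<^sup>+z. ennreal (\<bar>Z v (snd (snd z))\<bar> ^ (2 * q)) \<partial>NN) \<le> ennreal ?K"
    using D nn_integral_distr[OF measurable_draws(1) M]
      nn_integral_distr[OF measurable_draws(2) M]
    unfolding distr_draws by simp_all
  have "(\<integral>\<^sup>+z. ennreal (norm ((U v z) ^ (2 * q))) \<partial>NN) \<le>
      (\<integral>\<^sup>+z. 2 ^ (2 * q) * (ennreal (\<bar>Z v (snd (fst z))\<bar> ^ (2 * q)) + ennreal (\<bar>Z v (snd (snd z))\<bar> ^ (2 * q))) \<partial>NN)"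
  proof (intro nn_integral_mono)
    fix z :: "(bool \<times> (nat \<Rightarrow> real)) \<times> (bool \<times> (nat \<Rightarrow> real))"
    let ?a = "\<bar>Z v (snd (fst z))\<bar>" and ?b = "\<bar>Z v (snd (snd z))\<bar>"
    have "\<bar>U v z\<bar> ^ (2 * q) \<le> (2 * max ?a ?b) ^ (2 * q)" by (intro power_mono) (auto simp: U_eq)
    also have "\<dots> \<le> 2 ^ (2 * q) * (?a ^ (2 * q) + ?b ^ (2 * q))"
      by (auto simp: power_mult_distrib max_def)
    finally have "ennreal (\<bar>U v z\<bar> ^ (2 * q)) \<le> ennreal (2 ^ (2 * q) * (?a ^ (2 * q) + ?b ^ (2 * q)))"
      by (rule ennreal_leI)
    then show "ennreal (norm ((U v z) ^ (2 * q))) \<le> 2 ^ (2 * q) * (ennreal (?a ^ (2 * q)) + ennreal (?b ^ (2 * q)))"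
      by (simp add: power_abs ennreal_mult ennreal_power[symmetric])
  qed
  also have "\<dots> = 2 ^ (2 * q) * ((\<integral>\<^sup>+z. ennreal (\<bar>Z v (snd (fst z))\<bar> ^ (2 * q)) \<partial>NN) + (\<integral>\<^sup>+z. ennreal (\<bar>Z v (snd (snd z))\<bar> ^ (2 * q)) \<partial>NN))"
    by (subst nn_integral_cmult, measurable, subst nn_integral_add) measurable
  also have "\<dots> \<le> 2 ^ (2 * q) * (ennreal ?K + ennreal ?K)"
    using d by (intro mult_left_mono add_mono) auto
  also have "\<dots> = ennreal (2 ^ (2 * q) * (?K + ?K))"
    using K0 by (simp add: ennreal_mult ennreal_power[symmetric] mult_2[symmetric])
  also have "2 ^ (2 * q) * (?K + ?K) = \<kappa> q * s2 v ^ q"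
    by (simp add: moment_const_def sd_square[symmetric] power_mult)
  finally have nn: "(\<integral>\<^sup>+z. ennreal (norm ((U v z) ^ (2 * q))) \<partial>NN) \<le> ennreal (\<kappa> q * s2 v ^ q)" .
  show int: "integrable NN (\<lambda>z. (U v z) ^ (2 * q))"
    by (rule integrableI_bounded) (use nn in \<open>auto intro: le_less_trans\<close>)
  have "ennreal (NN.expectation (\<lambda>z. (U v z) ^ (2 * q))) = (\<integral>\<^sup>+z. ennreal ((U v z) ^ (2 * q)) \<partial>NN)"
    by (rule nn_integral_eq_integral[symmetric]) (use int in \<open>auto simp: power_mult\<close>)
  also have "\<dots> \<le> ennreal (\<kappa> q * s2 v ^ q)" using nn by (simp add: power_abs power_mult)
  finally show "NN.expectation (\<lambda>z. (U v z) ^ (2 * q)) \<le> \<kappa> q * s2 v ^ q"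
    using \<kappa>_ge_1[of q] s2_nonneg[of v] by (subst (asm) ennreal_le_iff) auto
qed

lemma integrable_U2: "integrable NN (\<lambda>z. (U v z)\<^sup>2)"
  using U_moment(1)[of 1 v] by simp

text \<open>Expanding the product leaves two equal terms, each with one factor
  \<open>1 - \<eta>\<close> per coin; the mixed terms vanish because the two draws are independent
  and centred.\<close>

lemma inl_covariance:
  assumes a: "a < n" and c: "c < n"
  defines "g \<equiv> \<lambda>z. of_bool (inl z) * (U (unit_vec a) z * U (unit_vec c) z)"
  shows "integrable NN g" "NN.expectation g = 2 * (1 - \<eta>)\<^sup>2 * S a c"
proof -
  define e where "e = (\<lambda>c. of_bool (\<not> c) :: real)"
  define z where "z = (\<lambda>k x. x k - \<mu> k :: real)"
  have Zu: "Z (unit_vec k) x = z k x" if "k < n" for k x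
    using that by (simp add: Z_def z_def unit_vec_def if_distrib[of "\<lambda>y. _ * y"] sum.delta cong: if_cong)
  have e: "integrable (measure_pmf (bernoulli_pmf \<eta>)) e" "(\<integral>c. e c \<partial>measure_pmf (bernoulli_pmf \<eta>)) = 1 - \<eta>"
    using \<eta> by (auto simp: e_def intro: integrable_measure_pmf_finite)
  have z: "integrable D (z k)" "(\<integral>x. z k x \<partial>D) = 0" if "k < n" for k
    using mean[OF that] by (auto simp: z_def has_bochner_integral_iff D.prob_space)
  have zz: "integrable D (\<lambda>x. z a x * z c x)" "(\<integral>x. z a x * z c x \<partial>D) = S a c"
    using cov[OF a c] by (auto simp: z_def has_bochner_integral_iff)
  note ps = measure_pmf.prob_space_axioms D.prob_space_axioms
  note N1 = integrable_pair_mult[OF ps e(1), folded N_def] and N2 = integral_pair_mult[OF ps e(1), folded N_def]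
  have F0: "integrable N (\<lambda>y. e (fst y) * 1)" "(\<integral>y. e (fst y) * 1 \<partial>N) = 1 - \<eta>"
    using N1[of "\<lambda>_. 1"] N2[of "\<lambda>_. 1"] e by (simp_all add: D.prob_space)
  have F1: "integrable N (\<lambda>y. e (fst y) * z k (snd y))" "(\<integral>y. e (fst y) * z k (snd y) \<partial>N) = 0" if "k < n" for k
    using N1[OF z(1)[OF that]] N2[OF z(1)[OF that]] z(2)[OF that] by simp_all
  have F2: "integrable N (\<lambda>y. e (fst y) * (z a (snd y) * z c (snd y)))"
    "(\<integral>y. e (fst y) * (z a (snd y) * z c (snd y)) \<partial>N) = (1 - \<eta>) * S a c"
    using N1[OF zz(1)] N2[OF zz(1)] zz(2) e(2) by simp_all
  note pN = N.prob_space_axioms N.prob_space_axioms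
  note M = integrable_pair_mult[OF pN, folded NN_def] and I = integral_pair_mult[OF pN, folded NN_def]
  have g: "g = (\<lambda>y. (e (fst (fst y)) * (z a (snd (fst y)) * z c (snd (fst y)))) * (e (fst (snd y)) * 1)
      - (e (fst (fst y)) * z a (snd (fst y))) * (e (fst (snd y)) * z c (snd (snd y)))
      - (e (fst (fst y)) * z c (snd (fst y))) * (e (fst (snd y)) * z a (snd (snd y)))
      + (e (fst (fst y)) * 1) * (e (fst (snd y)) * (z a (snd (snd y)) * z c (snd (snd y)))))"
    unfolding g_def U_eq Zu[OF a] Zu[OF c] by (auto simp: fun_eq_iff e_def inl_def algebra_simps)
  note ints = M[OF F2(1) F0(1)] M[OF F1(1)[OF a] F1(1)[OF c]] M[OF F1(1)[OF c] F1(1)[OF a]] M[OF F0(1) F2(1)]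
  note vals = I[OF F2(1) F0(1)] I[OF F1(1)[OF a] F1(1)[OF c]] I[OF F1(1)[OF c] F1(1)[OF a]] I[OF F0(1) F2(1)]
  show "integrable NN g"
    unfolding g by (intro Bochner_Integration.integrable_add Bochner_Integration.integrable_diff ints)
  have "NN.expectation g = (1 - \<eta>) * S a c * (1 - \<eta>) - 0 * 0 - 0 * 0 + (1 - \<eta>) * ((1 - \<eta>) * S a c)"
    unfolding g using ints vals F0(2) F1(2)[OF a] F1(2)[OF c] F2(2)
    by (simp only: Bochner_Integration.integral_add Bochner_Integration.integral_diff
      Bochner_Integration.integrable_add Bochner_Integration.integrable_diff)
  then show "NN.expectation g = 2 * (1 - \<eta>)\<^sup>2 * S a c" by (simp add: power2_eq_square algebra_simps)
qed

lemma U_expand: "(U v z)\<^sup>2 = (\<Sum>a<n. \<Sum>c<n. v a * v c * (U (unit_vec a) z * U (unit_vec c) z))"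
proof -
  have "U v z = (\<Sum>a<n. v a * U (unit_vec a) z)"
    by (simp add: U_def dot_unit_vec) (simp add: dot_def)
  then show ?thesis by (simp add: power2_eq_square sum_product mult_ac)
qed

lemma inl_variance:
  shows "integrable NN (\<lambda>z. of_bool (inl z) * (U v z)\<^sup>2)"
    "NN.expectation (\<lambda>z. of_bool (inl z) * (U v z)\<^sup>2) = 2 * (1 - \<eta>)\<^sup>2 * s2 v"
proof -
  have eq: "of_bool (inl z) * (U v z)\<^sup>2 = (\<Sum>a<n. \<Sum>c<n. v a * v c * (of_bool (inl z) * (U (unit_vec a) z * U (unit_vec c) z)))" for z
    by (simp add: U_expand sum_distrib_left mult_ac)
  have h: "has_bochner_integral NN (\<lambda>z. of_bool (inl z) * (U v z)\<^sup>2) (\<Sum>a<n. \<Sum>c<n. v a * v c * (2 * (1 - \<eta>)\<^sup>2 * S a c))"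
    unfolding eq using inl_covariance
    by (intro has_bochner_integral_sum has_bochner_integral_mult_right) (auto simp: has_bochner_integral_iff)
  have "(\<Sum>a<n. \<Sum>c<n. v a * v c * (2 * (1 - \<eta>)\<^sup>2 * S a c)) = 2 * (1 - \<eta>)\<^sup>2 * s2 v"
    by (simp add: s2_eq sum_distrib_left mult_ac)
  then show "integrable NN (\<lambda>z. of_bool (inl z) * (U v z)\<^sup>2)"
    "NN.expectation (\<lambda>z. of_bool (inl z) * (U v z)\<^sup>2) = 2 * (1 - \<eta>)\<^sup>2 * s2 v"
    using h by (auto simp: has_bochner_integral_iff)
qed

text \<open>Anti-concentration by the second moment method: a mean-square contribution below \<open>s2 v\<close>
  is too small, and the fourth moment controls the rest.\<close>

lemma prob_large:
  assumes "\<eta> \<le> 1/100"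
  shows "1 / (2 * \<kappa> 2) \<le> NN.prob {z \<in> space NN. inl z \<and> s2 v \<le> (U v z)\<^sup>2}"
proof (cases "s2 v = 0")
  case True
  have "1 - 2 * \<eta> \<le> NN.prob {z \<in> space NN. inl z}"
    using prob_outlier NN.prob_neg[of inl] by simp
  moreover have "1 / (2 * \<kappa> 2) \<le> 1 / 2" using \<kappa>_ge_1[of 2] by (intro divide_left_mono) auto
  ultimately show ?thesis using True assms by simp
next
  case False
  then have s: "s2 v > 0" using s2_nonneg[of v] by linarith
  let ?B = "{z \<in> space NN. inl z \<and> s2 v \<le> (U v z)\<^sup>2}"
  have B: "?B \<in> sets NN" by measurable
  have k: "1 \<le> \<kappa> 2" by (rule \<kappa>_ge_1)
  have amgm: "x \<le> x\<^sup>2 / (4 * a) + a" if "0 < a" for x a :: real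
  proof -
    have "0 \<le> (x - 2 * a)\<^sup>2" by simp
    then have "4 * a * x \<le> x\<^sup>2 + 4 * a * a" by (simp add: power2_eq_square algebra_simps)
    then show ?thesis using that by (simp add: field_simps)
  qed
  have int4: "integrable NN (\<lambda>z. (U v z) ^ 4)" "NN.expectation (\<lambda>z. (U v z) ^ 4) \<le> \<kappa> 2 * (s2 v)\<^sup>2"
    using U_moment[of 2 v] by simp_all
  have "2 * (1 - \<eta>)\<^sup>2 * s2 v = NN.expectation (\<lambda>z. of_bool (inl z) * (U v z)\<^sup>2)"
    by (simp add: inl_variance)
  \<comment> \<open>Outside \<open>?B\<close> the square contributes at most \<open>s2 v\<close>. On
    \<open>?B\<close>, \<open>amgm\<close> with \<open>a = \<kappa> 2 * s2 v\<close> trades it for a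
    fourth moment term of expectation at most \<open>s2 v / 4\<close> plus a multiple of the
    probability; 5/4 stays well below \<open>2 * (1 - \<eta>)\<^sup>2\<close>.\<close>
  also have "\<dots> \<le> NN.expectation (\<lambda>z. s2 v + ((U v z) ^ 4 / (4 * \<kappa> 2 * s2 v) + \<kappa> 2 * s2 v * indicator ?B z))"
  proof (rule integral_mono)
    fix z assume z: "z \<in> space NN"
    let ?x = "(U v z)\<^sup>2"
    have x4: "(U v z) ^ 4 = ?x\<^sup>2" by simp
    show "of_bool (inl z) * (U v z)\<^sup>2 \<le> s2 v + ((U v z) ^ 4 / (4 * \<kappa> 2 * s2 v) + \<kappa> 2 * s2 v * indicator ?B z)"
    proof (cases "z \<in> ?B")
      case True
      have "?x \<le> ?x\<^sup>2 / (4 * (\<kappa> 2 * s2 v)) + \<kappa> 2 * s2 v" using k s by (intro amgm) simp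
      moreover have "of_bool (inl z) = (1 :: real)" "indicator ?B z = (1 :: real)" using True by auto
      ultimately show ?thesis using s unfolding x4 by (simp only: mult_1_left mult_1_right mult.assoc)
    next
      case False
      then have "of_bool (inl z) * ?x \<le> s2 v" using z s by auto
      moreover have "0 \<le> (U v z) ^ 4 / (4 * \<kappa> 2 * s2 v)" using k s by (intro divide_nonneg_nonneg) auto
      ultimately show ?thesis using False by simp
    qed
  qed (use inl_variance int4 B in \<open>auto simp: NN.emeasure_eq_measure\<close>)
  also have "\<dots> = s2 v + (NN.expectation (\<lambda>z. (U v z) ^ 4) / (4 * \<kappa> 2 * s2 v) + \<kappa> 2 * s2 v * NN.prob ?B)"
    using int4 B by (simp add: NN.emeasure_eq_measure NN.prob_space)
  also have "\<dots> \<le> s2 v + ((\<kappa> 2 * (s2 v)\<^sup>2) / (4 * \<kappa> 2 * s2 v) + \<kappa> 2 * s2 v * NN.prob ?B)"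
    using int4(2) k s by (intro add_mono divide_right_mono order_refl) auto
  also have "\<dots> = s2 v * (5/4 + \<kappa> 2 * NN.prob ?B)"
  proof -
    have "(\<kappa> 2 * (s2 v)\<^sup>2) / (4 * \<kappa> 2 * s2 v) = s2 v / 4" using k s by (simp add: power2_eq_square)
    then show ?thesis by (simp add: algebra_simps)
  qed
  finally have "2 * (1 - \<eta>)\<^sup>2 * s2 v \<le> s2 v * (5/4 + \<kappa> 2 * NN.prob ?B)" .
  then have "2 * (1 - \<eta>)\<^sup>2 \<le> 5/4 + \<kappa> 2 * NN.prob ?B"
    using s by (simp add: mult.commute[of "s2 v"] mult_le_cancel_right)
  moreover have "(99/100)\<^sup>2 \<le> (1 - \<eta>)\<^sup>2" using assms \<eta> by (intro power_mono) auto
  ultimately have "1/2 \<le> \<kappa> 2 * NN.prob ?B" by (simp add: power2_eq_square)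
  then show ?thesis using k by (simp add: field_simps)
qed

lemma prob_too_large:
  assumes "0 < q"
  shows "NN.prob {z \<in> space NN. \<not> inl z \<or> \<kappa> 1 / q * s2 v < (U v z)\<^sup>2} \<le> 2 * \<eta> + q"
proof -
  have "NN.prob {z \<in> space NN. \<not> inl z \<or> \<kappa> 1 / q * s2 v < (U v z)\<^sup>2} =
      NN.prob ({z \<in> space NN. \<not> inl z} \<union> {z \<in> space NN. \<kappa> 1 / q * s2 v < (U v z)\<^sup>2})"
    by (rule arg_cong[where f = NN.prob]) auto
  also have "\<dots> \<le> NN.prob {z \<in> space NN. \<not> inl z} + NN.prob {z \<in> space NN. \<kappa> 1 / q * s2 v < (U v z)\<^sup>2}"
    by (rule measure_Un_le) measurable
  also have "NN.prob {z \<in> space NN. \<kappa> 1 / q * s2 v < (U v z)\<^sup>2} \<le> q"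
    by (rule NN.markov_strict)
      (use U_moment(2)[of 1 v] integrable_U2 assms \<kappa>_ge_1[of 1] s2_nonneg in auto)
  finally show ?thesis using prob_outlier by simp
qed

end


section \<open>The good event\<close>


text \<open>\<open>\<rho>\<close> is a quarter of the probability in \<open>prob_large\<close>, and
  \<open>\<eta> \<le> \<rho> / 16\<close> keeps the probability of an outlier pair below
  \<open>\<rho> / 8\<close>: the rank level lies safely between what inliers guarantee and what
  outliers can fake. \<open>s\<close> will be the operator norm.\<close>

locale noisy_sample = noisy +
  fixes h r :: nat and s \<rho> :: real
  assumes rh: "r < h" and s: "0 \<le> s" "\<And>v. s2 v \<le> s * dot n v v"
    and \<rho>_def: "\<rho> = 1 / (8 * \<kappa> 2)" and \<eta>\<rho>: "\<eta> \<le> \<rho> / 16" "\<eta> \<le> 1/100"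
begin

definition \<Omega> :: "(nat \<Rightarrow> bool \<times> (nat \<Rightarrow> real)) measure" where
  "\<Omega> = PiM {..<2 * h} (\<lambda>_. N)"

sublocale \<Omega>: prob_space \<Omega>
  unfolding \<Omega>_def by (rule prob_space_PiM) (rule N.prob_space_axioms)

lemma \<Omega>_noise_space: "\<Omega> = noise_space (2 * h) \<eta> D"
  by (simp add: \<Omega>_def noise_space_def N_def)

definition W :: "nat \<Rightarrow> (nat \<Rightarrow> bool \<times> (nat \<Rightarrow> real)) \<Rightarrow> (bool \<times> (nat \<Rightarrow> real)) \<times> (bool \<times> (nat \<Rightarrow> real))" where
  "W i \<omega> = (\<omega> (2 * i), \<omega> (2 * i + 1))"

lemma measurable_coord_\<Omega>: "i < 2 * h \<Longrightarrow> (\<lambda>\<omega>. \<omega> i) \<in> measurable \<Omega> N"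
  unfolding \<Omega>_def by (rule measurable_component_singleton) simp

lemma measurable_W [measurable]: "i < h \<Longrightarrow> W i \<in> measurable \<Omega> NN"
  unfolding W_def[abs_def] NN_def by (intro measurable_Pair measurable_coord_\<Omega>) auto

lemma indep_coords: "\<Omega>.indep_vars (\<lambda>_. N) (\<lambda>i \<omega>. \<omega> i) {..<2 * h}"
proof -
  have "distr \<Omega> (PiM {..<2 * h} (\<lambda>_. N)) (\<lambda>x. \<lambda>i\<in>{..<2 * h}. x i) = distr \<Omega> \<Omega> (\<lambda>x. x)"
    by (intro distr_cong) (auto simp: \<Omega>_def space_PiM restrict_def PiE_def extensional_def fun_eq_iff)
  also have "\<dots> = PiM {..<2 * h} (\<lambda>i. distr \<Omega> N (\<lambda>\<omega>. \<omega> i))"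
    unfolding distr_id \<Omega>_def
    by (intro PiM_cong refl distr_PiM_component[symmetric]) (auto intro: N.prob_space_axioms)
  finally have d: "distr \<Omega> (PiM {..<2 * h} (\<lambda>_. N)) (\<lambda>x. \<lambda>i\<in>{..<2 * h}. x i) =
      PiM {..<2 * h} (\<lambda>i. distr \<Omega> N (\<lambda>\<omega>. \<omega> i))" .
  have "{..<2 * h} \<noteq> {}" using rh by (simp add: lessThan_empty_iff)
  then show ?thesis
    using measurable_coord_\<Omega> d by (subst \<Omega>.indep_vars_iff_distr_eq_PiM') simp_all
qed

lemma indep_W: "\<Omega>.indep_vars (\<lambda>_. NN) W {..<h}"
proof -
  have "\<Omega>.indep_vars (\<lambda>j. PiM {2 * j, 2 * j + 1} (\<lambda>_. N)) (\<lambda>j \<omega>. restrict (\<lambda>i. \<omega> i) {2 * j, 2 * j + 1}) {..<h}"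
  proof (rule \<Omega>.indep_vars_restrict[OF indep_coords])
    show "disjoint_family_on (\<lambda>j. {2 * j, 2 * j + 1}) {..<h}"
      unfolding disjoint_family_on_def by (auto; presburger)
  qed auto
  from \<Omega>.indep_vars_compose2[OF this, of "\<lambda>j z. (z (2 * j), z (2 * j + 1))" "\<lambda>_. NN"]
  have "\<Omega>.indep_vars (\<lambda>_. NN) (\<lambda>j \<omega>. (restrict (\<lambda>i. \<omega> i) {2 * j, 2 * j + 1} (2 * j), restrict (\<lambda>i. \<omega> i) {2 * j, 2 * j + 1} (2 * j + 1))) {..<h}"
    unfolding NN_def by (auto intro!: measurable_Pair measurable_component_singleton)
  then show ?thesis by (simp add: W_def[abs_def])
qed

lemma distr_W: "i < h \<Longrightarrow> distr \<Omega> NN (W i) = NN"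
proof -
  assume i: "i < h"
  have "\<Omega>.indep_var (PiM {2 * i} (\<lambda>_. N)) (\<lambda>\<omega>. restrict (\<lambda>i. \<omega> i) {2 * i})
      (PiM {2 * i + 1} (\<lambda>_. N)) (\<lambda>\<omega>. restrict (\<lambda>i. \<omega> i) {2 * i + 1})"
    using i by (intro \<Omega>.indep_var_restrict[OF indep_coords]) auto
  from \<Omega>.indep_var_compose[OF this, of "\<lambda>z. z (2 * i)" N "\<lambda>z. z (2 * i + 1)" N]
  have "\<Omega>.indep_var N (\<lambda>\<omega>. \<omega> (2 * i)) N (\<lambda>\<omega>. \<omega> (2 * i + 1))"
    by (auto simp: comp_def intro!: measurable_component_singleton)
  then have "distr \<Omega> (N \<Otimes>\<^sub>M N) (\<lambda>\<omega>. (\<omega> (2 * i), \<omega> (2 * i + 1))) = distr \<Omega> N (\<lambda>\<omega>. \<omega> (2 * i)) \<Otimes>\<^sub>M distr \<Omega> N (\<lambda>\<omega>. \<omega> (2 * i + 1))"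
    unfolding \<Omega>.indep_var_distribution_eq by simp
  moreover have "distr \<Omega> N (\<lambda>\<omega>. \<omega> (2 * i)) = N" "distr \<Omega> N (\<lambda>\<omega>. \<omega> (2 * i + 1)) = N"
    unfolding \<Omega>_def using i by (auto intro!: distr_PiM_component N.prob_space_axioms)
  ultimately show "distr \<Omega> NN (W i) = NN" by (simp add: NN_def W_def[abs_def])
qed

lemma prob_W:
  assumes i: "i < h" and P: "Measurable.pred NN P"
  shows "\<Omega>.prob {\<omega> \<in> space \<Omega>. W i \<omega> \<in> {z \<in> space NN. P z}} = NN.prob {z \<in> space NN. P z}"
proof -
  have "{z \<in> space NN. P z} \<in> sets NN" using P by measurable
  from measure_distr[OF measurable_W[OF i] this] show ?thesis
    unfolding distr_W[OF i] by (simp add: vimage_def Int_def conj_commute)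
qed

lemma integral_W:
  fixes f :: "(bool \<times> (nat \<Rightarrow> real)) \<times> (bool \<times> (nat \<Rightarrow> real)) \<Rightarrow> real"
  assumes i: "i < h" and f: "integrable NN f"
  shows "integrable \<Omega> (\<lambda>\<omega>. f (W i \<omega>))" "\<Omega>.expectation (\<lambda>\<omega>. f (W i \<omega>)) = NN.expectation f"
  using integrable_distr[OF measurable_W[OF i], of f] integral_distr[OF measurable_W[OF i], of f]
    borel_measurable_integrable[OF f] f
  unfolding distr_W[OF i] by (simp_all add: NN_def)

definition m2 :: real where "m2 = real h - real r"

lemma m2: "m2 > 0" "real (card {r..<h}) = m2"
  using rh by (auto simp: m2_def of_nat_diff)

lemma centered_sum:
  assumes f: "f \<in> borel_measurable NN" and f2: "integrable NN (\<lambda>z. (f z)\<^sup>2)" "NN.expectation (\<lambda>z. (f z)\<^sup>2) \<le> B"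
  defines "c \<equiv> NN.expectation f"
  shows "integrable \<Omega> (\<lambda>\<omega>. (\<Sum>i\<in>{r..<h}. f (W i \<omega>) - c)\<^sup>2)"
    and "\<Omega>.expectation (\<lambda>\<omega>. (\<Sum>i\<in>{r..<h}. f (W i \<omega>) - c)\<^sup>2) \<le> m2 * B"
proof -
  have int: "integrable NN f" by (rule NN.square_integrable_imp_integrable[OF f f2(1)])
  have sq: "integrable NN (\<lambda>z. (f z - c)\<^sup>2)"
    unfolding power2_diff using int f2 by auto
  have var: "NN.expectation (\<lambda>z. (f z - c)\<^sup>2) \<le> B"
    using NN.variance_eq[OF int f2(1)] f2(2) zero_le_power2[of c] unfolding c_def by linarith
  have ind: "\<Omega>.indep_vars (\<lambda>_. borel) (\<lambda>i \<omega>. f (W i \<omega>) - c) {r..<h}"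
    using f by (intro \<Omega>.indep_vars_compose2[OF \<Omega>.indep_vars_subset[OF indep_W]]) auto
  note sm = \<Omega>.second_moment_sum[OF _ ind]
  have e1: "integrable \<Omega> (\<lambda>\<omega>. (f (W i \<omega>) - c)\<^sup>2)" "\<Omega>.expectation (\<lambda>\<omega>. (f (W i \<omega>) - c)\<^sup>2) \<le> B"
    if "i \<in> {r..<h}" for i
    using integral_W[of i "\<lambda>z. (f z - c)\<^sup>2"] sq var that by auto
  have e0: "\<Omega>.expectation (\<lambda>\<omega>. f (W i \<omega>) - c) = 0" if "i \<in> {r..<h}" for i
    using integral_W[of i f] int that by (simp add: c_def \<Omega>.prob_space)
  show "integrable \<Omega> (\<lambda>\<omega>. (\<Sum>i\<in>{r..<h}. f (W i \<omega>) - c)\<^sup>2)"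
    by (rule sm) (use e1 e0 in auto)
  have "\<Omega>.expectation (\<lambda>\<omega>. (\<Sum>i\<in>{r..<h}. f (W i \<omega>) - c)\<^sup>2) = (\<Sum>i\<in>{r..<h}. \<Omega>.expectation (\<lambda>\<omega>. (f (W i \<omega>) - c)\<^sup>2))"
    by (rule sm) (use e1 e0 in auto)
  also have "\<dots> \<le> (\<Sum>i\<in>{r..<h}. B)" using e1 by (intro sum_mono)
  finally show "\<Omega>.expectation (\<lambda>\<omega>. (\<Sum>i\<in>{r..<h}. f (W i \<omega>) - c)\<^sup>2) \<le> m2 * B" using m2 by simp
qed

definition g :: "nat \<Rightarrow> nat \<Rightarrow> (bool \<times> (nat \<Rightarrow> real)) \<times> (bool \<times> (nat \<Rightarrow> real)) \<Rightarrow> real" where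
  "g a c z = of_bool (inl z) * (U (unit_vec a) z * U (unit_vec c) z)"

lemma measurable_g [measurable]: "g a c \<in> borel_measurable NN"
  unfolding g_def[abs_def] by measurable

definition \<Delta> :: "nat \<Rightarrow> nat \<Rightarrow> (nat \<Rightarrow> bool \<times> (nat \<Rightarrow> real)) \<Rightarrow> real" where
  "\<Delta> a c \<omega> = (\<Sum>i\<in>{r..<h}. g a c (W i \<omega>) - 2 * (1 - \<eta>)\<^sup>2 * S a c)"

lemma measurable_\<Delta> [measurable]: "\<Delta> a c \<in> borel_measurable \<Omega>"
  unfolding \<Delta>_def[abs_def]
  by (intro borel_measurable_sum borel_measurable_diff measurable_compose[OF measurable_W measurable_g]) auto

text \<open>The Frobenius norm dominates the operator norm, so avoiding this single event controls
  all directions at once, with no union bound. Chebyshev over \<open>n ^ 2\<close> entries bounds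
  its probability by \<open>n ^ 2 * \<kappa> 2 / (m2 * \<eta>\<^sup>2)\<close>.\<close>

definition bad_cov :: "(nat \<Rightarrow> bool \<times> (nat \<Rightarrow> real)) set" where
  "bad_cov = {\<omega> \<in> space \<Omega>. (\<eta> * m2 * s)\<^sup>2 < (\<Sum>a<n. \<Sum>c<n. (\<Delta> a c \<omega>)\<^sup>2)}"

lemma prob_bad_cov:
  assumes q: "0 \<le> q" "(real n)\<^sup>2 * \<kappa> 2 \<le> q * (m2 * \<eta>\<^sup>2)"
  shows "bad_cov \<in> sets \<Omega>" "\<Omega>.prob bad_cov \<le> q"
proof -
  have g2: "integrable NN (\<lambda>z. (g a c z)\<^sup>2)" "NN.expectation (\<lambda>z. (g a c z)\<^sup>2) \<le> \<kappa> 2 * s\<^sup>2"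
    if "a < n" "c < n" for a c
  proof -
    have i4: "integrable NN (\<lambda>z. (U (unit_vec k) z) ^ 4)" "NN.expectation (\<lambda>z. (U (unit_vec k) z) ^ 4) \<le> \<kappa> 2 * s\<^sup>2"
      if "k < n" for k
    proof -
      have "s2 (unit_vec k) \<le> s" using s(2)[of "unit_vec k"] that by (simp add: dot_unit_vec) (simp add: unit_vec_def)
      then have "\<kappa> 2 * (s2 (unit_vec k))\<^sup>2 \<le> \<kappa> 2 * s\<^sup>2"
        using \<kappa>_ge_1[of 2] s2_nonneg by (intro mult_left_mono power_mono) auto
      then show "integrable NN (\<lambda>z. (U (unit_vec k) z) ^ 4)" "NN.expectation (\<lambda>z. (U (unit_vec k) z) ^ 4) \<le> \<kappa> 2 * s\<^sup>2"
        using U_moment[of 2 "unit_vec k"] by auto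
    qed
    have avg: "(x + y) / 2 \<le> B" if "x \<le> B" "y \<le> B" for x y B :: real
      using that by simp
    let ?b = "\<lambda>z. ((U (unit_vec a) z) ^ 4 + (U (unit_vec c) z) ^ 4) / 2"
    have b: "integrable NN ?b" using i4(1) that by auto
    have le: "(g a c z)\<^sup>2 \<le> ?b z" for z
    proof -
      have "2 * ((U (unit_vec a) z)\<^sup>2 * (U (unit_vec c) z)\<^sup>2) \<le> ((U (unit_vec a) z)\<^sup>2)\<^sup>2 + ((U (unit_vec c) z)\<^sup>2)\<^sup>2"
        using sum_squares_bound[of "(U (unit_vec a) z)\<^sup>2" "(U (unit_vec c) z)\<^sup>2"] by simp
      moreover have "(g a c z)\<^sup>2 \<le> (U (unit_vec a) z)\<^sup>2 * (U (unit_vec c) z)\<^sup>2"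
        by (simp add: g_def power_mult_distrib)
      ultimately show ?thesis by simp
    qed
    show i: "integrable NN (\<lambda>z. (g a c z)\<^sup>2)"
      by (rule Bochner_Integration.integrable_bound[OF b]) (use le in \<open>auto intro!: order_trans[OF le]\<close>)
    have "NN.expectation (\<lambda>z. (g a c z)\<^sup>2) \<le> NN.expectation ?b" by (rule integral_mono[OF i b le])
    also have "\<dots> = (NN.expectation (\<lambda>z. (U (unit_vec a) z) ^ 4) + NN.expectation (\<lambda>z. (U (unit_vec c) z) ^ 4)) / 2"
      using i4(1) that by simp
    also have "\<dots> \<le> \<kappa> 2 * s\<^sup>2"
      by (rule avg) (rule i4(2)[OF that(1)], rule i4(2)[OF that(2)])
    finally show "NN.expectation (\<lambda>z. (g a c z)\<^sup>2) \<le> \<kappa> 2 * s\<^sup>2" .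
  qed
  have d: "integrable \<Omega> (\<lambda>\<omega>. (\<Delta> a c \<omega>)\<^sup>2)" "\<Omega>.expectation (\<lambda>\<omega>. (\<Delta> a c \<omega>)\<^sup>2) \<le> m2 * (\<kappa> 2 * s\<^sup>2)"
    if ac: "a < n" "c < n" for a c
  proof -
    have "NN.expectation (g a c) = 2 * (1 - \<eta>)\<^sup>2 * S a c" unfolding g_def[abs_def] by (rule inl_covariance(2)[OF ac])
    then show "integrable \<Omega> (\<lambda>\<omega>. (\<Delta> a c \<omega>)\<^sup>2)" "\<Omega>.expectation (\<lambda>\<omega>. (\<Delta> a c \<omega>)\<^sup>2) \<le> m2 * (\<kappa> 2 * s\<^sup>2)"
      using centered_sum[OF measurable_g g2[OF ac]] by (simp_all add: \<Delta>_def)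
  qed
  show "bad_cov \<in> sets \<Omega>" unfolding bad_cov_def by measurable
  show "\<Omega>.prob bad_cov \<le> q"
    unfolding bad_cov_def
  proof (rule \<Omega>.markov_strict)
    have "\<Omega>.expectation (\<lambda>\<omega>. \<Sum>a<n. \<Sum>c<n. (\<Delta> a c \<omega>)\<^sup>2) = (\<Sum>a<n. \<Sum>c<n. \<Omega>.expectation (\<lambda>\<omega>. (\<Delta> a c \<omega>)\<^sup>2))"
      by (intro has_bochner_integral_integral_eq has_bochner_integral_sum has_bochner_integral_integrable d(1)) auto
    also have "\<dots> \<le> (\<Sum>a<n. \<Sum>c<n. m2 * (\<kappa> 2 * s\<^sup>2))" by (intro sum_mono d(2)) auto
    also have "\<dots> = ((real n)\<^sup>2 * \<kappa> 2) * (m2 * s\<^sup>2)" by (simp add: power2_eq_square)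
    also have "\<dots> \<le> (q * (m2 * \<eta>\<^sup>2)) * (m2 * s\<^sup>2)" using q m2 by (intro mult_right_mono) auto
    also have "\<dots> = q * (\<eta> * m2 * s)\<^sup>2" by (simp add: power2_eq_square mult_ac)
    finally show "\<Omega>.expectation (\<lambda>\<omega>. \<Sum>a<n. \<Sum>c<n. (\<Delta> a c \<omega>)\<^sup>2) \<le> q * (\<eta> * m2 * s)\<^sup>2" .
  qed (use q d in \<open>auto intro!: sum_nonneg Bochner_Integration.integrable_sum\<close>)
qed

lemma good_cov:
  assumes "\<omega> \<in> space \<Omega>" "\<omega> \<notin> bad_cov"
  shows "\<bar>(\<Sum>i\<in>{i\<in>{r..<h}. inl (W i \<omega>)}. (U v (W i \<omega>))\<^sup>2) - m2 * (2 * (1 - \<eta>)\<^sup>2 * s2 v)\<bar> \<le> \<eta> * m2 * s * dot n v v"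
proof -
  let ?I = "{i\<in>{r..<h}. inl (W i \<omega>)}"
  have g_sum: "(\<Sum>a<n. \<Sum>c<n. v a * v c * g a c z) = of_bool (inl z) * (U v z)\<^sup>2" for z
    by (simp add: U_expand g_def sum_distrib_left mult_ac)
  have S_sum: "(\<Sum>a<n. \<Sum>c<n. v a * v c * (2 * (1 - \<eta>)\<^sup>2 * S a c)) = 2 * (1 - \<eta>)\<^sup>2 * s2 v"
    by (simp add: s2_eq sum_distrib_left mult_ac)
  have "(\<Sum>a<n. \<Sum>c<n. v a * v c * \<Delta> a c \<omega>) =
      (\<Sum>a<n. \<Sum>c<n. \<Sum>i\<in>{r..<h}. v a * v c * g a c (W i \<omega>) - v a * v c * (2 * (1 - \<eta>)\<^sup>2 * S a c))"
    by (simp add: \<Delta>_def sum_distrib_left right_diff_distrib)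
  also have "\<dots> = (\<Sum>a<n. \<Sum>i\<in>{r..<h}. \<Sum>c<n. v a * v c * g a c (W i \<omega>) - v a * v c * (2 * (1 - \<eta>)\<^sup>2 * S a c))"
    by (rule sum.cong[OF refl]) (rule sum.swap)
  also have "\<dots> = (\<Sum>i\<in>{r..<h}. \<Sum>a<n. \<Sum>c<n. v a * v c * g a c (W i \<omega>) - v a * v c * (2 * (1 - \<eta>)\<^sup>2 * S a c))"
    by (rule sum.swap)
  also have "\<dots> = (\<Sum>i\<in>{r..<h}. of_bool (inl (W i \<omega>)) * (U v (W i \<omega>))\<^sup>2 - 2 * (1 - \<eta>)\<^sup>2 * s2 v)"
    by (simp only: sum_subtractf g_sum S_sum)
  also have "\<dots> = (\<Sum>i\<in>{r..<h}. of_bool (inl (W i \<omega>)) * (U v (W i \<omega>))\<^sup>2) - m2 * (2 * (1 - \<eta>)\<^sup>2 * s2 v)"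
    using m2(2) by (simp add: sum_subtractf)
  also have "(\<Sum>i\<in>{r..<h}. of_bool (inl (W i \<omega>)) * (U v (W i \<omega>))\<^sup>2) = (\<Sum>i\<in>?I. (U v (W i \<omega>))\<^sup>2)"
  proof -
    have "(\<Sum>i\<in>?I. (U v (W i \<omega>))\<^sup>2) = (\<Sum>i\<in>{r..<h}. if inl (W i \<omega>) then (U v (W i \<omega>))\<^sup>2 else 0)"
      by (rule sum.inter_filter) simp
    also have "\<dots> = (\<Sum>i\<in>{r..<h}. of_bool (inl (W i \<omega>)) * (U v (W i \<omega>))\<^sup>2)"
      by (intro sum.cong) auto
    finally show ?thesis by simp
  qed
  finally have eq: "(\<Sum>a<n. \<Sum>c<n. v a * v c * \<Delta> a c \<omega>) =
      (\<Sum>i\<in>?I. (U v (W i \<omega>))\<^sup>2) - m2 * (2 * (1 - \<eta>)\<^sup>2 * s2 v)" .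
  have "(\<Sum>a<n. \<Sum>c<n. v a * v c * \<Delta> a c \<omega>)\<^sup>2 = (\<Sum>(a, c)\<in>{..<n} \<times> {..<n}. (v a * v c) * \<Delta> a c \<omega>)\<^sup>2"
    by (simp add: sum.cartesian_product)
  also have "\<dots> \<le> (\<Sum>(a, c)\<in>{..<n} \<times> {..<n}. (v a * v c)\<^sup>2) * (\<Sum>(a, c)\<in>{..<n} \<times> {..<n}. (\<Delta> a c \<omega>)\<^sup>2)"
    using Cauchy_Schwarz_ineq_sum[of "\<lambda>(a, c). v a * v c" "\<lambda>(a, c). \<Delta> a c \<omega>" "{..<n} \<times> {..<n}"]
    by (simp add: case_prod_unfold)
  also have "(\<Sum>(a, c)\<in>{..<n} \<times> {..<n}. (v a * v c)\<^sup>2) = (dot n v v)\<^sup>2"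
    by (simp add: sum.cartesian_product[symmetric] dot_def power2_eq_square sum_product mult_ac)
  also have "(dot n v v)\<^sup>2 * (\<Sum>(a, c)\<in>{..<n} \<times> {..<n}. (\<Delta> a c \<omega>)\<^sup>2) \<le> (dot n v v)\<^sup>2 * (\<eta> * m2 * s)\<^sup>2"
    using assms by (intro mult_left_mono) (auto simp: bad_cov_def sum.cartesian_product[symmetric])
  finally have "(\<Sum>a<n. \<Sum>c<n. v a * v c * \<Delta> a c \<omega>)\<^sup>2 \<le> (\<eta> * m2 * s * dot n v v)\<^sup>2"
    by (simp add: power_mult_distrib mult_ac)
  then show ?thesis unfolding eq
    using \<eta> m2 s dot_self_nonneg[of n v] by (simp add: abs_le_square_iff[symmetric])
qed

text \<open>Excluded only for the one direction that nearly attains the operator norm. Chebyshev for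
  fourth powers uses eighth moments, hence \<open>\<kappa> 4\<close>.\<close>

definition bad_fourth :: "(nat \<Rightarrow> real) \<Rightarrow> (nat \<Rightarrow> bool \<times> (nat \<Rightarrow> real)) set" where
  "bad_fourth v = {\<omega> \<in> space \<Omega>. (m2 * (s2 v)\<^sup>2)\<^sup>2 < (\<Sum>i\<in>{r..<h}. (U v (W i \<omega>)) ^ 4 - NN.expectation (\<lambda>z. (U v z) ^ 4))\<^sup>2}"

lemma prob_bad_fourth:
  shows "bad_fourth v \<in> sets \<Omega>" "\<Omega>.prob (bad_fourth v) \<le> \<kappa> 4 / m2"
proof -
  show "bad_fourth v \<in> sets \<Omega>" 
  proof -
    have "(\<lambda>\<omega>. U v (W i \<omega>)) \<in> borel_measurable \<Omega>" if "i \<in> {r..<h}" for i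
      using that by (intro measurable_compose[OF measurable_W measurable_U]) auto
    then have "(\<lambda>\<omega>. (\<Sum>i\<in>{r..<h}. (U v (W i \<omega>)) ^ 4 - NN.expectation (\<lambda>z. (U v z) ^ 4))\<^sup>2) \<in> borel_measurable \<Omega>"
      by (intro borel_measurable_power borel_measurable_sum borel_measurable_diff) auto
    then show ?thesis unfolding bad_fourth_def by measurable
  qed
  have 8: "integrable NN (\<lambda>z. ((U v z) ^ 4)\<^sup>2)" "NN.expectation (\<lambda>z. ((U v z) ^ 4)\<^sup>2) \<le> \<kappa> 4 * s2 v ^ 4"
    using U_moment[of 4 v] by simp_all
  note c = centered_sum[OF _ 8]
  show "\<Omega>.prob (bad_fourth v) \<le> \<kappa> 4 / m2"
    unfolding bad_fourth_def
  proof (rule \<Omega>.markov_strict)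
    show "\<Omega>.expectation (\<lambda>\<omega>. (\<Sum>i = r..<h. U v (W i \<omega>) ^ 4 - NN.expectation (\<lambda>z. U v z ^ 4))\<^sup>2) \<le> \<kappa> 4 / m2 * (m2 * (s2 v)\<^sup>2)\<^sup>2"
      using c(2) m2 by (simp add: power_mult_distrib power2_eq_square power_numeral_reduce mult_ac)
  qed (use c m2 \<kappa>_ge_1[of 4] s2_nonneg in \<open>auto intro!: borel_measurable_integrable\<close>)
qed

lemma good_fourth:
  assumes "\<omega> \<in> space \<Omega>" "\<omega> \<notin> bad_fourth v"
  shows "(\<Sum>i\<in>{i\<in>{r..<h}. inl (W i \<omega>)}. (U v (W i \<omega>)) ^ 4) \<le> (\<kappa> 2 + 1) * (m2 * (s2 v)\<^sup>2)"
proof -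
  have "(\<Sum>i\<in>{i\<in>{r..<h}. inl (W i \<omega>)}. (U v (W i \<omega>)) ^ 4) \<le> (\<Sum>i\<in>{r..<h}. (U v (W i \<omega>)) ^ 4)"
    by (intro sum_mono2) auto
  also have "\<dots> = (\<Sum>i\<in>{r..<h}. (U v (W i \<omega>)) ^ 4 - NN.expectation (\<lambda>z. (U v z) ^ 4)) + m2 * NN.expectation (\<lambda>z. (U v z) ^ 4)"
    using m2(2) by (simp add: sum_subtractf)
  also have "\<dots> \<le> m2 * (s2 v)\<^sup>2 + m2 * (\<kappa> 2 * (s2 v)\<^sup>2)"
  proof (intro add_mono mult_left_mono)
    have "(\<Sum>i\<in>{r..<h}. (U v (W i \<omega>)) ^ 4 - NN.expectation (\<lambda>z. (U v z) ^ 4))\<^sup>2 \<le> (m2 * (s2 v)\<^sup>2)\<^sup>2"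
      using assms by (auto simp: bad_fourth_def)
    then show "(\<Sum>i\<in>{r..<h}. (U v (W i \<omega>)) ^ 4 - NN.expectation (\<lambda>z. (U v z) ^ 4)) \<le> m2 * (s2 v)\<^sup>2"
      using m2 by (rule_tac power2_le_imp_le) auto
    show "NN.expectation (\<lambda>z. (U v z) ^ 4) \<le> \<kappa> 2 * (s2 v)\<^sup>2" using U_moment(2)[of 2 v] by simp
  qed (use m2 in auto)
  finally show ?thesis by (simp add: algebra_simps)
qed

section \<open>Chernoff bounds for counts of pairs\<close>

lemma
  assumes I: "I \<subseteq> {..<h}" and P: "Measurable.pred NN P"
  shows measurable_count: "(\<lambda>\<omega>. real (card {i \<in> I. P (W i \<omega>)})) \<in> borel_measurable \<Omega>"
    and count_eq: "\<omega> \<in> space \<Omega> \<Longrightarrow> card {i \<in> I. P (W i \<omega>)} = card {i \<in> I. W i \<omega> \<in> {z \<in> space NN. P z}}"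
proof -
  have fin: "finite I" using I by (rule finite_subset) simp
  have card_eq: "real (card {i \<in> I. P (W i \<omega>)}) = (\<Sum>i\<in>I. of_bool (P (W i \<omega>)))" for \<omega>
    using fin by (simp add: of_bool_def sum.inter_filter[symmetric])
  have mP: "Measurable.pred \<Omega> (\<lambda>\<omega>. P (W i \<omega>))" if "i \<in> I" for i
    using measurable_compose[OF measurable_W P] I that by auto
  show "(\<lambda>\<omega>. real (card {i \<in> I. P (W i \<omega>)})) \<in> borel_measurable \<Omega>"
    unfolding card_eq using mP by (intro borel_measurable_sum) measurable
  assume \<omega>: "\<omega> \<in> space \<Omega>"
  have "{i \<in> I. P (W i \<omega>)} = {i \<in> I. W i \<omega> \<in> {z \<in> space NN. P z}}"
    using measurable_space[OF measurable_W \<omega>] I by blast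
  then show "card {i \<in> I. P (W i \<omega>)} = card {i \<in> I. W i \<omega> \<in> {z \<in> space NN. P z}}" by simp
qed

lemma count_ge_exp:
  assumes I: "I \<subseteq> {..<h}" and P: "Measurable.pred NN P" and p: "NN.prob {z \<in> space NN. P z} \<le> p"
  shows "{\<omega> \<in> space \<Omega>. a \<le> real (card {i \<in> I. P (W i \<omega>)})} \<in> sets \<Omega>"
    "\<Omega>.prob {\<omega> \<in> space \<Omega>. a \<le> real (card {i \<in> I. P (W i \<omega>)})} \<le> exp (2 * real (card I) * p - a)"
    "1 < K \<Longrightarrow> \<Omega>.prob {\<omega> \<in> space \<Omega>. a \<le> real (card {i \<in> I. P (W i \<omega>)})} \<le> exp (real (card I) * (K * p)) / K powr a"
proof -
  let ?A = "{\<omega> \<in> space \<Omega>. a \<le> real (card {i \<in> I. P (W i \<omega>)})}"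
  show "?A \<in> sets \<Omega>" using measurable_count[OF I P] by measurable
  have fin: "finite I" using I by (rule finite_subset) simp
  have p0: "0 \<le> p" using p measure_nonneg[of NN "{z \<in> space NN. P z}"] by linarith
  have G: "{z \<in> space NN. P z} \<in> sets NN" using P by measurable
  have le: "\<Omega>.prob ?A \<le> exp (real (card I) * ((K - 1) * p)) / K powr a" if "1 < K" for K
  proof -
    have eq: "?A = {\<omega> \<in> space \<Omega>. a \<le> real (card {i \<in> I. W i \<omega> \<in> {z \<in> space NN. P z}})}"
      by (rule Collect_cong, rule conj_cong[OF refl]) (simp only: count_eq[OF I P])
    have pr: "\<Omega>.prob {\<omega> \<in> space \<Omega>. W i \<omega> \<in> {z \<in> space NN. P z}} \<le> p" if i: "i \<in> I" for i
      using prob_W[OF _ P, of i] I i p by fastforce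
    show ?thesis unfolding eq by (rule \<Omega>.count_ge[OF fin \<Omega>.indep_vars_subset[OF indep_W I] G that pr])
  qed
  show "\<Omega>.prob ?A \<le> exp (real (card I) * (K * p)) / K powr a" if K: "1 < K" for K
  proof -
    have "exp (real (card I) * ((K - 1) * p)) / K powr a \<le> exp (real (card I) * (K * p)) / K powr a"
      using p0 by (intro divide_right_mono) (auto intro!: mult_left_mono mult_right_mono)
    then show ?thesis using le[OF K] by linarith
  qed
  have "\<Omega>.prob ?A \<le> exp (real (card I) * ((exp 1 - 1) * p)) / exp 1 powr a" by (rule le) simp
  also have "\<dots> = exp (real (card I) * ((exp 1 - 1) * p) - a)" by (simp add: exp_powr_real exp_diff)
  also have "\<dots> \<le> exp (2 * real (card I) * p - a)"
  proof -
    have "real (card I) * ((exp 1 - 1) * p) \<le> real (card I) * (2 * p)"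
      using exp_le p0 by (intro mult_left_mono mult_right_mono) auto
    then show ?thesis by simp
  qed
  finally show "\<Omega>.prob ?A \<le> exp (2 * real (card I) * p - a)" .
qed

lemma count_le_exp:
  assumes I: "I \<subseteq> {..<h}" and P: "Measurable.pred NN P" and p: "p \<le> NN.prob {z \<in> space NN. P z}"
  shows "{\<omega> \<in> space \<Omega>. real (card {i \<in> I. P (W i \<omega>)}) \<le> a} \<in> sets \<Omega>"
    "\<Omega>.prob {\<omega> \<in> space \<Omega>. real (card {i \<in> I. P (W i \<omega>)}) \<le> a} \<le> exp (a - real (card I) * (p / 2))"
proof -
  let ?A = "{\<omega> \<in> space \<Omega>. real (card {i \<in> I. P (W i \<omega>)}) \<le> a}"
  show "?A \<in> sets \<Omega>" using measurable_count[OF I P] by measurable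
  have fin: "finite I" using I by (rule finite_subset) simp
  have G: "{z \<in> space NN. P z} \<in> sets NN" using P by measurable
  have eq: "?A = {\<omega> \<in> space \<Omega>. real (card {i \<in> I. W i \<omega> \<in> {z \<in> space NN. P z}}) \<le> a}"
    by (rule Collect_cong, rule conj_cong[OF refl]) (simp only: count_eq[OF I P])
  have pr: "p \<le> \<Omega>.prob {\<omega> \<in> space \<Omega>. W i \<omega> \<in> {z \<in> space NN. P z}}" if i: "i \<in> I" for i
    using prob_W[OF _ P, of i] I i p by fastforce
  show "\<Omega>.prob ?A \<le> exp (a - real (card I) * (p / 2))"
    unfolding eq by (rule \<Omega>.count_le[OF fin \<Omega>.indep_vars_subset[OF indep_W I] G pr])
qed

text \<open>The level at which Markov's inequality for the squared difference leaves probability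
  \<open>\<rho> / 8\<close>.\<close>

definition c2 :: real where "c2 = 8 * \<kappa> 1 / \<rho>"

lemma \<rho>: "0 < \<rho>" "\<rho> \<le> 1" using \<kappa>_ge_1[of 2] by (auto simp: \<rho>_def)

definition bad_out :: "(nat \<Rightarrow> bool \<times> (nat \<Rightarrow> real)) set" where
  "bad_out = {\<omega> \<in> space \<Omega>. 6 * \<eta> * m2 \<le> real (card {i \<in> {r..<h}. \<not> inl (W i \<omega>)})}"

text \<open>Outside \<open>bad_low v\<close> and \<open>bad_high v\<close> the quantile lies between
  \<open>s2 v\<close> and \<open>c2 * s2 v\<close> for every adversary: the first event counts only
  inliers as large, the second counts every outlier as large.\<close>

definition bad_low :: "(nat \<Rightarrow> real) \<Rightarrow> (nat \<Rightarrow> bool \<times> (nat \<Rightarrow> real)) set" where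
  "bad_low v = {\<omega> \<in> space \<Omega>. real (card {i \<in> {..<r}. inl (W i \<omega>) \<and> s2 v \<le> (U v (W i \<omega>))\<^sup>2}) \<le> \<rho> * r}"

definition bad_high :: "(nat \<Rightarrow> real) \<Rightarrow> (nat \<Rightarrow> bool \<times> (nat \<Rightarrow> real)) set" where
  "bad_high v = {\<omega> \<in> space \<Omega>. \<rho> * r \<le> real (card {i \<in> {..<r}. \<not> inl (W i \<omega>) \<or> c2 * s2 v < (U v (W i \<omega>))\<^sup>2})}"

definition bad_tail :: "real \<Rightarrow> (nat \<Rightarrow> real) \<Rightarrow> (nat \<Rightarrow> bool \<times> (nat \<Rightarrow> real)) set" where
  "bad_tail T v = {\<omega> \<in> space \<Omega>. real n \<le> real (card {i \<in> {r..<h}. 4 * T\<^sup>2 * s2 v < (U v (W i \<omega>))\<^sup>2})}"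

lemma prob_bad_out: "bad_out \<in> sets \<Omega>" "\<Omega>.prob bad_out \<le> exp (- 2 * \<eta> * m2)"
proof -
  have I: "{r..<h} \<subseteq> {..<h}" by auto
  note c = count_ge_exp[OF I, of "\<lambda>z. \<not> inl z" "2 * \<eta>" "6 * \<eta> * m2"]
  show "bad_out \<in> sets \<Omega>" unfolding bad_out_def by (rule c) (use prob_outlier in auto)
  have "\<Omega>.prob bad_out \<le> exp (2 * real (card {r..<h}) * (2 * \<eta>) - 6 * \<eta> * m2)"
    unfolding bad_out_def by (rule c) (use prob_outlier in auto)
  then show "\<Omega>.prob bad_out \<le> exp (- 2 * \<eta> * m2)" unfolding m2(2) by (simp add: mult_ac)
qed

lemma prob_bad_low: "bad_low v \<in> sets \<Omega>" "\<Omega>.prob (bad_low v) \<le> exp (- (\<rho> * r))"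
proof -
  have I: "{..<r} \<subseteq> {..<h}" using rh by auto
  have p: "4 * \<rho> \<le> NN.prob {z \<in> space NN. inl z \<and> s2 v \<le> (U v z)\<^sup>2}"
    using prob_large[OF \<eta>\<rho>(2), of v] by (simp add: \<rho>_def)
  note c = count_le_exp[OF I _ p, of "\<rho> * r"]
  show "bad_low v \<in> sets \<Omega>" unfolding bad_low_def by (rule c) measurable
  have "\<Omega>.prob (bad_low v) \<le> exp (\<rho> * r - real (card {..<r}) * (4 * \<rho> / 2))"
    unfolding bad_low_def by (rule c) measurable
  then show "\<Omega>.prob (bad_low v) \<le> exp (- (\<rho> * r))" by (simp add: mult_ac)
qed

lemma prob_bad_high: "bad_high v \<in> sets \<Omega>" "\<Omega>.prob (bad_high v) \<le> exp (- (\<rho> * r / 2))"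
proof -
  have I: "{..<r} \<subseteq> {..<h}" using rh by auto
  have "c2 = \<kappa> 1 / (\<rho> / 8)" by (simp add: c2_def)
  then have p: "NN.prob {z \<in> space NN. \<not> inl z \<or> c2 * s2 v < (U v z)\<^sup>2} \<le> \<rho> / 4"
    using prob_too_large[of "\<rho> / 8" v] \<rho> \<eta>\<rho> by simp
  note c = count_ge_exp[OF I _ p, of "\<rho> * r"]
  show "bad_high v \<in> sets \<Omega>" unfolding bad_high_def by (rule c) measurable
  have "\<Omega>.prob (bad_high v) \<le> exp (2 * real (card {..<r}) * (\<rho> / 4) - \<rho> * r)"
    unfolding bad_high_def by (rule c) measurable
  then show "\<Omega>.prob (bad_high v) \<le> exp (- (\<rho> * r / 2))" by (simp add: mult_ac)
qed

text \<open>The expected count is at most \<open>m2 * p\<close>, tiny by assumption. The choice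
  \<open>K = 1 / (m2 * p)\<close> makes the exponential factor a constant, so the chance of
  \<open>n\<close> hits is about the \<open>n\<close>-th power of \<open>m2 * p\<close>; this power
  is what beats the number of grid vectors.\<close>

lemma prob_bad_tail:
  assumes T: "0 \<le> T" and p: "2 * exp (- (T powr \<gamma>)) \<le> p" "0 < p" "m2 * p < 1"
  shows "bad_tail T v \<in> sets \<Omega>" "\<Omega>.prob (bad_tail T v) \<le> 3 * (m2 * p) ^ n"
proof -
  have I: "{r..<h} \<subseteq> {..<h}" by auto
  have pr: "NN.prob {z \<in> space NN. 4 * T\<^sup>2 * s2 v < (U v z)\<^sup>2} \<le> p"
    using tail_NN[OF T, of v] p by linarith
  define K where "K = 1 / (m2 * p)"
  have K: "1 < K" using p m2 by (simp add: K_def)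
  have mP: "Measurable.pred NN (\<lambda>z. 4 * T\<^sup>2 * s2 v < (U v z)\<^sup>2)" by measurable
  note c = count_ge_exp[OF I mP pr, where a = "real n"]
  show "bad_tail T v \<in> sets \<Omega>" unfolding bad_tail_def by (rule c)
  have "\<Omega>.prob (bad_tail T v) \<le> exp (real (card {r..<h}) * (K * p)) / K powr n"
    unfolding bad_tail_def by (rule c(3)[OF K])
  also have "real (card {r..<h}) * (K * p) = 1" unfolding m2(2) using p m2 by (simp add: K_def)
  also have "exp 1 / K powr n \<le> 3 / K ^ n"
    using K exp_le by (subst powr_realpow) (auto intro: divide_right_mono)
  also have "\<dots> = 3 * (m2 * p) ^ n" by (simp add: K_def power_divide)
  finally show "\<Omega>.prob (bad_tail T v) \<le> 3 * (m2 * p) ^ n" .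
qed

lemma good_event:
  assumes q: "0 \<le> q" "(real n)\<^sup>2 * \<kappa> 2 \<le> q * (m2 * \<eta>\<^sup>2)"
    and V: "finite V" and T: "0 \<le> T" and p: "2 * exp (- (T powr \<gamma>)) \<le> p" "0 < p" "m2 * p < 1"
  shows "\<exists>E\<in>sets \<Omega>. 1 - (q + \<kappa> 4 / m2 + exp (- 2 * \<eta> * m2) +
      card V * (exp (- (\<rho> * r)) + exp (- (\<rho> * r / 2)) + 3 * (m2 * p) ^ n)) \<le> \<Omega>.prob E \<and>
    (\<forall>\<omega>\<in>E. \<omega> \<in> space \<Omega> \<and> \<omega> \<notin> bad_cov \<and> \<omega> \<notin> bad_fourth x \<and> \<omega> \<notin> bad_out \<and>
      (\<forall>v\<in>V. \<omega> \<notin> bad_low v \<and> \<omega> \<notin> bad_high v \<and> \<omega> \<notin> bad_tail T v))"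
proof -
  define F where "F = (\<lambda>v. bad_low v \<union> bad_high v \<union> bad_tail T v)"
  have F: "F v \<in> sets \<Omega>" "\<Omega>.prob (F v) \<le> exp (- (\<rho> * r)) + exp (- (\<rho> * r / 2)) + 3 * (m2 * p) ^ n" for v
  proof -
    note s = prob_bad_low[of v] prob_bad_high[of v] prob_bad_tail[OF T p, of v]
    show "F v \<in> sets \<Omega>" unfolding F_def using s by auto
    have "\<Omega>.prob (F v) \<le> \<Omega>.prob (bad_low v) + \<Omega>.prob (bad_high v) + \<Omega>.prob (bad_tail T v)"
      unfolding F_def using s(1,3,5) measure_Un_le[of "bad_low v" \<Omega> "bad_high v"]
        measure_Un_le[of "bad_low v \<union> bad_high v" \<Omega> "bad_tail T v"] by auto
    then show "\<Omega>.prob (F v) \<le> exp (- (\<rho> * r)) + exp (- (\<rho> * r / 2)) + 3 * (m2 * p) ^ n"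
      using s(2,4,6) by linarith
  qed
  define B where "B = ((bad_cov \<union> bad_fourth x) \<union> bad_out) \<union> (\<Union>v\<in>V. F v)"
  have UF: "(\<Union>v\<in>V. F v) \<in> sets \<Omega>" using F(1) V by auto
  note s = prob_bad_cov[OF q] prob_bad_fourth[of x] prob_bad_out
  have B: "B \<in> sets \<Omega>" unfolding B_def using s UF by auto
  have "\<Omega>.prob (\<Union>v\<in>V. F v) \<le> (\<Sum>v\<in>V. \<Omega>.prob (F v))"
    using V F(1) by (intro measure_UNION_le) auto
  also have "\<dots> \<le> (\<Sum>v\<in>V. exp (- (\<rho> * r)) + exp (- (\<rho> * r / 2)) + 3 * (m2 * p) ^ n)"
    by (intro sum_mono F(2))
  finally have pF: "\<Omega>.prob (\<Union>v\<in>V. F v) \<le> card V * (exp (- (\<rho> * r)) + exp (- (\<rho> * r / 2)) + 3 * (m2 * p) ^ n)"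
    by simp
  have "\<Omega>.prob B \<le> \<Omega>.prob bad_cov + \<Omega>.prob (bad_fourth x) + \<Omega>.prob bad_out + \<Omega>.prob (\<Union>v\<in>V. F v)"
    unfolding B_def using s(1,3,5) UF measure_Un_le[of bad_cov \<Omega> "bad_fourth x"]
      measure_Un_le[of "bad_cov \<union> bad_fourth x" \<Omega> bad_out]
      measure_Un_le[of "(bad_cov \<union> bad_fourth x) \<union> bad_out" \<Omega> "\<Union>v\<in>V. F v"] by auto
  then have "\<Omega>.prob B \<le> q + \<kappa> 4 / m2 + exp (- 2 * \<eta> * m2) +
      card V * (exp (- (\<rho> * r)) + exp (- (\<rho> * r / 2)) + 3 * (m2 * p) ^ n)"
    using s(2,4,6) pF by linarith
  then have "1 - (q + \<kappa> 4 / m2 + exp (- 2 * \<eta> * m2) +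
      card V * (exp (- (\<rho> * r)) + exp (- (\<rho> * r / 2)) + 3 * (m2 * p) ^ n)) \<le> \<Omega>.prob (space \<Omega> - B)"
    using \<Omega>.prob_compl[OF B] by linarith
  moreover have "space \<Omega> - B \<in> sets \<Omega>" using B by auto
  ultimately show ?thesis
    by (intro bexI[of _ "space \<Omega> - B"]) (auto simp: B_def F_def)
qed

end


section \<open>Accuracy on the good event\<close>


lemma L2_set_eq_1_iff: "L2_set v {..<n} = 1 \<longleftrightarrow> dot n v v = 1"
  by (simp add: L2_set_def dot_def power2_eq_square real_sqrt_eq_1_iff)

text \<open>The operator norm is the supremum of the Rayleigh quotients: Cauchy-Schwarz for the
  form, applied to the image of \<open>v\<close> and \<open>v\<close>, bounds the length of the
  image. A maximiser up to the factor \<open>1 - \<epsilon>\<close> avoids any compactness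
  argument.\<close>

lemma (in psd_form) operator_norm:
  assumes n: "1 \<le> n"
  shows "0 \<le> operator_norm n M" "qf n M v \<le> operator_norm n M * dot n v v"
    and "0 < \<epsilon> \<Longrightarrow> \<exists>x. dot n x x = 1 \<and> (1 - \<epsilon>) * operator_norm n M \<le> qf n M x"
proof -
  let ?I = "{v. L2_set v {..<n} = 1}"
  let ?f = "\<lambda>v. L2_set (\<lambda>i. \<Sum>j<n. M i j * v j) {..<n}"
  define \<sigma> where "\<sigma> = (SUP v\<in>?I. qf n M v)"
  have I: "v \<in> ?I \<longleftrightarrow> dot n v v = 1" for v by (simp add: L2_set_eq_1_iff)
  have e: "unit_vec 0 \<in> ?I" unfolding I using n by (simp add: dot_unit_vec) (simp add: unit_vec_def)
  then have ne: "?I \<noteq> {}" by blast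
  have bdd: "bdd_above (qf n M ` ?I)"
  proof (rule bdd_aboveI2)
    show "qf n M v \<le> (\<Sum>j<n. M j j)" if "v \<in> ?I" for v
      using qf_le_trace[of v] that unfolding I by simp
  qed
  have le\<sigma>1: "qf n M v \<le> \<sigma>" if "v \<in> ?I" for v
    unfolding \<sigma>_def by (rule cSUP_upper[OF that bdd])
  have \<sigma>0: "0 \<le> \<sigma>" using le\<sigma>1[OF e] psd[of "unit_vec 0"] by linarith
  have le\<sigma>: "qf n M v \<le> \<sigma> * dot n v v" for v
    by (rule qf_le_if_unit, rule le\<sigma>1) (simp add: L2_set_eq_1_iff)
  have f: "?f v = sqrt (dot n (mv n M v) (mv n M v))" for v
    by (simp add: L2_set_def dot_def mv_def power2_eq_square)
  have f_le: "?f v \<le> \<sigma>" if "v \<in> ?I" for v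
  proof -
    let ?w = "mv n M v"
    have w0: "0 \<le> dot n ?w ?w" by (rule dot_self_nonneg)
    have "(dot n ?w ?w)\<^sup>2 \<le> qf n M ?w * qf n M v" by (rule cauchy_schwarz)
    also have "\<dots> \<le> (\<sigma> * dot n ?w ?w) * \<sigma>"
      using le\<sigma>[of ?w] le\<sigma>1[OF that] \<sigma>0 w0 psd by (intro mult_mono) auto
    finally have "dot n ?w ?w * dot n ?w ?w \<le> \<sigma>\<^sup>2 * dot n ?w ?w"
      by (simp add: power2_eq_square mult_ac)
    then have "dot n ?w ?w \<le> \<sigma>\<^sup>2"
      using w0 by (cases "dot n ?w ?w = 0") (auto simp: mult_le_cancel_right)
    then show ?thesis unfolding f using \<sigma>0 by (simp add: real_le_lsqrt)
  qed
  have qf_f: "qf n M v \<le> ?f v" if "v \<in> ?I" for v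
  proof -
    have "(qf n M v)\<^sup>2 \<le> (\<Sum>k<n. (v k)\<^sup>2) * (\<Sum>k<n. (mv n M v k)\<^sup>2)"
      unfolding qf_def dot_def by (rule Cauchy_Schwarz_ineq_sum)
    also have "\<dots> = dot n (mv n M v) (mv n M v)"
      using that unfolding I by (simp add: dot_def power2_eq_square)
    finally show ?thesis unfolding f by (rule real_le_rsqrt)
  qed
  have "operator_norm n M \<le> \<sigma>"
    unfolding operator_norm_def using ne f_le by (intro cSUP_least) auto
  moreover have "\<sigma> \<le> operator_norm n M"
    unfolding operator_norm_def \<sigma>_def
    using ne f_le qf_f by (intro cSUP_mono) (auto intro!: bdd_aboveI2)
  ultimately have eq: "operator_norm n M = \<sigma>" by simp
  show "0 \<le> operator_norm n M" "qf n M v \<le> operator_norm n M * dot n v v"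
    using \<sigma>0 le\<sigma> eq by auto
  show "\<exists>x. dot n x x = 1 \<and> (1 - \<epsilon>) * operator_norm n M \<le> qf n M x" if \<epsilon>: "0 < \<epsilon>"
  proof (cases "\<sigma> = 0")
    case True
    then show ?thesis using e psd unfolding eq I by auto
  next
    case False
    then have "(1 - \<epsilon>) * \<sigma> < \<sigma>" using \<sigma>0 \<epsilon> by (simp add: algebra_simps)
    then obtain x where "x \<in> ?I" "(1 - \<epsilon>) * \<sigma> < qf n M x"
      unfolding \<sigma>_def using less_cSUP_iff[OF ne bdd] by auto
    then show ?thesis unfolding eq I by (auto intro: less_imp_le)
  qed
qed

context noisy_sample
begin

text \<open>Extensional functions make the set finite. Arbitrary directions are compared with it
  after restriction, which changes neither \<open>s2\<close> nor \<open>U\<close>.\<close>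

definition dirs :: "nat \<Rightarrow> (nat \<Rightarrow> real) set" where
  "dirs b = PiE {..<n} (\<lambda>_. grid b)"

lemma finite_dirs: "finite (dirs b)"
  unfolding dirs_def by (intro finite_PiE finite_grid) simp

lemma card_dirs: "card (dirs b) \<le> 2 ^ (b * n)"
proof -
  have "card (dirs b) = card (grid b) ^ n" by (simp add: dirs_def card_PiE)
  also have "\<dots> \<le> (2 ^ b) ^ n" by (intro power_mono card_grid) simp
  finally show ?thesis by (simp add: power_mult)
qed

text \<open>The leading 1 is the loss of the power method. Of the 7, six come from the outlier coins
  and the near-maximiser via \<open>(1 - \<eta>) ^ 3\<close>, counted for the doubled covariance,
  and one from \<open>good_cov\<close>; the root accounts for the deleted inliers.\<close>

definition lower_const :: real where "lower_const = 1 + (7 + sqrt (\<kappa> 2 + 1)) / 2"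

text \<open>Translates the good event into \<open>filtering_good\<close>. As the quantile is at
  least \<open>s2 v\<close>, deleted inliers lie in the tail counted by \<open>bad_tail\<close>; as
  it is at most \<open>c2 * s2 v\<close>, the few outlier pairs have little energy below the
  cut-off; \<open>good_cov\<close> bounds the inliers.\<close>

lemma good_output:
  assumes n: "1 \<le> n" and b: "real n / \<eta> \<le> 2 ^ b" and r: "0 < r" and T: "1 \<le> T"
    and m2_ge: "real (Suc n * n * n) \<le> \<eta>\<^sup>2 * m2"
    and x: "dot n x x = 1" "(1 - \<eta>) * s \<le> s2 x"
    and \<omega>: "\<omega> \<in> space \<Omega>" "\<omega> \<notin> bad_cov" "\<omega> \<notin> bad_fourth x" "\<omega> \<notin> bad_out"
      "\<And>v. v \<in> dirs b \<Longrightarrow> \<omega> \<notin> bad_low v \<and> \<omega> \<notin> bad_high v \<and> \<omega> \<notin> bad_tail T v"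
    and Y: "\<And>i k. i < h \<Longrightarrow> k < n \<Longrightarrow> Y i k = noisy_samples adv \<omega> (2 * i) k - noisy_samples adv \<omega> (2 * i + 1) k"
  defines "res \<equiv> filtering.out n h r b \<rho> (4 * T\<^sup>2) Y"
  shows "(1 - lower_const * \<eta>) * s \<le> res" "res \<le> (1 + (1 + 1200 * c2) * (\<eta> * T\<^sup>2)) * s"
proof -
  interpret filtering n h r b \<rho> "4 * T\<^sup>2" Y .
  define In where "In = {i \<in> {r..<h}. inl (W i \<omega>)}"
  define Out where "Out = {i \<in> {r..<h}. \<not> inl (W i \<omega>)}"
  \<comment> \<open>Number of outliers \<open>6 * \<eta> * m2\<close>, times the cut-off factor
    \<open>4 * T\<^sup>2\<close>, times \<open>c2\<close> from the quantile.\<close>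
  define E where "E = 24 * \<eta> * T\<^sup>2 * c2"
  have T2: "1 \<le> T\<^sup>2" using T by simp
  have c2: "8 \<le> c2"
  proof -
    have "8 * 1 \<le> 8 * \<kappa> 1" using \<kappa>_ge_1[of 1] by simp
    also have "\<dots> \<le> 8 * \<kappa> 1 / \<rho>" using \<rho> \<kappa>_ge_1[of 1] by (simp add: le_divide_eq mult_left_le)
    finally show ?thesis by (simp add: c2_def)
  qed
  have sc: "score v i = (U v (W i \<omega>))\<^sup>2" if "i < h" "inl (W i \<omega>)" for v i
  proof -
    have "Y i k = snd (\<omega> (2 * i)) k - snd (\<omega> (2 * i + 1)) k" if "k < n" for k
      using Y[OF \<open>i < h\<close> that] \<open>inl (W i \<omega>)\<close> by (simp add: noisy_samples_def inl_def W_def)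
    then have "dot n v (Y i) = U v (W i \<omega>)" by (simp add: U_def W_def dot_def)
    then show ?thesis by (simp add: score_def)
  qed
  have In_h: "i < h" "inl (W i \<omega>)" if "i \<in> In" for i using that by (auto simp: In_def)
  have restr: "s2 (restrict v {..<n}) = s2 v" "U (restrict v {..<n}) = U v" for v
    by (auto simp: s2_eq U_def dot_def)
  have good: "\<rho> * r < real (card {i \<in> {..<r}. inl (W i \<omega>) \<and> s2 v \<le> (U v (W i \<omega>))\<^sup>2})"
    "real (card {i \<in> {..<r}. \<not> inl (W i \<omega>) \<or> c2 * s2 v < (U v (W i \<omega>))\<^sup>2}) < \<rho> * r"
    "real (card {i \<in> {r..<h}. 4 * T\<^sup>2 * s2 v < (U v (W i \<omega>))\<^sup>2}) < real n"
    if v: "\<And>k. k < n \<Longrightarrow> v k \<in> grid b" for v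
  proof -
    have "restrict v {..<n} \<in> dirs b" using v by (auto simp: dirs_def)
    from \<omega>(5)[OF this] \<omega>(1)
    show "\<rho> * r < real (card {i \<in> {..<r}. inl (W i \<omega>) \<and> s2 v \<le> (U v (W i \<omega>))\<^sup>2})"
      "real (card {i \<in> {..<r}. \<not> inl (W i \<omega>) \<or> c2 * s2 v < (U v (W i \<omega>))\<^sup>2}) < \<rho> * r"
      "real (card {i \<in> {r..<h}. 4 * T\<^sup>2 * s2 v < (U v (W i \<omega>))\<^sup>2}) < real n"
      unfolding bad_low_def bad_high_def bad_tail_def restr by (auto simp: not_le)
  qed
  have q_low: "s2 v \<le> quant v r" if v: "\<And>k. k < n \<Longrightarrow> v k \<in> grid b" for v
  proof (rule quant_lower[OF \<rho>(1) r])
    have "card {i \<in> {..<r}. inl (W i \<omega>) \<and> s2 v \<le> (U v (W i \<omega>))\<^sup>2} \<le> card {j. j < r \<and> s2 v \<le> score v j}"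
      using sc rh by (intro card_mono) auto
    then show "\<rho> * real r \<le> real (card {j. j < r \<and> s2 v \<le> score v j})" using good(1)[of v, OF v] by linarith
  qed
  have q_high: "quant v r \<le> c2 * s2 v" if v: "\<And>k. k < n \<Longrightarrow> v k \<in> grid b" for v
  proof (rule quant_upper)
    show "0 \<le> c2 * s2 v" using c2 s2_nonneg by simp
    have "card {j. j < r \<and> c2 * s2 v < score v j} \<le> card {i \<in> {..<r}. \<not> inl (W i \<omega>) \<or> c2 * s2 v < (U v (W i \<omega>))\<^sup>2}"
      using sc rh by (intro card_mono) auto
    then show "real (card {j. j < r \<and> c2 * s2 v < score v j}) < \<rho> * real r" using good(2)[of v, OF v] by linarith
  qed
  note cov = good_cov[OF \<omega>(1,2), folded In_def]
  have In_sum: "(\<Sum>i\<in>In. score v i) = (\<Sum>i\<in>In. (U v (W i \<omega>))\<^sup>2)" for v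
    using sc In_h by (intro sum.cong) auto
  have Out: "real (card Out) \<le> 6 * \<eta> * m2" using \<omega>(1,4) by (auto simp: bad_out_def Out_def)
  have E\<eta>: "\<eta> \<le> E"
  proof -
    have "1 * 1 \<le> T\<^sup>2 * c2" using T2 c2 by (intro mult_mono) auto
    then have "\<eta> * 1 \<le> \<eta> * (24 * (T\<^sup>2 * c2))" using \<eta> by (intro mult_left_mono) auto
    then show ?thesis by (simp add: E_def mult_ac)
  qed
  interpret filtering_good n h r b \<rho> "4 * T\<^sup>2" Y In Out \<eta> E "m2 * s"
  proof
    show "card {i \<in> In. 4 * T\<^sup>2 * quant v r < score v i} \<le> n"
      if v: "\<And>k. k < n \<Longrightarrow> v k \<in> grid b" for v
    proof -
      have "{i \<in> In. 4 * T\<^sup>2 * quant v r < score v i} \<subseteq> {i \<in> {r..<h}. 4 * T\<^sup>2 * s2 v < (U v (W i \<omega>))\<^sup>2}"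
      proof
        fix i assume i: "i \<in> {i \<in> In. 4 * T\<^sup>2 * quant v r < score v i}"
        have "4 * T\<^sup>2 * s2 v \<le> 4 * T\<^sup>2 * quant v r" using q_low[of v, OF v] by (intro mult_left_mono) auto
        also have "\<dots> < score v i" using i by blast
        also have "score v i = (U v (W i \<omega>))\<^sup>2" using i In_h[of i] by (intro sc) blast+
        finally show "i \<in> {i \<in> {r..<h}. 4 * T\<^sup>2 * s2 v < (U v (W i \<omega>))\<^sup>2}"
          using i unfolding In_def by blast
      qed
      then have "card {i \<in> In. 4 * T\<^sup>2 * quant v r < score v i} \<le> card {i \<in> {r..<h}. 4 * T\<^sup>2 * s2 v < (U v (W i \<omega>))\<^sup>2}"
        by (intro card_mono) auto
      then show ?thesis using good(3)[of v, OF v] by linarith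
    qed
    show "real (card Out) * (4 * T\<^sup>2 * quant v r) \<le> E * (m2 * s) * dot n v v"
      if v: "\<And>k. k < n \<Longrightarrow> v k \<in> grid b" for v
    proof -
      have "real (card Out) * (4 * T\<^sup>2 * quant v r) \<le> (6 * \<eta> * m2) * (4 * T\<^sup>2 * (c2 * (s * dot n v v)))"
      proof (intro mult_mono Out mult_left_mono)
        have "c2 * s2 v \<le> c2 * (s * dot n v v)" using s(2)[of v] c2 by (intro mult_left_mono) auto
        then show "quant v r \<le> c2 * (s * dot n v v)" using q_high[of v, OF v] by linarith
      qed (use \<eta> m2 quant_nonneg in auto)
      then show ?thesis by (simp add: E_def mult_ac)
    qed
    show "(\<Sum>i\<in>In. score v i) \<le> (2 + \<eta>) * (m2 * s) * dot n v v" for v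
    proof -
      have "(1 - \<eta>)\<^sup>2 \<le> 1" using \<eta> by (simp add: power_le_one)
      then have "(1 - \<eta>)\<^sup>2 * s2 v \<le> 1 * (s * dot n v v)"
        using s(2)[of v] s2_nonneg[of v] by (intro mult_mono) auto
      then have "m2 * (2 * (1 - \<eta>)\<^sup>2 * s2 v) \<le> m2 * (2 * (s * dot n v v))"
        using m2 by (intro mult_left_mono) auto
      then show ?thesis using cov[of v] unfolding In_sum by (simp add: algebra_simps)
    qed
  qed (use n \<eta> \<eta>\<rho> b rh E\<eta> m2 s in \<open>auto simp: In_def Out_def\<close>)
  have m2': "real h - real r = m2" by (simp add: m2_def)
  have "res \<le> (2 + \<eta> + 100 * E) * (m2 * s) / (2 * m2)"
    using out_le unfolding m2' res_def .
  also have "\<dots> = (1 + \<eta> / 2 + 50 * E) * s" using m2 by (simp add: field_simps)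
  \<comment> \<open>1200 is 50 times the 24 in \<open>E\<close>.\<close>
  also have "\<dots> \<le> (1 + (1 + 1200 * c2) * (\<eta> * T\<^sup>2)) * s"
  proof (intro mult_right_mono s(1))
    have "\<eta> * 1 \<le> \<eta> * T\<^sup>2" using \<eta> T2 by (intro mult_left_mono) auto
    then have "\<eta> / 2 \<le> \<eta> * T\<^sup>2" using \<eta> by simp
    then show "1 + \<eta> / 2 + 50 * E \<le> 1 + (1 + 1200 * c2) * (\<eta> * T\<^sup>2)"
      by (simp add: E_def algebra_simps)
  qed
  finally show "res \<le> (1 + (1 + 1200 * c2) * (\<eta> * T\<^sup>2)) * s" .
  define \<sigma> where "\<sigma> = sqrt (\<kappa> 2 + 1)"
  define lam where "lam = m2 * s * (2 - 7 * \<eta> - \<sigma> * \<eta>)"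
  have s2x: "s2 x \<le> s" using s(2)[of x] x by simp
  have "(1 - lower_const * \<eta>) * s \<le> (1 - \<eta>) * lam / (2 * m2)"
  proof -
    have "(1 - \<eta>) * lam / (2 * m2) = ((1 - \<eta>) * (1 - (7 + \<sigma>) / 2 * \<eta>)) * s"
      using m2 by (simp add: lam_def field_simps)
    moreover have "1 - lower_const * \<eta> \<le> (1 - \<eta>) * (1 - (7 + \<sigma>) / 2 * \<eta>)"
    proof -
      have "0 \<le> \<eta> * ((7 + \<sigma>) / 2 * \<eta>)" using \<eta> \<kappa>_ge_1[of 2] by (simp add: \<sigma>_def)
      then show ?thesis by (simp add: lower_const_def \<sigma>_def algebra_simps)
    qed
    ultimately show ?thesis using s(1) by (simp add: mult_right_mono)
  qed
  also have "\<dots> \<le> res"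
    unfolding res_def m2'[symmetric]
  proof (rule out_ge[OF x(1)])
    have "(\<Sum>i\<in>In. (score x i)\<^sup>2) = (\<Sum>i\<in>In. (U x (W i \<omega>)) ^ 4)"
      using sc In_h by (intro sum.cong) auto
    also have "\<dots> \<le> (\<kappa> 2 + 1) * (m2 * (s2 x)\<^sup>2)"
      using good_fourth[OF \<omega>(1,3)] by (simp add: In_def)
    also have "\<dots> \<le> (\<kappa> 2 + 1) * (m2 * s\<^sup>2)"
      using s2x s2_nonneg[of x] m2 \<kappa>_ge_1[of 2] by (intro mult_left_mono power_mono) auto
    finally show "(\<Sum>i\<in>In. (score x i)\<^sup>2) \<le> (\<kappa> 2 + 1) * (m2 * s\<^sup>2)" .
    have "sqrt (real (Suc n * n * n) * ((\<kappa> 2 + 1) * (m2 * s\<^sup>2))) \<le> sqrt ((\<eta>\<^sup>2 * m2) * ((\<kappa> 2 + 1) * (m2 * s\<^sup>2)))"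
      using m2_ge m2 \<kappa>_ge_1[of 2] by (intro real_sqrt_le_mono mult_right_mono) auto
    also have "(\<eta>\<^sup>2 * m2) * ((\<kappa> 2 + 1) * (m2 * s\<^sup>2)) = (\<eta> * m2 * s)\<^sup>2 * (\<kappa> 2 + 1)"
      by (simp add: power2_eq_square mult_ac)
    also have "sqrt \<dots> = \<eta> * m2 * s * \<sigma>"
      using \<eta> m2 s by (simp add: real_sqrt_mult \<sigma>_def)
    finally have sq: "sqrt (real (Suc n * n * n) * ((\<kappa> 2 + 1) * (m2 * s\<^sup>2))) \<le> \<eta> * m2 * s * \<sigma>" .
    have "(1 - 3 * \<eta>) * s \<le> (1 - \<eta>)\<^sup>2 * ((1 - \<eta>) * s)"
    proof -
      have "1 - 3 * \<eta> \<le> (1 - \<eta>) ^ 3"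
        using Bernoulli_inequality[of "- \<eta>" 3] \<eta> by simp
      then have "(1 - 3 * \<eta>) * s \<le> (1 - \<eta>) ^ 3 * s" using s(1) by (rule mult_right_mono)
      then show ?thesis by (simp add: power_numeral_reduce mult_ac)
    qed
    also have "\<dots> \<le> (1 - \<eta>)\<^sup>2 * s2 x" using x(2) by (intro mult_left_mono) auto
    finally have "2 * m2 * ((1 - 3 * \<eta>) * s) \<le> 2 * m2 * ((1 - \<eta>)\<^sup>2 * s2 x)"
      using m2 by (intro mult_left_mono) auto
    then have "m2 * s * (2 - 7 * \<eta>) \<le> (\<Sum>i\<in>In. score x i)"
      using cov[of x] x(1) unfolding In_sum by (simp add: algebra_simps abs_le_iff)
    then show "lam \<le> (\<Sum>i\<in>In. score x i) - sqrt (real (Suc n * n * n) * ((\<kappa> 2 + 1) * (m2 * s\<^sup>2)))"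
      using sq by (simp add: lam_def algebra_simps)
  qed
  finally show "(1 - lower_const * \<eta>) * s \<le> res" .
qed

end


section \<open>Choice of the constants\<close>


lemma bits_upper:
  assumes "1 \<le> n" "0 < \<eta>" "1 \<le> bits n \<eta>"
  shows "2 ^ bits n \<eta> \<le> 2 * (real n / \<eta>)"
proof -
  obtain b where b: "bits n \<eta> = Suc b" using assms(3) by (cases "bits n \<eta>") auto
  have "2 ^ b * \<eta> < real n" using bits_props(2)[OF assms(2), of b n] b by simp
  then show ?thesis using assms(2) b by (simp add: field_simps)
qed

lemma bits_le:
  assumes "1 \<le> n" "0 < \<eta>" "\<eta> < 1"
  shows "real (bits n \<eta>) \<le> 1 + 2 * ln (real n / \<eta>)"
proof (cases "bits n \<eta> = 0")
  case True
  then show ?thesis using assms by (simp add: ln_ge_zero)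
next
  case False
  have "ln (2 ^ bits n \<eta>) \<le> ln (2 * (real n / \<eta>))"
    using bits_upper[OF assms(1,2)] False assms by (intro ln_mono) auto
  then have "real (bits n \<eta>) * ln 2 \<le> ln 2 + ln (real n / \<eta>)"
  proof -
    have "ln (2 * (real n / \<eta>)) = ln 2 + ln (real n / \<eta>)" by (rule ln_mult_pos) (use assms in auto)
    then show ?thesis using \<open>ln (2 ^ bits n \<eta>) \<le> _\<close> by (simp add: ln_realpow)
  qed
  then have *: "(real (bits n \<eta>) - 1) * ln 2 \<le> ln (real n / \<eta>)" by (simp add: algebra_simps)
  have "(real (bits n \<eta>) - 1) * (1 / 2) \<le> (real (bits n \<eta>) - 1) * ln 2"
    using False ln2_ge_two_thirds by (intro mult_left_mono) auto
  then show ?thesis using * by simp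
qed

lemma level_upper:
  assumes "1 \<le> b"
  shows "2 ^ level b \<le> 2 * b"
proof (cases "level b")
  case (Suc j)
  then have "2 ^ j < b" by (intro level_props(2)) simp
  then show ?thesis using Suc by simp
qed (use assms in simp)

lemma exp_minus_le_inverse: "0 < x \<Longrightarrow> exp (- x) \<le> 1 / x" for x :: real
proof -
  assume "0 < x"
  moreover have "x \<le> exp x" using exp_ge_add_one_self[of x] by linarith
  ultimately show ?thesis by (simp add: exp_minus inverse_eq_divide frac_le)
qed

lemma exp_minus_nat_le: "exp (- real b) \<le> (1 / 2) ^ b"
proof -
  have "exp (- 1) \<le> (1 / 2 :: real)"
    using exp_ge_add_one_self[of 1] by (simp add: exp_minus inverse_eq_divide divide_le_eq)
  then have "exp (- 1) ^ b \<le> (1 / 2 :: real) ^ b" by (intro power_mono) auto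
  then show ?thesis by (simp add: exp_of_nat_mult[symmetric])
qed

text \<open>Everything is compared with \<open>u = \<eta> / n\<close>: \<open>2 ^ b\<close> lies
  between \<open>1 / u\<close> and \<open>2 / u\<close>, \<open>m2\<close> is at most
  \<open>2 * C / u ^ 3\<close>, and the exponent 6 makes \<open>p\<close> at most
  \<open>2 * u ^ 6\<close>. So \<open>2 ^ b * (m2 * p)\<close> is at most \<open>u / 50\<close>, and
  its \<open>n\<close>-th power pays for all grid vectors. For the batch,
  \<open>8 \<le> \<rho> * c\<close> puts \<open>exp (- 4 * n * b)\<close> against at most
  \<open>exp (n * b)\<close> vectors. Each of the six terms gets \<open>1 / (6 * n)\<close>.\<close>

lemma failure_bound:
  fixes n c N :: nat and \<eta> C m2 \<rho> k4 :: real
  defines "b \<equiv> bits n \<eta>" and "X \<equiv> C * (real n ^ 3 / \<eta>\<^sup>2)" and "p \<equiv> 2 * exp (- (6 * real (bits n \<eta>)))"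
  assumes n: "2 \<le> n" and \<eta>: "0 < \<eta>" "\<eta> \<le> 1 / 100" "\<eta> \<le> 1 / (400 * C)"
    and C: "3 \<le> C" "6 * k4 \<le> C" and k4: "0 \<le> k4" and m2: "X \<le> m2" "m2 \<le> X + 1"
    and c: "0 < \<rho>" "8 \<le> \<rho> * c" and N: "N \<le> 2 ^ (b * n)"
  shows "m2 * p < 1"
    and "1 / (6 * n) + k4 / m2 + exp (- 2 * \<eta> * m2) +
      N * (exp (- (\<rho> * real (c * (n * b)))) + exp (- (\<rho> * real (c * (n * b)) / 2)) + 3 * (m2 * p) ^ n) \<le> 1 / n"
    and "2 \<le> b"
proof -
  define u where "u = \<eta> / n"
  have n0: "0 < real n" "2 \<le> real n" using n by auto
  have u0: "0 < u" using \<eta> n0 by (simp add: u_def)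
  have u\<eta>: "u \<le> \<eta>" using \<eta> n0 by (simp add: u_def divide_le_eq)
  have u1: "u \<le> 1 / 200"
  proof -
    have "u \<le> \<eta> / 2" unfolding u_def using \<eta> n0 by (intro divide_left_mono) auto
    then show ?thesis using \<eta> by simp
  qed
  have nn: "n * u \<le> 1 / 100" using \<eta> n0 by (simp add: u_def)
  have b_low: "1 / u \<le> 2 ^ b"
    using bits_props(1)[of \<eta> n] \<eta> by (simp add: u_def b_def divide_le_eq)
  show b2: "2 \<le> b"
  proof (rule ccontr)
    assume "\<not> 2 \<le> b"
    then have "(2 :: real) ^ b \<le> 2 ^ 1" by (intro power_increasing) auto
    moreover have "200 \<le> 1 / u" using u0 u1 by (simp add: le_divide_eq)
    ultimately show False using b_low by simp
  qed
  have b_up: "2 ^ b \<le> 2 / u"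
    using bits_upper[of n \<eta>] b2 n \<eta> by (simp add: b_def u_def)
  have X: "X \<le> C / u ^ 3" "1 \<le> X" "6 * n * k4 \<le> X" "6 * n \<le> 2 * \<eta> * X"
  proof -
    have "1 \<le> 1 / \<eta>" using \<eta> by simp
    then have "real n ^ 3 / \<eta>\<^sup>2 * 1 \<le> real n ^ 3 / \<eta>\<^sup>2 * (1 / \<eta>)" using \<eta> by (intro mult_left_mono) auto
    then have "real n ^ 3 / \<eta>\<^sup>2 \<le> 1 / u ^ 3" by (simp add: u_def power_divide power_numeral_reduce)
    then show "X \<le> C / u ^ 3" unfolding X_def using C mult_left_mono[of "real n ^ 3 / \<eta>\<^sup>2" "1 / u ^ 3" C] by simp
    have e1: "1 \<le> 1 / \<eta>\<^sup>2" using \<eta> by (simp add: power_le_one)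
    have "real n ^ 1 \<le> real n ^ 3" using n0 by (intro power_increasing) auto
    then have n3: "real n \<le> real n ^ 3" by simp
    have nX: "real n * 1 \<le> real n ^ 3 * (1 / \<eta>\<^sup>2)" using n3 e1 n0 by (intro mult_mono) auto
    have "6 * k4 * real n \<le> C * (real n ^ 3 * (1 / \<eta>\<^sup>2))"
      using C nX n0 k4 by (intro mult_mono) auto
    then show "6 * n * k4 \<le> X" by (simp add: X_def mult_ac)
    have "3 * real n \<le> C * (real n ^ 3 * (1 / \<eta>\<^sup>2))" using C nX n0 by (intro mult_mono) auto
    then show "1 \<le> X" using n0 by (simp add: X_def)
    have "1 \<le> 1 / \<eta>" using \<eta> by simp
    then have "real n * 1 \<le> real n ^ 3 * (1 / \<eta>)" using n3 n0 by (intro mult_mono) auto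
    then have "3 * real n \<le> C * (real n ^ 3 * (1 / \<eta>))" using C n0 by (intro mult_mono) auto
    also have "\<dots> = \<eta> * X" using \<eta> by (simp add: X_def power2_eq_square)
    finally show "6 * n \<le> 2 * \<eta> * X" by (simp add: mult.commute)
  qed
  have m20: "0 < m2" using X(2) m2 by linarith
  have p: "0 < p" "p \<le> 2 * u ^ 6"
  proof -
    have "exp (- real b) \<le> u"
    proof -
      have "(1 / 2 :: real) ^ b = 1 / 2 ^ b" by (simp add: power_divide)
      also have "\<dots> \<le> 1 / (1 / u)" using b_low u0 by (intro divide_left_mono) auto
      finally show ?thesis using exp_minus_nat_le[of b] by simp
    qed
    then have "exp (- real b) ^ 6 \<le> u ^ 6" by (intro power_mono) auto
    then show "p \<le> 2 * u ^ 6" by (simp add: p_def b_def exp_of_nat_mult[symmetric])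
  qed (simp add: p_def)
  have m2p: "m2 * p \<le> 4 * C * u ^ 3"
  proof -
    have "m2 \<le> 2 * (C / u ^ 3)" using m2 X by linarith
    then have "m2 * p \<le> 2 * (C / u ^ 3) * (2 * u ^ 6)" using p m20 u0 C by (intro mult_mono) auto
    also have "\<dots> = 4 * C * u ^ 3" using u0 by (simp add: field_simps power_numeral_reduce)
    finally show ?thesis .
  qed
  have Cu: "400 * (C * u) \<le> 1"
  proof -
    have "u \<le> 1 / (400 * C)" using u\<eta> \<eta> by linarith
    then show ?thesis using C by (simp add: field_simps)
  qed
  have mp0: "0 < m2 * p" using m20 p by simp
  have step: "2 ^ b * (m2 * p) \<le> u / 50"
  proof -
    have "2 ^ b * (m2 * p) \<le> (2 / u) * (4 * C * u ^ 3)" using b_up m2p mp0 u0 by (intro mult_mono[of "2 ^ b" "2 / u" "m2 * p"]) auto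
    also have "\<dots> = 8 * (C * u) * u" using u0 by (simp add: field_simps power_numeral_reduce)
    also have "\<dots> \<le> (8 / 400) * u" using Cu u0 by (intro mult_right_mono) auto
    finally show ?thesis by simp
  qed
  have "1 * (m2 * p) \<le> 2 ^ b * (m2 * p)" using mp0 by (intro mult_right_mono) auto
  then show "m2 * p < 1" using step u1 by simp
  have t1: "k4 / m2 \<le> 1 / (6 * n)"
  proof -
    have "6 * n * k4 \<le> m2" using X(3) m2 by linarith
    then show ?thesis using m20 n0 by (simp add: field_simps)
  qed
  have t2: "exp (- 2 * \<eta> * m2) \<le> 1 / (6 * n)"
  proof -
    have "2 * \<eta> * X \<le> 2 * \<eta> * m2" using m2 \<eta> by (intro mult_left_mono) auto
    then have le: "6 * n \<le> 2 * \<eta> * m2" using X(4) by linarith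
    have "exp (- (2 * \<eta> * m2)) \<le> exp (- real (6 * n))" using le by simp
    also have "\<dots> \<le> 1 / real (6 * n)" using n by (intro exp_minus_le_inverse) auto
    finally show ?thesis by simp
  qed
  have t3: "N * exp (- (\<rho> * real (c * (n * b)) / 2)) \<le> 1 / (6 * n)"
  proof -
    have "real N \<le> 2 ^ (b * n)" using N by (metis of_nat_le_iff of_nat_numeral of_nat_power)
    also have "\<dots> \<le> exp 1 ^ (b * n)" using exp_ge_add_one_self[of 1] by (intro power_mono) auto
    also have "\<dots> = exp (real (n * b))" by (simp add: exp_of_nat_mult[symmetric] mult.commute)
    finally have "real N \<le> exp (real (n * b))" .
    moreover have "exp (- (\<rho> * real (c * (n * b)) / 2)) \<le> exp (- (4 * real (n * b)))"
    proof -
      have "8 * real (n * b) \<le> \<rho> * c * real (n * b)" using c by (intro mult_right_mono) auto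
      then show ?thesis by (simp add: mult.assoc)
    qed
    ultimately have "N * exp (- (\<rho> * real (c * (n * b)) / 2)) \<le> exp (real (n * b)) * exp (- (4 * real (n * b)))"
      by (intro mult_mono) auto
    also have "\<dots> = exp (- (3 * real (n * b)))" by (simp add: exp_add[symmetric])
    also have "\<dots> \<le> exp (- real (6 * n))"
    proof -
      have "6 * n \<le> 3 * (n * b)" using b2 by simp
      then have "real (6 * n) \<le> real (3 * (n * b))" by (rule of_nat_mono)
      then show ?thesis by simp
    qed
    also have "\<dots> \<le> 1 / real (6 * n)" using n by (intro exp_minus_le_inverse) auto
    finally show ?thesis by simp
  qed
  have t4: "N * exp (- (\<rho> * real (c * (n * b)))) \<le> 1 / (6 * n)"
  proof -
    have "0 \<le> \<rho> * real (c * (n * b))" using c by simp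
    then have "exp (- (\<rho> * real (c * (n * b)))) \<le> exp (- (\<rho> * real (c * (n * b)) / 2))"
      unfolding exp_le_cancel_iff by linarith
    then have "N * exp (- (\<rho> * real (c * (n * b)))) \<le> N * exp (- (\<rho> * real (c * (n * b)) / 2))"
      by (rule mult_left_mono) simp
    then show ?thesis using t3 by linarith
  qed
  have t5: "N * (3 * (m2 * p) ^ n) \<le> 1 / (6 * n)"
  proof -
    have "real N \<le> 2 ^ (b * n)" using N by (metis of_nat_le_iff of_nat_numeral of_nat_power)
    then have "N * (3 * (m2 * p) ^ n) \<le> 2 ^ (b * n) * (3 * (m2 * p) ^ n)"
      using mp0 by (intro mult_right_mono) auto
    also have "\<dots> = 3 * (2 ^ b * (m2 * p)) ^ n" by (simp add: power_mult power_mult_distrib)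
    also have "\<dots> \<le> 3 * (u / 50) ^ n" using step mp0 by (intro mult_left_mono power_mono) auto
    also have "\<dots> \<le> 3 * (u / 50) ^ 1" using u0 u1 n by (intro mult_left_mono power_decreasing) auto
    also have "\<dots> \<le> 1 / (6 * n)"
    proof -
      have "18 * (n * u) \<le> 50" using nn by linarith
      then show ?thesis using n0 by (simp add: field_simps)
    qed
    finally show ?thesis .
  qed
  have "1 / (6 * real n) = 1 / n / 6" by simp
  then show "1 / (6 * n) + k4 / m2 + exp (- 2 * \<eta> * m2) +
      N * (exp (- (\<rho> * real (c * (n * b)))) + exp (- (\<rho> * real (c * (n * b)) / 2)) + 3 * (m2 * p) ^ n) \<le> 1 / n"
    using t1 t2 t3 t4 t5 unfolding distrib_left by linarith
qed

text \<open>The numerator is an empty sum, so the denominators do not matter.\<close>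

lemma out_no_samples: "filtering.out n 0 r b \<rho> \<theta> Y = 0"
proof -
  interpret filtering n 0 r b \<rho> \<theta> Y .
  show ?thesis unfolding out_def by (simp add: case_prod_beta qf_gram)
qed

text \<open>The factor computed by the program is \<open>4 * T\<^sup>2\<close> with
  \<open>T powr \<gamma> = 6 * 2 ^ J\<close>. For \<open>J = level b\<close> this is at least
  \<open>6 * b\<close>, the exponent in \<open>failure_bound\<close>.\<close>

lemma threshold_eq:
  assumes "0 < \<gamma>"
  shows "4 * 6 powr (2 / \<gamma>) * ((2 :: real) powr (2 / \<gamma>)) ^ J = 4 * ((6 * 2 ^ J) powr (1 / \<gamma>))\<^sup>2"
proof -
  have "((6 * 2 ^ J :: real) powr (1 / \<gamma>))\<^sup>2 = (6 * 2 ^ J) powr (2 / \<gamma>)"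
    by (simp add: power2_eq_square powr_add[symmetric])
  also have "\<dots> = 6 powr (2 / \<gamma>) * (2 ^ J) powr (2 / \<gamma>)" by (simp add: powr_mult)
  also have "(2 ^ J :: real) powr (2 / \<gamma>) = (2 powr (2 / \<gamma>)) ^ J"
    by (simp add: powr_realpow[symmetric] powr_powr mult.commute)
  finally show ?thesis by simp
qed

text \<open>With \<open>w = n + ln (1 / \<eta>)\<close> the batch size is at most quadratic in
  \<open>w\<close>, so the fifth power in \<open>time_bound\<close> has degree 10.\<close>

lemma time_polynomial:
  fixes n h c :: nat and \<eta> :: real
  assumes n: "1 \<le> n" and \<eta>: "0 < \<eta>" "\<eta> < 1"
  defines "b \<equiv> bits n \<eta>"
  defines "r \<equiv> c * (n * b)"
  assumes t: "t \<le> 2 * h + 6 * b + 8 + T_core n h b r"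
  shows "real t \<le> (real (2 * h) + 1) * (250 * (5 + 3 * real c) ^ 5 * (real n + ln (1 / \<eta>)) ^ 10)"
proof -
  define w where "w = real n + ln (1 / \<eta>)"
  have "0 \<le> ln (1 / \<eta>)" using \<eta> by (intro ln_ge_zero) auto
  then have w: "1 \<le> w" "real n \<le> w" using n by (auto simp: w_def)
  have b: "real b \<le> 3 * w"
  proof -
    have "ln (real n / \<eta>) = ln (real n) + ln (1 / \<eta>)" using n \<eta> by (simp add: ln_div)
    also have "\<dots> \<le> w" using n ln_le_minus_one[of "real n"] by (simp add: w_def)
    finally show ?thesis using bits_le[OF n \<eta>] w by (simp add: b_def)
  qed
  define z where "z = n + b + r + 1"
  have "real z \<le> (5 + 3 * real c) * w\<^sup>2"
  proof -
    have "real n * real b \<le> w * (3 * w)" using w b by (intro mult_mono) auto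
    then have "real r \<le> real c * (3 * w\<^sup>2)"
      unfolding r_def by (simp add: power2_eq_square mult_left_mono)
    moreover have "w \<le> w\<^sup>2" using w power_increasing[of 1 2 w] by simp
    moreover have "(5 + 3 * real c) * w\<^sup>2 = 5 * w\<^sup>2 + real c * (3 * w\<^sup>2)" by (simp add: algebra_simps)
    moreover have "real z = real n + real b + real r + 1" by (simp add: z_def)
    ultimately show ?thesis using w b by linarith
  qed
  then have z5: "real z ^ 5 \<le> ((5 + 3 * real c) * w\<^sup>2) ^ 5" by (intro power_mono) auto
  have "real t \<le> real (250 * (z ^ 5 * (h + 1)))"
    using t time_bound[of h b n r] by (intro of_nat_mono) (simp add: z_def)
  also have "\<dots> = (real h + 1) * (250 * real z ^ 5)" by (simp add: algebra_simps)
  also have "\<dots> \<le> (real (2 * h) + 1) * (250 * ((5 + 3 * real c) * w\<^sup>2) ^ 5)"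
    using z5 by (intro mult_mono) auto
  also have "((5 + 3 * real c) * w\<^sup>2) ^ 5 = (5 + 3 * real c) ^ 5 * w ^ 10"
    by (simp add: power_mult_distrib power_mult[symmetric])
  finally show ?thesis by (simp add: w_def mult_ac)
qed

text \<open>The construction takes only about \<open>n ^ 3 / \<eta>\<^sup>2 + n * b\<close> samples;
  the logarithms are slack. The factor \<open>ln n\<close> is at least 1/2 because
  \<open>n \<ge> 2\<close>, which doubles the constant.\<close>

lemma sample_size_bound:
  fixes n c :: nat and \<eta> C :: real
  assumes n: "2 \<le> n" and \<eta>: "0 < \<eta>" "\<eta> \<le> 1 / 100" and C: "0 \<le> C"
  shows "real (2 * (c * (n * bits n \<eta>) + nat \<lceil>C * (real n ^ 3 / \<eta>\<^sup>2)\<rceil>)) \<le>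
    (12 * real c + 4 * C + 4) * (real n ^ 3 * (ln (real n / \<eta>))\<^sup>2 * ln (real n) / \<eta>\<^sup>2)"
proof -
  define L where "L = ln (real n / \<eta>)"
  define G where "G = real n ^ 3 * L\<^sup>2 / \<eta>\<^sup>2"
  have n0: "2 \<le> real n" using n by simp
  have L: "1 \<le> L"
  proof -
    have "exp 1 \<le> (3 :: real)" by (rule exp_le)
    also have "3 \<le> real n / \<eta>" using n0 \<eta> by (simp add: le_divide_eq)
    finally have "ln (exp 1) \<le> L" unfolding L_def by (intro ln_mono) auto
    then show ?thesis by simp
  qed
  have e1: "1 \<le> 1 / \<eta>\<^sup>2" using \<eta> by (simp add: power_le_one)
  have n3: "real n \<le> real n ^ 3" using power_increasing[of 1 3 "real n"] n0 by simp
  have L2: "1 \<le> L\<^sup>2" "L \<le> L\<^sup>2" using L power_increasing[of 1 2 L] by (auto simp: one_le_power)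
  have G1: "real n ^ 3 / \<eta>\<^sup>2 \<le> G"
  proof -
    have "real n ^ 3 / \<eta>\<^sup>2 * 1 \<le> real n ^ 3 / \<eta>\<^sup>2 * L\<^sup>2" using L2 by (intro mult_left_mono) auto
    then show ?thesis by (simp add: G_def)
  qed
  have G2: "real n * L \<le> G"
  proof -
    have "(real n * L) * 1 \<le> (real n ^ 3 * L\<^sup>2) * (1 / \<eta>\<^sup>2)"
      using n3 L2 L e1 n0 by (intro mult_mono) auto
    then show ?thesis by (simp add: G_def)
  qed
  have G3: "1 \<le> G" using mult_mono[of 1 "real n" 1 L] n0 L G2 by simp
  have lnn: "1 / 2 \<le> ln (real n)"
  proof -
    have "ln 2 \<le> ln (real n)" using n0 by (intro ln_mono) auto
    then show ?thesis using ln2_ge_two_thirds by simp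
  qed
  have b: "real (bits n \<eta>) \<le> 3 * L"
    using bits_le[of n \<eta>] n \<eta> L by (simp add: L_def)
  have "real (nat \<lceil>C * (real n ^ 3 / \<eta>\<^sup>2)\<rceil>) \<le> C * (real n ^ 3 / \<eta>\<^sup>2) + 1"
  proof -
    have "0 \<le> C * (real n ^ 3 / \<eta>\<^sup>2)" using C by simp
    then show ?thesis by linarith
  qed
  also have "\<dots> \<le> C * G + G" using G1 G3 C by (intro add_mono mult_left_mono) auto
  finally have a: "real (nat \<lceil>C * (real n ^ 3 / \<eta>\<^sup>2)\<rceil>) \<le> C * G + G" .
  have "real n * real (bits n \<eta>) \<le> real n * (3 * L)" using b by (intro mult_left_mono) auto
  then have "real n * real (bits n \<eta>) \<le> 3 * G" using G2 by simp
  then have "real c * (real n * real (bits n \<eta>)) \<le> real c * (3 * G)" by (intro mult_left_mono) auto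
  then have "real (2 * (c * (n * bits n \<eta>) + nat \<lceil>C * (real n ^ 3 / \<eta>\<^sup>2)\<rceil>)) \<le> 2 * (real c * (3 * G) + (C * G + G))"
    using a by simp
  also have "\<dots> = (12 * real c + 4 * C + 4) * (G * (1 / 2))" by (simp add: algebra_simps)
  also have "\<dots> \<le> (12 * real c + 4 * C + 4) * (G * ln (real n))"
    using lnn G3 C by (intro mult_left_mono) auto
  finally show ?thesis by (simp add: G_def L_def mult_ac)
qed

text \<open>In \<open>C\<close>, the summand \<open>6 * k 2\<close> pays for the covariance entries,
  \<open>6 * k 4\<close> for the fourth moment in the chosen direction, and 3 for the number of
  outlier pairs. \<open>c\<close> is the batch size per direction bit required by the union
  bound.\<close>

lemma estimator_accuracy:
  fixes n :: nat and \<gamma> \<eta> :: real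
  defines "k \<equiv> moment_const \<gamma>"
  defines "\<rho> \<equiv> 1 / (8 * k 2)" and "C \<equiv> 6 * k 2 + 6 * k 4 + 3"
  defines "c \<equiv> nat \<lceil>8 / \<rho>\<rceil>" and "m \<equiv> nat \<lceil>C * (real n ^ 3 / \<eta>\<^sup>2)\<rceil>"
  defines "h \<equiv> c * (n * bits n \<eta>) + m"
  assumes \<gamma>: "0 < \<gamma>" and n: "2 \<le> n"
    and eta: "0 < \<eta>" "\<eta> \<le> 1 / 100" "\<eta> \<le> \<rho> / 16" "\<eta> \<le> 1 / (400 * C)"
    and D: "distribution_on n D" "has_mean_and_covariance n D \<mu> S" "concentrated n D \<mu> S \<gamma>"
  shows "with_prob_at_least (noise_space (2 * h) \<eta> D) (1 - 1 / real n)
    (\<lambda>\<omega>. \<exists>t y. computes (Estimator \<rho> (4 * 6 powr (2 / \<gamma>)) (2 powr (2 / \<gamma>)) c) n (2 * h) \<eta> (noisy_samples adv \<omega>) t y \<and>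
      (1 - (1 + (7 + sqrt (k 2 + 1)) / 2) * \<eta>) * operator_norm n S \<le> y \<and>
      y \<le> (1 + ((1 + 1200 * (8 * k 1 / \<rho>)) * 36 powr (2 / \<gamma>)) * (\<eta> * ln (real n / \<eta>) powr (2 / \<gamma>))) * operator_norm n S)"
proof -
  define b where "b = bits n \<eta>"
  define r where "r = c * (n * b)"
  define s where "s = operator_norm n S"
  define J where "J = level b"
  define T where "T = (6 * 2 ^ J) powr (1 / \<gamma>)"
  have k: "1 \<le> k q" for q unfolding k_def by (rule moment_const_ge_1[OF \<gamma>])
  have \<rho>0: "0 < \<rho>" using k[of 2] by (simp add: \<rho>_def)
  have C: "3 \<le> C" "6 * k 4 \<le> C" "6 * k 2 \<le> C" using k[of 2] k[of 4] by (auto simp: C_def)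
  have c: "8 \<le> \<rho> * c"
  proof -
    have "8 / \<rho> \<le> real c" unfolding c_def by linarith
    then show ?thesis using \<rho>0 by (simp add: divide_le_eq mult.commute)
  qed
  have c0: "0 < c" using c by (cases c) auto
  have X: "0 < C * (real n ^ 3 / \<eta>\<^sup>2)" using C n eta by simp
  have m: "C * (real n ^ 3 / \<eta>\<^sup>2) \<le> real m" "real m \<le> C * (real n ^ 3 / \<eta>\<^sup>2) + 1"
    unfolding m_def using X by linarith+
  have m0: "0 < m" using m X by (cases m) auto
  have h: "h = r + m" "r < h" using m0 by (auto simp: h_def r_def b_def)
  interpret noisy n D \<mu> S \<gamma> \<eta>
    by unfold_locales (use D \<gamma> eta in auto)
  have n1: "1 \<le> n" using n by simp
  interpret noisy_sample n D \<mu> S \<gamma> \<eta> h r s \<rho>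
    by unfold_locales (use h eta S.operator_norm[OF n1] in \<open>auto simp: s_def s2_def \<rho>_def k_def\<close>)
  have "real h - real r = real m" using h(1) by simp
  then have m2m: "m2 = real m" unfolding m2_def .
  obtain x where x: "dot n x x = 1" "(1 - \<eta>) * s \<le> s2 x"
    using S.operator_norm(3)[OF n1 eta(1)] by (auto simp: s_def s2_def)
  define p where "p = 2 * exp (- (6 * real b))"
  have b_le: "real b \<le> 2 ^ J"
    using level_props(1)[of b] unfolding J_def by (metis of_nat_le_iff of_nat_numeral of_nat_power)
  have T\<gamma>: "T powr \<gamma> = 6 * 2 ^ J" using \<gamma> by (simp add: T_def powr_powr)
  have T1: "1 \<le> T"
  proof -
    have "(1 :: real) \<le> 2 ^ J" by simp
    then have "(1 :: real) \<le> 6 * 2 ^ J" by linarith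
    then show ?thesis using \<gamma> unfolding T_def by (intro ge_one_powr_ge_zero) auto
  qed
  have p: "2 * exp (- (T powr \<gamma>)) \<le> p" "0 < p" unfolding T\<gamma> using b_le by (auto simp: p_def)
  note fb = failure_bound[OF n eta(1,2,4) C(1,2) _ m \<rho>0 c card_dirs[of "bits n \<eta>"], folded b_def, folded p_def r_def]
  have k4: "0 \<le> k 4" using k[of 4] by simp
  have mp: "m2 * p < 1" using fb(1)[OF k4] by (simp add: m2m)
  have q: "(real n)\<^sup>2 * \<kappa> 2 \<le> 1 / (6 * real n) * (m2 * \<eta>\<^sup>2)"
  proof -
    have "6 * k 2 * (real n ^ 3 / \<eta>\<^sup>2) \<le> m2"
      using m(1) C(3) mult_right_mono[of "6 * k 2" C "real n ^ 3 / \<eta>\<^sup>2"] by (simp add: m2m)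
    then show ?thesis using n eta by (simp add: k_def field_simps power_numeral_reduce)
  qed
  from good_event[OF _ q finite_dirs, of T p b x]
  obtain E where E: "E \<in> sets \<Omega>" and
    prob: "1 - (1 / (6 * real n) + \<kappa> 4 / m2 + exp (- 2 * \<eta> * m2) +
      card (dirs b) * (exp (- (\<rho> * r)) + exp (- (\<rho> * r / 2)) + 3 * (m2 * p) ^ n)) \<le> \<Omega>.prob E" and
    good: "\<And>\<omega>. \<omega> \<in> E \<Longrightarrow> \<omega> \<in> space \<Omega> \<and> \<omega> \<notin> bad_cov \<and> \<omega> \<notin> bad_fourth x \<and> \<omega> \<notin> bad_out \<and>
      (\<forall>v\<in>dirs b. \<omega> \<notin> bad_low v \<and> \<omega> \<notin> bad_high v \<and> \<omega> \<notin> bad_tail T v)"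
    using T1 p mp by auto
  have "1 - 1 / real n \<le> \<Omega>.prob E"
    using prob fb(2)[OF k4] unfolding m2m k_def by linarith
  moreover have "\<exists>t y. computes (Estimator \<rho> (4 * 6 powr (2 / \<gamma>)) (2 powr (2 / \<gamma>)) c) n (2 * h) \<eta> (noisy_samples adv \<omega>) t y \<and>
      (1 - (1 + (7 + sqrt (k 2 + 1)) / 2) * \<eta>) * s \<le> y \<and>
      y \<le> (1 + ((1 + 1200 * (8 * k 1 / \<rho>)) * 36 powr (2 / \<gamma>)) * (\<eta> * ln (real n / \<eta>) powr (2 / \<gamma>))) * s"
    if \<omega>: "\<omega> \<in> E" for \<omega>
  proof -
    obtain Y t where Y: "\<forall>i<h. \<forall>j<n. Y i j = noisy_samples adv \<omega> (2 * i) j - noisy_samples adv \<omega> (2 * i + 1) j"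
      and comp: "computes (Estimator \<rho> (4 * 6 powr (2 / \<gamma>)) (2 powr (2 / \<gamma>)) c) n (2 * h) \<eta> (noisy_samples adv \<omega>) t
        (filtering.out n h r b \<rho> (4 * T\<^sup>2) Y)"
      using computes_Estimator[OF eta(1), where h = h and x = "noisy_samples adv \<omega>" and n = n and c = c and \<rho> = \<rho>
        and ?\<theta>0.0 = "4 * 6 powr (2 / \<gamma>)" and \<kappa> = "2 powr (2 / \<gamma>)"]
      unfolding b_def[symmetric] r_def[symmetric] J_def[symmetric] threshold_eq[OF \<gamma>] T_def[symmetric] by blast
    have b2: "2 \<le> b" using fb(3)[OF k4] .
    have r0: "0 < r" using c0 n b2 by (simp add: r_def)
    have bn: "real n / \<eta> \<le> 2 ^ b" using bits_props(1)[of \<eta> n] eta by (simp add: b_def divide_le_eq)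
    have m2_ge: "real (Suc n * n * n) \<le> \<eta>\<^sup>2 * m2"
    proof -
      have "real (Suc n * n * n) \<le> 2 * real n ^ 3"
        using n by (simp add: power_numeral_reduce algebra_simps)
      also have "\<dots> \<le> C * real n ^ 3" using C by (intro mult_right_mono) auto
      also have "\<dots> = \<eta>\<^sup>2 * (C * (real n ^ 3 / \<eta>\<^sup>2))" using eta by simp
      also have "\<dots> \<le> \<eta>\<^sup>2 * m2" using m(1) unfolding m2m by (intro mult_left_mono) auto
      finally show ?thesis .
    qed
    note go = good_output[OF n1 bn r0 T1 m2_ge x, of \<omega> Y adv]
    define y where "y = filtering.out n h r b \<rho> (4 * T\<^sup>2) Y"
    have lo: "(1 - lower_const * \<eta>) * s \<le> y" and up: "y \<le> (1 + (1 + 1200 * c2) * (\<eta> * T\<^sup>2)) * s"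
      unfolding y_def using go good[OF \<omega>] Y by auto
    \<comment> \<open>Rounding \<open>b\<close> up to a power of two costs a factor 2, and
      \<open>b\<close> is at most \<open>3 * ln (n / \<eta>)\<close>; with the 6 in \<open>T\<close>
      this gives 36.\<close>
    have "T\<^sup>2 \<le> 36 powr (2 / \<gamma>) * ln (real n / \<eta>) powr (2 / \<gamma>)"
    proof -
      have L: "1 \<le> ln (real n / \<eta>)"
      proof -
        have "exp 1 \<le> (3 :: real)" by (rule exp_le)
        also have "3 \<le> real n / \<eta>" using n eta by (simp add: le_divide_eq)
        finally have "ln (exp 1) \<le> ln (real n / \<eta>)" by (intro ln_mono) auto
        then show ?thesis by simp
      qed
      have "(2 :: real) ^ J \<le> 2 * real b"
      proof -
        have "2 ^ J \<le> 2 * b" unfolding J_def using b2 by (intro level_upper) simp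
        then have "real (2 ^ J) \<le> real (2 * b)" by (rule of_nat_mono)
        then show ?thesis by simp
      qed
      also have "\<dots> \<le> 2 * (3 * ln (real n / \<eta>))"
        using bits_le[OF n1, of \<eta>] eta L by (simp add: b_def)
      finally have "6 * 2 ^ J \<le> 36 * ln (real n / \<eta>)" by simp
      then have "(6 * 2 ^ J) powr (2 / \<gamma>) \<le> (36 * ln (real n / \<eta>)) powr (2 / \<gamma>)"
        using \<gamma> by (intro powr_mono2) auto
      moreover have "T\<^sup>2 = (6 * 2 ^ J) powr (2 / \<gamma>)"
        by (simp add: T_def power2_eq_square powr_add[symmetric])
      moreover have "(36 * ln (real n / \<eta>)) powr (2 / \<gamma>) = 36 powr (2 / \<gamma>) * ln (real n / \<eta>) powr (2 / \<gamma>)"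
        using L by (simp add: powr_mult)
      ultimately show ?thesis by simp
    qed
    then have "(1 + 1200 * c2) * (\<eta> * T\<^sup>2) \<le> (1 + 1200 * c2) * (\<eta> * (36 powr (2 / \<gamma>) * ln (real n / \<eta>) powr (2 / \<gamma>)))"
      using eta k[of 1] \<rho>0 unfolding c2_def k_def by (intro mult_left_mono) auto
    then have "(1 + (1 + 1200 * c2) * (\<eta> * T\<^sup>2)) * s \<le>
        (1 + ((1 + 1200 * c2) * 36 powr (2 / \<gamma>)) * (\<eta> * ln (real n / \<eta>) powr (2 / \<gamma>))) * s"
      using s(1) by (intro mult_right_mono) (auto simp: mult_ac)
    then have "y \<le> (1 + ((1 + 1200 * (8 * k 1 / \<rho>)) * 36 powr (2 / \<gamma>)) * (\<eta> * ln (real n / \<eta>) powr (2 / \<gamma>))) * s"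
      using up unfolding c2_def k_def by linarith
    moreover have "(1 - (1 + (7 + sqrt (k 2 + 1)) / 2) * \<eta>) * s \<le> y"
      using lo unfolding lower_const_def k_def .
    ultimately show ?thesis using comp unfolding y_def by blast
  qed
  ultimately show ?thesis
    unfolding with_prob_at_least_def \<Omega>_noise_space[symmetric] s_def[symmetric] using E by blast
qed

theorem theorem1p6:
  shows "\<exists>\<eta>\<^sub>0>0. \<forall>\<gamma>>0.
    \<exists>(p :: prog) (m :: nat \<Rightarrow> real \<Rightarrow> nat) (C\<^sub>m :: real) (C\<^sub>l :: real) (C\<^sub>u :: real)
      (C\<^sub>t :: real) (d :: nat) (k :: nat). k \<ge> 1 \<and>
    (\<forall>n\<ge>1. \<forall>\<eta>. 0 < \<eta> \<and> \<eta> < 1 \<and> \<eta> < \<eta>\<^sub>0 \<longrightarrow>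
      real (m n \<eta>) \<le> C\<^sub>m * (real n ^ 3 * (ln (real n / \<eta>))\<^sup>2 * ln (real n) / \<eta>\<^sup>2) \<and>
      (\<forall>x. \<exists>t y. computes p n (m n \<eta>) \<eta> x t y \<and>
        real t \<le> (real (m n \<eta>) + 1) * (C\<^sub>t * (real n + ln (1 / \<eta>)) ^ d)) \<and>
      (\<forall>D \<mu> S adv.
        distribution_on n D \<and> has_mean_and_covariance n D \<mu> S \<and> concentrated n D \<mu> S \<gamma> \<longrightarrow>
        with_prob_at_least (noise_space (m n \<eta>) \<eta> D) (1 - 1 / real n ^ k)
          (\<lambda>\<omega>. \<exists>t y. computes p n (m n \<eta>) \<eta> (noisy_samples adv \<omega>) t y \<and>
            (1 - C\<^sub>l * \<eta>) * operator_norm n S \<le> y \<and>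
            y \<le> (1 + C\<^sub>u * (\<eta> * ln (real n / \<eta>) powr (2 / \<gamma>))) * operator_norm n S)))"
proof (rule exI[of _ 1], rule conjI, simp, intro allI impI)
  fix \<gamma> :: real assume \<gamma>: "0 < \<gamma>"
  define k where "k = moment_const \<gamma>"
  define \<rho> where "\<rho> = 1 / (8 * k 2)"
  define C where "C = 6 * k 2 + 6 * k 4 + 3"
  define c where "c = nat \<lceil>8 / \<rho>\<rceil>"
  \<comment> \<open>The smallness required by the analysis depends on \<open>\<gamma>\<close>, so it
    cannot serve as the universal constant. The latter is 1, and the range above
    \<open>\<eta>1\<close> is absorbed by \<open>Cl\<close>.\<close>
  define \<eta>1 where "\<eta>1 = min (1 / 100) (min (\<rho> / 16) (1 / (400 * C)))"
  define p where "p = Estimator \<rho> (4 * 6 powr (2 / \<gamma>)) (2 powr (2 / \<gamma>)) c"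
  \<comment> \<open>If \<open>n = 1\<close> or \<open>\<eta> > \<eta>1\<close>, no samples are taken and the output is \<open>0\<close>: then \<open>1 - 1 / n = 0\<close>,
    respectively \<open>Cl * \<eta> \<ge> 1\<close>.\<close>
  define large where "large = (\<lambda>(n :: nat) \<eta>. 2 \<le> n \<and> \<eta> \<le> \<eta>1)"
  define h where "h = (\<lambda>n \<eta>. if large n \<eta> then c * (n * bits n \<eta>) + nat \<lceil>C * (real n ^ 3 / \<eta>\<^sup>2)\<rceil> else 0)"
  define Cl where "Cl = max (1 + (7 + sqrt (k 2 + 1)) / 2) (1 / \<eta>1)"
  define Cu where "Cu = (1 + 1200 * (8 * k 1 / \<rho>)) * 36 powr (2 / \<gamma>)"
  have k: "1 \<le> k q" for q unfolding k_def by (rule moment_const_ge_1[OF \<gamma>])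
  have \<rho>0: "0 < \<rho>" using k[of 2] by (simp add: \<rho>_def)
  have C: "3 \<le> C" using k[of 2] k[of 4] by (simp add: C_def)
  have \<eta>1: "0 < \<eta>1" using \<rho>0 C by (simp add: \<eta>1_def)
  have Cu: "0 \<le> Cu" using k[of 1] \<rho>0 by (simp add: Cu_def)
  have size: "real (2 * h n \<eta>) \<le> (12 * real c + 4 * C + 4) * (real n ^ 3 * (ln (real n / \<eta>))\<^sup>2 * ln (real n) / \<eta>\<^sup>2)"
    if "1 \<le> n" "0 < \<eta>" "\<eta> < 1" for n \<eta>
  proof (cases "large n \<eta>")
    case True
    then show ?thesis
      using sample_size_bound[of n \<eta> C c] that C by (simp add: h_def large_def \<eta>1_def)
  next
    case False
    have "0 \<le> ln (real n)" using that by simp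
    then show ?thesis using False that C by (simp add: h_def)
  qed
  have time: "\<exists>t y. computes p n (2 * h n \<eta>) \<eta> x t y \<and>
      real t \<le> (real (2 * h n \<eta>) + 1) * (250 * (5 + 3 * real c) ^ 5 * (real n + ln (1 / \<eta>)) ^ 10)"
    if "1 \<le> n" "0 < \<eta>" "\<eta> < 1" for n \<eta> x
    using computes_Estimator[OF that(2), where h = "h n \<eta>" and x = x and n = n and c = c and \<rho> = \<rho>
        and ?\<theta>0.0 = "4 * 6 powr (2 / \<gamma>)" and \<kappa> = "2 powr (2 / \<gamma>)"]
      time_polynomial[OF that, of _ "h n \<eta>" c] unfolding p_def by blast
  have accuracy: "with_prob_at_least (noise_space (2 * h n \<eta>) \<eta> D) (1 - 1 / real n ^ 1)
      (\<lambda>\<omega>. \<exists>t y. computes p n (2 * h n \<eta>) \<eta> (noisy_samples adv \<omega>) t y \<and>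
        (1 - Cl * \<eta>) * operator_norm n S \<le> y \<and>
        y \<le> (1 + Cu * (\<eta> * ln (real n / \<eta>) powr (2 / \<gamma>))) * operator_norm n S)"
    if n: "1 \<le> n" and \<eta>: "0 < \<eta>" "\<eta> < 1"
      and D: "distribution_on n D" "has_mean_and_covariance n D \<mu> S" "concentrated n D \<mu> S \<gamma>" for n \<eta> D \<mu> S adv
  proof -
    interpret noisy n D \<mu> S \<gamma> \<eta>
      by unfold_locales (use D \<gamma> \<eta> in auto)
    have s: "0 \<le> operator_norm n S" by (rule S.operator_norm(1)[OF n])
    consider "large n \<eta>" | "n = 1" | "\<not> large n \<eta>" "2 \<le> n" using n by force
    then show ?thesis
    proof cases
      case 1
      then have hn: "2 * h n \<eta> = 2 * (c * (n * bits n \<eta>) + nat \<lceil>C * (real n ^ 3 / \<eta>\<^sup>2)\<rceil>)"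
        by (simp add: h_def)
      have Cl: "(1 - Cl * \<eta>) * operator_norm n S \<le> (1 - (1 + (7 + sqrt (k 2 + 1)) / 2) * \<eta>) * operator_norm n S"
        using s \<eta> by (intro mult_right_mono diff_left_mono) (auto simp: Cl_def)
      have "with_prob_at_least (noise_space (2 * h n \<eta>) \<eta> D) (1 - 1 / real n)
        (\<lambda>\<omega>. \<exists>t y. computes p n (2 * h n \<eta>) \<eta> (noisy_samples adv \<omega>) t y \<and>
          (1 - (1 + (7 + sqrt (k 2 + 1)) / 2) * \<eta>) * operator_norm n S \<le> y \<and>
          y \<le> (1 + Cu * (\<eta> * ln (real n / \<eta>) powr (2 / \<gamma>))) * operator_norm n S)"
        unfolding hn p_def Cu_def
        using estimator_accuracy[OF \<gamma> _ \<eta>(1) _ _ _ D, folded k_def, folded \<rho>_def, folded C_def c_def, of adv] 1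
        by (simp add: large_def \<eta>1_def)
      then show ?thesis
        unfolding with_prob_at_least_def power_one_right using order_trans[OF Cl] by blast
    next
      \<comment> \<open>For \<open>n = 1\<close> the factor \<open>ln n\<close> in the sample bound
        is 0 and leaves no samples at all; the required probability is 0 as well, so the empty event
        serves.\<close>
      case 2
      then show ?thesis unfolding with_prob_at_least_def by (intro bexI[of _ "{}"]) auto
    next
      case 3
      have h0: "h n \<eta> = 0" using 3 by (simp add: h_def)
      interpret \<Omega>: prob_space "noise_space (2 * h n \<eta>) \<eta> D"
        unfolding noise_space_def N_def[symmetric] by (rule prob_space_PiM) (rule N.prob_space_axioms)
      have "\<eta>1 < \<eta>" using 3 by (simp add: large_def)
      then have "1 \<le> 1 / \<eta>1 * \<eta>" using \<eta>1 by (simp add: field_simps)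
      also have "\<dots> \<le> Cl * \<eta>" using \<eta> by (intro mult_right_mono) (auto simp: Cl_def)
      finally have "(1 - Cl * \<eta>) * operator_norm n S \<le> 0"
        using s by (intro mult_nonpos_nonneg) auto
      moreover have "0 \<le> (1 + Cu * (\<eta> * ln (real n / \<eta>) powr (2 / \<gamma>))) * operator_norm n S"
        using s Cu \<eta> by (intro mult_nonneg_nonneg add_nonneg_nonneg) auto
      moreover have "\<exists>t. computes p n (2 * h n \<eta>) \<eta> x t 0" for x
        using computes_Estimator[OF \<eta>(1), where h = "h n \<eta>" and x = x and n = n and c = c and \<rho> = \<rho>
        and ?\<theta>0.0 = "4 * 6 powr (2 / \<gamma>)" and \<kappa> = "2 powr (2 / \<gamma>)"]
        unfolding p_def h0 out_no_samples by blast
      ultimately have "\<exists>t y. computes p n (2 * h n \<eta>) \<eta> x t y \<and>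
          (1 - Cl * \<eta>) * operator_norm n S \<le> y \<and>
          y \<le> (1 + Cu * (\<eta> * ln (real n / \<eta>) powr (2 / \<gamma>))) * operator_norm n S" for x
        by blast
      then show ?thesis
        unfolding with_prob_at_least_def
        by (intro bexI[of _ "space (noise_space (2 * h n \<eta>) \<eta> D)"]) (auto simp: \<Omega>.prob_space)
    qed
  qed
  show "\<exists>(p :: prog) (m :: nat \<Rightarrow> real \<Rightarrow> nat) (C\<^sub>m :: real) (C\<^sub>l :: real) (C\<^sub>u :: real)
      (C\<^sub>t :: real) (d :: nat) (k :: nat). k \<ge> 1 \<and>
    (\<forall>n\<ge>1. \<forall>\<eta>. 0 < \<eta> \<and> \<eta> < 1 \<and> \<eta> < 1 \<longrightarrow>
      real (m n \<eta>) \<le> C\<^sub>m * (real n ^ 3 * (ln (real n / \<eta>))\<^sup>2 * ln (real n) / \<eta>\<^sup>2) \<and>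
      (\<forall>x. \<exists>t y. computes p n (m n \<eta>) \<eta> x t y \<and>
        real t \<le> (real (m n \<eta>) + 1) * (C\<^sub>t * (real n + ln (1 / \<eta>)) ^ d)) \<and>
      (\<forall>D \<mu> S adv.
        distribution_on n D \<and> has_mean_and_covariance n D \<mu> S \<and> concentrated n D \<mu> S \<gamma> \<longrightarrow>
        with_prob_at_least (noise_space (m n \<eta>) \<eta> D) (1 - 1 / real n ^ k)
          (\<lambda>\<omega>. \<exists>t y. computes p n (m n \<eta>) \<eta> (noisy_samples adv \<omega>) t y \<and>
            (1 - C\<^sub>l * \<eta>) * operator_norm n S \<le> y \<and>
            y \<le> (1 + C\<^sub>u * (\<eta> * ln (real n / \<eta>) powr (2 / \<gamma>))) * operator_norm n S)))"
    apply (rule exI[of _ p], rule exI[of _ "\<lambda>n \<eta>. 2 * h n \<eta>"], rule exI[of _ "12 * real c + 4 * C + 4"],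
        rule exI[of _ Cl], rule exI[of _ Cu], rule exI[of _ "250 * (5 + 3 * real c) ^ 5"],
        rule exI[of _ 10], rule exI[of _ 1])
    apply (intro conjI allI impI order_refl)
    using size apply blast
    using time apply blast
    using accuracy apply blast
    done
qed

end
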